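(* Let $\Omega$ be a Polish space, let $\nu$ be a belief measure on $(\Omega,\mathcal{B}(\Omega))$, and let $\nu^\infty$ be the associated i.i.d. product belief measure on $(\Omega^\infty,\mathcal{B}(\Omega^\infty))$. Let $\{Y_i\}_{i=1}^\infty$ be a sequence of bounded random variables on $(\Omega,\mathcal{B}(\Omega))$ that are identically distributed with respect to $\nu$, let $M=\inf\{C\ge 0:\nu(|Y_i|\le C)=1\}$, and put $X_i(\omega_1,\omega_2,\dots):=Y_i(\omega_i)$ for $i\ge 1$ and $(\omega_1,\omega_2,\dots)\in\Omega^\infty$. Let $$\underline{\mu}=\int_0^M\nu(Y_i\ge t)\,dt+\int_{-M}^0[\nu(Y_i\ge t)-1]\,dt,\qquad \bar\mu=\int_0^M\nu^*(Y_i\ge t)\,dt+\int_{-M}^0[\nu^*(Y_i\ge t)-1]\,dt,$$ $$\underline{\sigma}^2=\int_0^M 2t\,\nu(Y_i\ge t)\,dt+\int_{-M}^0 2t[\nu(Y_i\ge t)-1]\,dt-\underline{\mu}^2,$$ $$\bar\sigma^2=\int_0^M 2t\,\nu^*(Y_i\ge t)\,dt+\int_{-M}^0 2t[\nu^*(Y_i\ge t)-1]\,dt-\bar\mu^2,$$ with $\underline\sigma,\bar\sigma\ge0$ the nonnegative square roots; assume $\underline\sigma>0$ and $\bar\sigma>0$, and let $$\rho=\frac{M^2-M\bar\mu+M\underline{\mu}-\int_{-M}^M\int_{-M}^{t_2}\nu(t_1\le Y_i\le t_2)\,dt_1\,dt_2-\underline{\mu}\,\bar\mu}{\underline{\sigma}\,\bar\sigma}$$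 (none of these quantities depends on $i$). Then there is a constant $K$, not depending on $\alpha_1$, $\alpha_2$ or $n$, such that for all $\alpha_1,\alpha_2\in\mathbb{R}$ and all $n\ge1$, $$\left|\nu^\infty\Big(\alpha_1\sqrt n\,\underline{\sigma}+n\underline{\mu}\le\sum_{i=1}^nX_i\le\alpha_2\sqrt n\,\bar\sigma+n\bar\mu\Big)-\mathbf{N}_2(-\alpha_1,\alpha_2;-\rho)\right|\le\frac{K}{\sqrt n}.$$ Moreover, the same estimate holds if $\alpha_1$ and $\alpha_2$ are allowed to depend on $n$ (i.e. are replaced by $\alpha_{1,n},\alpha_{2,n}$ for arbitrary real sequences).
   Context: $\mathcal{B}(\cdot)$ denotes the Borel $\sigma$-algebra. $\mathcal{K}(\Omega)$ is the set of (nonempty) compact subsets of the Polish space $\Omega$, with the Hausdorff topology. A belief measure on $(\Omega,\mathcal{B}(\Omega))$ is a set function $\nu:\mathcal{B}(\Omega)\to[0,1]$ such that: (i) $\nu(\emptyset)=0$, $\nu(\Omega)=1$; (ii) $\nu(A)\le\nu(B)$ for Borel $A\subset B$; (iii) $\nu(B_n)\downarrow\nu(B)$ for Borel sets $B_n\downarrow B$; (iv) $\nu(G)=\sup\{\nu(K):K\subset G,\ K\text{ compact}\}$ for every open $G$; (v) for all Borel $B_1,\dots,B_n$, $\nu(\bigcup_{j=1}^nB_j)\ge\sum_{\emptyset\ne I\subset\{1,\dots,n\}}(-1)^{|I|+1}\nu(\bigcap_{j\in I}B_j)$. Its conjugate is $\nu^*(A)=1-\nu(A^c)$. For every $A\in\mathcal{B}(\Omega)$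 the set $\{K\in\mathcal{K}(\Omega):K\subset A\}$ is universally measurable. By Choquet's theorem (known), $\nu$ is a belief measure if and only if there is a probability measure $P_\nu$ on $(\mathcal{K}(\Omega),\mathcal{B}(\mathcal{K}(\Omega)))$, uniquely extended to the universally measurable sets and still denoted $P_\nu$, with $\nu(A)=P_\nu(\{K\in\mathcal{K}(\Omega):K\subset A\})$ for all $A\in\mathcal{B}(\Omega)$. Let $P_\nu^\infty$ be the i.i.d. product probability measure on $(\mathcal{K}(\Omega))^\infty$ with marginals $P_\nu$ (extended to universally measurable sets). For $A\in\mathcal{B}(\Omega^\infty)$ define $$\nu^\infty(A)=P_\nu^\infty\big(\{(K_1,K_2,\dots)\in(\mathcal{K}(\Omega))^\infty:K_1\times K_2\times\cdots\subset A\}\big).$$ It is known that $\nu^\infty$ is a belief measure on $(\Omega^\infty,\mathcal{B}(\Omega^\infty))$. Random variables $\{Y_i\}$ on $(\Omega,\mathcal{B}(\Omega))$ are identically distributed with respect to $\nu$ if $\nu(Y_i\in G)=\nu(Y_j\in G)$ for all $i,j\ge1$ and all intervals $G\subset\mathbb{R}$. The number $\rho$ is the correlation coefficient under $P_\nu^\infty$ of $\inf_{\omega\in K_i}Y_i(\omega)$ and $\sup_{\omega\in K_i}Y_i(\omega)$ (as functions of $(K_1,K_2,\dots)$), so $\rho\in[-1,1]$. For $r\in[-1,1]$, $\mathbf{N}_2(a,b;r)=\Pr(B_1\le a,\,B_2\le b)$, where $(B_1,B_2)$ is bivariate normal with zero means, unit variances and correlation coefficient $r$. *)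

theory Defs
  imports "HOL-Probability.Probability"
begin

section \<open>The space of nonempty compact sets with the Hausdorff topology\<close>

definition compacts :: "'a::metric_space set set" where
  "compacts = {K. compact K \<and> K \<noteq> {}}"

text \<open>The value outside \<^term>\<open>compacts\<close> is irrelevant; it is set to 0 because the locale
  \<^locale>\<open>Metric_space\<close> requires a distance that is nonnegative everywhere.\<close>

definition hausdorff_dist :: "'a::metric_space set \<Rightarrow> 'a set \<Rightarrow> real" where
  "hausdorff_dist K L =
     (if K \<in> compacts \<and> L \<in> compacts
      then max (SUP x\<in>K. infdist x L) (SUP y\<in>L. infdist y K) else 0)"

lemma infdist_bdd_above_compact:
  assumes "compact K"
  shows "bdd_above ((\<lambda>x. infdist x L) ` K)"
proof -
  have "compact ((\<lambda>x. infdist x L) ` K)"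
    by (intro compact_continuous_image continuous_intros assms)
  then show ?thesis
    by (intro bounded_imp_bdd_above compact_imp_bounded)
qed

lemma infdist_le_hausdorff_dist:
  assumes "K \<in> compacts" "L \<in> compacts" "x \<in> K"
  shows "infdist x L \<le> hausdorff_dist K L"
proof -
  have "infdist x L \<le> (SUP x\<in>K. infdist x L)"
    using assms by (intro cSUP_upper infdist_bdd_above_compact) (auto simp: compacts_def)
  then show ?thesis
    using assms by (auto simp: hausdorff_dist_def)
qed

lemma hausdorff_dist_commute: "hausdorff_dist K L = hausdorff_dist L K"
  by (auto simp: hausdorff_dist_def max.commute)

lemma Metric_space_hausdorff: "Metric_space compacts hausdorff_dist"
proof
  fix K L N :: "'a set"
  show "0 \<le> hausdorff_dist K L"
  proof (cases "K \<in> compacts \<and> L \<in> compacts")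
    case True
    then obtain x where "x \<in> K" by (auto simp: compacts_def)
    with True show ?thesis
      using infdist_le_hausdorff_dist infdist_nonneg order_trans by blast
  next
    case False
    then show ?thesis by (auto simp: hausdorff_dist_def)
  qed
  show "hausdorff_dist K L = hausdorff_dist L K"
    by (rule hausdorff_dist_commute)
  assume K: "K \<in> compacts" and L: "L \<in> compacts"
  have sub: "A \<subseteq> B" if "A \<in> compacts" "B \<in> compacts" "hausdorff_dist A B = 0" for A B :: "'a set"
  proof
    fix x assume "x \<in> A"
    then have "infdist x B = 0"
      using infdist_le_hausdorff_dist[OF that(1,2)] that(3) infdist_nonneg[of x B] by fastforce
    then show "x \<in> B"
      using that(2) in_closed_iff_infdist_zero[of B x] by (auto simp: compacts_def compact_imp_closed)
  qed
  show "hausdorff_dist K L = 0 \<longleftrightarrow> K = L"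
  proof
    assume "hausdorff_dist K L = 0"
    then show "K = L" using sub[OF K L] sub[OF L K] by (auto simp: hausdorff_dist_commute)
  next
    assume "K = L"
    then show "hausdorff_dist K L = 0"
      using K by (auto simp: hausdorff_dist_def compacts_def)
  qed
  assume N: "N \<in> compacts"
  have half: "(SUP x\<in>A. infdist x C) \<le> hausdorff_dist A B + hausdorff_dist B C"
    if A: "A \<in> compacts" and B: "B \<in> compacts" and C: "C \<in> compacts" for A B C :: "'a set"
  proof (rule cSUP_least)
    show "A \<noteq> {}" using A by (simp add: compacts_def)
    fix x assume x: "x \<in> A"
    obtain y where y: "y \<in> B" "\<And>z. z \<in> B \<Longrightarrow> dist x y \<le> dist x z"
      using continuous_attains_inf[of B "dist x"] B
        continuous_on_dist[OF continuous_on_const continuous_on_id, of B x]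
      by (auto simp: compacts_def)
    have xy: "dist x y \<le> infdist x B"
      using y(1) by (subst infdist_notempty) (auto intro!: cINF_greatest y(2))
    have "infdist x C \<le> infdist y C + dist x y"
      by (rule infdist_triangle)
    then show "infdist x C \<le> hausdorff_dist A B + hausdorff_dist B C"
      using infdist_le_hausdorff_dist[OF A B x] infdist_le_hausdorff_dist[OF B C y(1)] xy
      by linarith
  qed
  show "hausdorff_dist K N \<le> hausdorff_dist K L + hausdorff_dist L N"
    using half[OF K L N] half[OF N L K] K N
    by (simp add: hausdorff_dist_def[of K N] hausdorff_dist_commute)
qed

definition hyperspace_borel :: "'a::metric_space set measure" where
  "hyperspace_borel = sigma compacts {U. openin (Metric_space.mtopology compacts hausdorff_dist) U}"

section \<open>Belief measures\<close>

text \<open>A set function is represented by a total function on \<^typ>\<open>'a set\<close>; only its values on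
  Borel sets matter.\<close>

definition belief_measure :: "('a::polish_space set \<Rightarrow> real) \<Rightarrow> bool" where
  "belief_measure \<nu> \<longleftrightarrow>
     (\<forall>A\<in>sets borel. 0 \<le> \<nu> A \<and> \<nu> A \<le> 1) \<and>
     \<nu> {} = 0 \<and> \<nu> UNIV = 1 \<and>
     (\<forall>A\<in>sets borel. \<forall>B\<in>sets borel. A \<subseteq> B \<longrightarrow> \<nu> A \<le> \<nu> B) \<and>
     (\<forall>B :: nat \<Rightarrow> 'a set. range B \<subseteq> sets borel \<and> decseq B \<longrightarrow>
        (\<lambda>n. \<nu> (B n)) \<longlonglongrightarrow> \<nu> (\<Inter>n. B n)) \<and>
     (\<forall>G. open G \<longrightarrow> \<nu> G = (SUP K\<in>{K. compact K \<and> K \<subseteq> G}. \<nu> K)) \<and>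
     (\<forall>n. \<forall>B :: nat \<Rightarrow> 'a set. (\<forall>j<n. B j \<in> sets borel) \<longrightarrow>
        \<nu> (\<Union>j<n. B j) \<ge> (\<Sum>I | I \<noteq> {} \<and> I \<subseteq> {..<n}. (-1) ^ (card I + 1) * \<nu> (\<Inter>j\<in>I. B j)))"

definition conjugate :: "('a set \<Rightarrow> real) \<Rightarrow> 'a set \<Rightarrow> real" where
  "conjugate \<nu> A = 1 - \<nu> (- A)"

text \<open>\<open>P\<close> is the measure \<open>P\<^sub>\<nu>\<close> of Choquet's theorem. The sets \<open>{K. K \<subseteq> A}\<close> with \<open>A\<close> Borel are
  universally measurable but in general not Borel, so \<open>P\<close> is evaluated on them through its
  completion, which contains all universally measurable sets.\<close>

definition choquet_measure :: "('a::polish_space set \<Rightarrow> real) \<Rightarrow> 'a set measure \<Rightarrow> bool" where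
  "choquet_measure \<nu> P \<longleftrightarrow>
     prob_space P \<and> sets P = sets hyperspace_borel \<and>
     (\<forall>A\<in>sets borel. {K\<in>compacts. K \<subseteq> A} \<in> sets (completion P) \<and>
        \<nu> A = measure (completion P) {K\<in>compacts. K \<subseteq> A})"

text \<open>The set function \<open>\<nu>\<^sup>\<infinity>\<close>, in terms of \<open>P = P\<^sub>\<nu>\<close>. Coordinates of sequences are indexed from 0,
  and \<^term>\<open>Pi UNIV Ks\<close> is the product of the sets \<^term>\<open>Ks i\<close>.\<close>

definition iid_product_belief :: "'a::polish_space set measure \<Rightarrow> (nat \<Rightarrow> 'a) set \<Rightarrow> real" where
  "iid_product_belief P A =
     measure (completion (Pi\<^sub>M UNIV (\<lambda>_. P)))
       {Ks :: nat \<Rightarrow> 'a set. (\<forall>i. Ks i \<in> compacts) \<and> Pi UNIV Ks \<subseteq> A}"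

definition identically_distributed_wrt ::
    "('a set \<Rightarrow> real) \<Rightarrow> (nat \<Rightarrow> 'a \<Rightarrow> real) \<Rightarrow> bool" where
  "identically_distributed_wrt \<nu> Y \<longleftrightarrow>
     (\<forall>i j. \<forall>G. is_interval G \<longrightarrow> \<nu> {\<omega>. Y i \<omega> \<in> G} = \<nu> {\<omega>. Y j \<omega> \<in> G})"

section \<open>Means, variances and correlation\<close>

definition belief_bound :: "('a set \<Rightarrow> real) \<Rightarrow> ('a \<Rightarrow> real) \<Rightarrow> real" where
  "belief_bound \<nu> Z = Inf {C. C \<ge> 0 \<and> \<nu> {\<omega>. \<bar>Z \<omega>\<bar> \<le> C} = 1}"

text \<open>In the next two definitions \<open>\<kappa>\<close> is \<open>\<nu>\<close> or its conjugate, and \<open>M\<close> is the bound computed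
  from \<open>\<nu>\<close> in both cases.\<close>

definition choquet_mean :: "real \<Rightarrow> ('a set \<Rightarrow> real) \<Rightarrow> ('a \<Rightarrow> real) \<Rightarrow> real" where
  "choquet_mean M \<kappa> Z =
     (LBINT t:{0..M}. \<kappa> {\<omega>. Z \<omega> \<ge> t}) + (LBINT t:{-M..0}. \<kappa> {\<omega>. Z \<omega> \<ge> t} - 1)"

definition choquet_variance :: "real \<Rightarrow> ('a set \<Rightarrow> real) \<Rightarrow> ('a \<Rightarrow> real) \<Rightarrow> real" where
  "choquet_variance M \<kappa> Z =
     (LBINT t:{0..M}. 2 * t * \<kappa> {\<omega>. Z \<omega> \<ge> t})
     + (LBINT t:{-M..0}. 2 * t * (\<kappa> {\<omega>. Z \<omega> \<ge> t} - 1))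
     - (choquet_mean M \<kappa> Z)\<^sup>2"

definition lower_mean :: "('a set \<Rightarrow> real) \<Rightarrow> ('a \<Rightarrow> real) \<Rightarrow> real" where
  "lower_mean \<nu> Z = choquet_mean (belief_bound \<nu> Z) \<nu> Z"

definition upper_mean :: "('a set \<Rightarrow> real) \<Rightarrow> ('a \<Rightarrow> real) \<Rightarrow> real" where
  "upper_mean \<nu> Z = choquet_mean (belief_bound \<nu> Z) (conjugate \<nu>) Z"

definition lower_sd :: "('a set \<Rightarrow> real) \<Rightarrow> ('a \<Rightarrow> real) \<Rightarrow> real" where
  "lower_sd \<nu> Z = sqrt (choquet_variance (belief_bound \<nu> Z) \<nu> Z)"

definition upper_sd :: "('a set \<Rightarrow> real) \<Rightarrow> ('a \<Rightarrow> real) \<Rightarrow> real" where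
  "upper_sd \<nu> Z = sqrt (choquet_variance (belief_bound \<nu> Z) (conjugate \<nu>) Z)"

definition belief_correlation :: "('a set \<Rightarrow> real) \<Rightarrow> ('a \<Rightarrow> real) \<Rightarrow> real" where
  "belief_correlation \<nu> Z =
     (let M = belief_bound \<nu> Z; ml = lower_mean \<nu> Z; mu = upper_mean \<nu> Z in
       (M\<^sup>2 - M * mu + M * ml
        - (LBINT t2:{-M..M}. (LBINT t1:{-M..t2}. \<nu> {\<omega>. t1 \<le> Z \<omega> \<and> Z \<omega> \<le> t2}))
        - ml * mu) / (lower_sd \<nu> Z * upper_sd \<nu> Z))"

section \<open>The bivariate normal distribution function\<close>

text \<open>For \<open>-1 \<le> r \<le> 1\<close>, if \<open>Z1\<close> and \<open>Z2\<close> are independent standard normal variables then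
  \<open>(Z1, r * Z1 + sqrt (1 - r\<^sup>2) * Z2)\<close> is bivariate normal with zero means, unit variances and
  correlation \<open>r\<close>; the degenerate cases \<open>r = 1\<close> and \<open>r = -1\<close> have no joint density.\<close>

definition bivariate_normal :: "real \<Rightarrow> (real \<times> real) measure" where
  "bivariate_normal r =
     distr (density lborel std_normal_density \<Otimes>\<^sub>M density lborel std_normal_density) borel
       (\<lambda>(z1, z2). (z1, r * z1 + sqrt (1 - r\<^sup>2) * z2))"

definition bivariate_normal_cdf :: "real \<Rightarrow> real \<Rightarrow> real \<Rightarrow> real" where
  "bivariate_normal_cdf a b r = measure (bivariate_normal r) {(x, y). x \<le> a \<and> y \<le> b}"

end

theory Submission
  imports Defs
begin

text \<open>A compact set \<open>K\<close> drawn from \<open>P\<close> turns \<open>Y\<close> into the pair of its infimum and its supremum over \<open>K\<close>, and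
  the Choquet integrals in the statement are the moments of this pair. A product of nonempty sets lies in the event
  exactly when the sum of the infima and the sum of the suprema satisfy the respective bounds, so the theorem is a
  Berry--Esseen bound for quadrants and i.i.d. bounded vectors in the plane. In coordinates in which the covariance is
  the identity, quadrants become wedges \<open>w\<^sub>1 \<le> a\<close>, \<open>r w\<^sub>1 + q w\<^sub>2 \<le> b\<close> with \<open>r\<^sup>2 + q\<^sup>2 = 1\<close>; the case \<open>q = 0\<close> is the
  degenerate limit.

  The bound is obtained without characteristic functions of the sums, by Lindeberg replacement and induction on \<open>n\<close>.
  Replacing one summand by a Gaussian one in the presence of independent Gaussian noise of variance \<open>s\<close> changes the
  expectation of \<open>F\<close> by \<open>O(sup \<bar>F\<bar> s\<^sup>-\<^sup>3\<^sup>/\<^sup>2)\<close>, because the first two moments agree. In the \<open>k\<close>-th replacement, the sum of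
  the first \<open>k\<close> vectors is compared with its Gaussian counterpart: the error is at most the Kolmogorov distance
  \<open>\<Delta>\<^sub>k\<close>, and the Gaussian counterpart only adds to the noise. With extra noise of variance \<open>t\<close>, smoothing gives
  \<open>\<Delta>\<^sub>n = O(n\<^sup>-\<^sup>1\<^sup>/\<^sup>2 + \<Sum>\<^sub>k \<Delta>\<^sub>k (n - k + t)\<^sup>-\<^sup>3\<^sup>/\<^sup>2 + (t/n)\<^sup>1\<^sup>/\<^sup>2)\<close>, and for a large constant \<open>t\<close> the induction closes.\<close>

section \<open>Averaging operators and Gaussian smoothing\<close>

text \<open>The test functions are indicators, so no derivative may fall on them. It falls on the
  Gaussian density of the noise instead, through translation of the Gaussian measure
  (\<open>integral_gauss2_shift\<close>), and this requires noise that is nondegenerate in every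
  direction. A law with correlation of modulus 1 would spoil that; it is therefore written as a
  linear image of an isotropic law, which moves the degeneracy into the test set, where only the
  Gaussian measure of strips with unit normals matters.

  The induction can close because k^(-1/2) convolved with (n - k + t)^(-3/2) is O((t n)^(-1/2)): the
  rate n^(-1/2) is reproduced with a factor t^(-1/2), while the cost of smoothing with a large t
  only enlarges the additive constant. The hypothesis must be uniform in the corner of the wedge and
  in the shift, since smoothing moves both.

  On the side of belief measures, the envelopes of a Borel function are known to be measurable only
  for the completion of \<open>P\<close>, and extrema over a compact set need not be attained. Hence
  the Borel versions, the approximating points and the countable sets of exceptional levels.\<close>

text \<open>The bound is carried as a parameter because the replacement error is linear in it: it is
  used with 1 for the indicators and with the current Kolmogorov distance for their
  differences.\<close>

definition bounded_borel :: "real \<Rightarrow> (real \<times> real \<Rightarrow> real) \<Rightarrow> bool" where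
  "bounded_borel B F \<longleftrightarrow> F \<in> borel_measurable borel \<and> (\<forall>x. \<bar>F x\<bar> \<le> B)"

definition borel_prob :: "(real \<times> real) measure \<Rightarrow> bool" where
  "borel_prob \<mu> \<longleftrightarrow> prob_space \<mu> \<and> sets \<mu> = sets borel"

text \<open>Convolution as an operator on test functions: \<open>(avg \<mu> ^^ n) F z\<close> is the
  expectation of F at z plus a sum of n independent vectors with law \<mu>. Independent sums thus
  need no product space before the belief measure enters, and exchanging summands is commutation of
  operators.\<close>

definition avg :: "(real \<times> real) measure \<Rightarrow> (real \<times> real \<Rightarrow> real) \<Rightarrow> real \<times> real \<Rightarrow> real" where
  "avg \<mu> F z = (\<integral>x. F (z + x) \<partial>\<mu>)"

lemma bounded_borelD:
  "bounded_borel B F \<Longrightarrow> \<bar>F x\<bar> \<le> B" "bounded_borel B F \<Longrightarrow> F \<in> borel_measurable borel"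
  unfolding bounded_borel_def by blast+

lemma bounded_borelI:
  "F \<in> borel_measurable borel \<Longrightarrow> (\<And>x. \<bar>F x\<bar> \<le> B) \<Longrightarrow> bounded_borel B F"
  unfolding bounded_borel_def by blast

lemma bounded_borel_nonneg: "bounded_borel B F \<Longrightarrow> 0 \<le> B"
  unfolding bounded_borel_def using abs_ge_zero order_trans by blast

lemma bounded_borel_shift: "bounded_borel B F \<Longrightarrow> bounded_borel B (\<lambda>x. F (z + c *\<^sub>R x))"
  by (rule bounded_borelI) (auto intro: bounded_borelD measurable_compose[OF _ bounded_borelD(2)])

lemma bounded_borel_diff:
  "bounded_borel B F \<Longrightarrow> bounded_borel D G \<Longrightarrow> (\<And>x. \<bar>F x - G x\<bar> \<le> E) \<Longrightarrow> bounded_borel E (\<lambda>x. F x - G x)"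
  unfolding bounded_borel_def by auto

lemma integrable_bounded_borel:
  assumes "bounded_borel B F" "borel_prob \<mu>"
  shows "integrable \<mu> F"
proof -
  interpret prob_space \<mu> using assms(2) by (simp add: borel_prob_def)
  have [measurable_cong]: "sets \<mu> = sets borel" using assms(2) by (simp add: borel_prob_def)
  have "F \<in> borel_measurable \<mu>" using assms by (auto simp: bounded_borel_def borel_prob_def cong: measurable_cong_sets)
  then show ?thesis
    using assms(1) by (intro integrable_const_bound[where B=B]) (auto simp: bounded_borel_def)
qed

lemma integrable_bounded_borel_shift:
  assumes "bounded_borel B F" "borel_prob \<mu>"
  shows "integrable \<mu> (\<lambda>x. F (z + x))"
  using integrable_bounded_borel[OF bounded_borel_shift[OF assms(1), where c=1] assms(2)] by simp

lemma integral_bounded_borel: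
  assumes "bounded_borel B F" "borel_prob \<mu>"
  shows "\<bar>integral\<^sup>L \<mu> F\<bar> \<le> B"
proof -
  interpret prob_space \<mu> using assms(2) by (simp add: borel_prob_def)
  have "\<bar>integral\<^sup>L \<mu> F\<bar> \<le> (\<integral>x. \<bar>F x\<bar> \<partial>\<mu>)" by (rule integral_abs_bound)
  also have "\<dots> \<le> (\<integral>x. B \<partial>\<mu>)"
    using integrable_bounded_borel[OF assms] assms(1)
    by (intro integral_mono) (auto simp: bounded_borel_def)
  finally show ?thesis by (simp add: prob_space)
qed

lemma bounded_borel_avg:
  assumes "bounded_borel B F" "borel_prob \<mu>"
  shows "bounded_borel B (avg \<mu> F)"
proof -
  interpret prob_space \<mu> using assms(2) by (simp add: borel_prob_def)
  have [measurable_cong]: "sets \<mu> = sets borel" using assms(2) by (simp add: borel_prob_def)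
  have [measurable]: "F \<in> borel_measurable borel" using assms by (simp add: bounded_borel_def)
  have "avg \<mu> F \<in> borel_measurable borel" unfolding avg_def by measurable
  moreover have "\<bar>avg \<mu> F z\<bar> \<le> B" for z
    unfolding avg_def using integral_bounded_borel[OF bounded_borel_shift[OF assms(1), where c=1] assms(2), of z] by simp
  ultimately show ?thesis by (simp add: bounded_borel_def)
qed

lemma avg_commute:
  assumes F: "bounded_borel B F" and \<mu>: "borel_prob \<mu>" and \<nu>: "borel_prob \<nu>"
  shows "avg \<mu> (avg \<nu> F) = avg \<nu> (avg \<mu> F)"
proof
  fix z
  interpret M: prob_space \<mu> using \<mu> by (simp add: borel_prob_def)
  interpret N: prob_space \<nu> using \<nu> by (simp add: borel_prob_def)
  interpret pair_prob_space \<mu> \<nu> ..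
  have [measurable_cong]: "sets \<mu> = sets borel" "sets \<nu> = sets borel"
    using \<mu> \<nu> by (simp_all add: borel_prob_def)
  have [measurable]: "F \<in> borel_measurable borel" using F by (simp add: bounded_borel_def)
  have "integrable (\<mu> \<Otimes>\<^sub>M \<nu>) (\<lambda>(x, y). F (z + x + y))"
    using bounded_borelD(1)[OF F] by (intro P.integrable_const_bound[where B=B] AE_I2) (auto split: prod.split)
  from Fubini_integral[OF this]
  show "avg \<mu> (avg \<nu> F) z = avg \<nu> (avg \<mu> F) z"
    by (simp add: avg_def algebra_simps)
qed

lemma avg_power_commute:
  assumes F: "bounded_borel B F" and \<mu>: "borel_prob \<mu>" and \<nu>: "borel_prob \<nu>"
  shows "bounded_borel B ((avg \<mu> ^^ n) F) \<and> (avg \<mu> ^^ n) (avg \<nu> F) = avg \<nu> ((avg \<mu> ^^ n) F)"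
proof (induction n)
  case (Suc n)
  then have b: "bounded_borel B ((avg \<mu> ^^ n) F)" by simp
  show ?case using Suc avg_commute[OF b \<mu> \<nu>] bounded_borel_avg[OF b \<mu>] by simp
qed (simp add: F)

lemma bounded_borel_avg_power:
  "bounded_borel B F \<Longrightarrow> borel_prob \<mu> \<Longrightarrow> bounded_borel B ((avg \<mu> ^^ n) F)"
  using avg_power_commute by blast

lemma avg_diff:
  assumes "bounded_borel B F" "bounded_borel D G" "borel_prob \<mu>"
  shows "avg \<mu> (\<lambda>x. F x - G x) z = avg \<mu> F z - avg \<mu> G z"
  unfolding avg_def
  by (rule Bochner_Integration.integral_diff; rule integrable_bounded_borel_shift; fact)

text \<open>Convolution commutes with translations, so a comparison between two translates survives
  any number of averagings. This turns the inclusion of a displaced wedge in a larger one into an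
  inequality of probabilities.\<close>

lemma avg_power_mono:
  assumes "bounded_borel B F" "bounded_borel D G" "borel_prob \<mu>" "\<And>y. F (y + v) \<le> G (y + w)"
  shows "(avg \<mu> ^^ n) F (z + v) \<le> (avg \<mu> ^^ n) G (z + w)"
proof (induction n arbitrary: z)
  case (Suc n)
  have *: "z + v + x = z + x + v" "z + w + x = z + x + w" for x by (auto simp: algebra_simps)
  have "integrable \<mu> (\<lambda>x. (avg \<mu> ^^ n) F (z + x + v))" "integrable \<mu> (\<lambda>x. (avg \<mu> ^^ n) G (z + x + w))"
    using integrable_bounded_borel_shift[OF bounded_borel_avg_power[OF assms(1,3)] assms(3), of n "z+v"]
      integrable_bounded_borel_shift[OF bounded_borel_avg_power[OF assms(2,3)] assms(3), of n "z+w"]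
    unfolding * by auto
  then show ?case
    unfolding funpow.simps comp_apply avg_def[of \<mu> "(avg \<mu> ^^ n) F"] avg_def[of \<mu> "(avg \<mu> ^^ n) G"] *
    by (intro integral_mono Suc)
qed (use assms in auto)

lemma borel_prob_distr:
  assumes "prob_space M" "X \<in> M \<rightarrow>\<^sub>M borel"
  shows "borel_prob (distr M borel X)"
  unfolding borel_prob_def using prob_space.prob_space_distr[OF assms] by simp

section \<open>Isotropic normal measures and their semigroup\<close>

definition gauss2 :: "(real \<times> real) measure" where
  "gauss2 = std_normal_distribution \<Otimes>\<^sub>M std_normal_distribution"

text \<open>A scaled image instead of a density, so that variance 0 is allowed and gives the point
  mass at the origin; the comparison of partial sums begins there, at k = 0.\<close>

definition gauss :: "real \<Rightarrow> (real \<times> real) measure" where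
  "gauss s = distr gauss2 borel (\<lambda>x. sqrt s *\<^sub>R x)"

lemma prob_std_normal: "prob_space std_normal_distribution"
  using real_dist_normal_dist by (rule real_distribution.axioms(1))

lemma borel_prob_gauss2: "borel_prob gauss2"
proof -
  interpret N: prob_space std_normal_distribution by (rule prob_std_normal)
  interpret pair_prob_space std_normal_distribution std_normal_distribution ..
  have "sets gauss2 = sets (borel \<Otimes>\<^sub>M borel)" unfolding gauss2_def by (intro sets_pair_measure_cong) auto
  then show ?thesis
    unfolding borel_prob_def borel_prod by (simp add: gauss2_def P.prob_space_axioms)
qed

lemma sets_gauss2[measurable_cong]: "sets gauss2 = sets borel"
  using borel_prob_gauss2 by (simp add: borel_prob_def)

lemma borel_prob_gauss: "borel_prob (gauss s)"
  unfolding gauss_def using borel_prob_gauss2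
  by (intro borel_prob_distr) (auto simp: borel_prob_def)

lemma avg_gauss:
  assumes "bounded_borel B F"
  shows "avg (gauss s) F z = (\<integral>x. F (z + sqrt s *\<^sub>R x) \<partial>gauss2)"
  using assms unfolding avg_def gauss_def bounded_borel_def
  by (subst integral_distr) auto

lemma avg_gauss_0: "bounded_borel B F \<Longrightarrow> avg (gauss 0) F = F"
  using borel_prob_gauss2 by (auto simp: avg_gauss borel_prob_def prob_space.prob_space)

text \<open>Comparing characteristic functions of single normal variables also covers a = 0 or b =
  0, where there are no two densities to convolve.\<close>

lemma distr_normal_combination:
  "distr (std_normal_distribution \<Otimes>\<^sub>M std_normal_distribution) borel (\<lambda>(x, y). a * x + b * y) =
   distr std_normal_distribution borel (\<lambda>x. sqrt (a\<^sup>2 + b\<^sup>2) * x)" (is "?L = ?R")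
proof -
  let ?N = "std_normal_distribution"
  interpret N: prob_space ?N by (rule prob_std_normal)
  interpret pair_prob_space ?N ?N ..
  have L: "real_distribution ?L"
    unfolding real_distribution_def real_distribution_axioms_def
    by (auto intro!: P.prob_space_distr)
  have R: "real_distribution ?R"
    unfolding real_distribution_def real_distribution_axioms_def
    by (auto intro!: N.prob_space_distr)
  have N: "(\<integral>x. iexp (t * x) \<partial>?N) = complex_of_real (exp (- (t^2) / 2))" for t
    using fun_cong[OF char_std_normal_distribution, of t] by (simp add: char_def)
  have "char ?L t = char ?R t" for t
  proof -
    have "char ?L t = (\<integral>z. iexp (t * (a * fst z + b * snd z)) \<partial>(?N \<Otimes>\<^sub>M ?N))"
      unfolding char_def by (subst integral_distr) (auto simp: case_prod_beta)
    also have "\<dots> = (\<integral>x. (\<integral>y. iexp (t * (a * x + b * y)) \<partial>?N) \<partial>?N)"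
      by (subst integral_fst'[symmetric]) (auto intro!: P.integrable_const_bound[where B=1])
    also have "\<dots> = (\<integral>x. iexp ((t * a) * x) * (\<integral>y. iexp ((t * b) * y) \<partial>?N) \<partial>?N)"
    proof (intro Bochner_Integration.integral_cong refl)
      fix x
      have "(\<integral>y. iexp (t * (a * x + b * y)) \<partial>?N) = (\<integral>y. iexp ((t * a) * x) * iexp ((t * b) * y) \<partial>?N)"
        by (intro Bochner_Integration.integral_cong refl) (simp add: exp_add[symmetric] algebra_simps)
      then show "(\<integral>y. iexp (t * (a * x + b * y)) \<partial>?N) = iexp ((t * a) * x) * (\<integral>y. iexp ((t * b) * y) \<partial>?N)"
        by simp
    qed
    also have "\<dots> = complex_of_real (exp (- ((t*a)^2) / 2)) * complex_of_real (exp (- ((t*b)^2) / 2))"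
      by (simp only: N integral_mult_left_zero integral_mult_left)
    also have "\<dots> = complex_of_real (exp (- ((t * sqrt (a\<^sup>2 + b\<^sup>2))^2) / 2))"
      unfolding of_real_mult[symmetric] exp_add[symmetric]
      by (simp add: power_mult_distrib field_simps)
    also have "\<dots> = (\<integral>x. iexp ((t * sqrt (a\<^sup>2 + b\<^sup>2)) * x) \<partial>?N)"
      by (rule N[symmetric])
    also have "\<dots> = char ?R t"
      unfolding char_def by (subst integral_distr) (auto simp: mult.assoc)
    finally show ?thesis .
  qed
  then show ?thesis by (intro Levy_uniqueness[OF L R]) auto
qed

lemma integral_normal_combination:
  fixes f :: "real \<Rightarrow> real"
  assumes [measurable]: "f \<in> borel_measurable borel" and b: "\<And>x. \<bar>f x\<bar> \<le> B"
  shows "(\<integral>x. (\<integral>y. f (a * x + b * y) \<partial>std_normal_distribution) \<partial>std_normal_distribution) =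
     (\<integral>x. f (sqrt (a\<^sup>2 + b\<^sup>2) * x) \<partial>std_normal_distribution)"
proof -
  let ?N = "std_normal_distribution"
  interpret N: prob_space ?N by (rule prob_std_normal)
  interpret pair_prob_space ?N ?N ..
  have "(\<integral>x. (\<integral>y. f (a * x + b * y) \<partial>?N) \<partial>?N) = (\<integral>z. f (a * fst z + b * snd z) \<partial>(?N \<Otimes>\<^sub>M ?N))"
    by (subst integral_fst'[symmetric]) (auto intro!: P.integrable_const_bound[where B=B] b)
  also have "\<dots> = integral\<^sup>L (distr (?N \<Otimes>\<^sub>M ?N) borel (\<lambda>(x, y). a * x + b * y)) f"
    by (subst integral_distr) (auto simp: case_prod_beta)
  also have "\<dots> = (\<integral>x. f (sqrt (a\<^sup>2 + b\<^sup>2) * x) \<partial>?N)"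
    unfolding distr_normal_combination by (subst integral_distr) auto
  finally show ?thesis .
qed

lemma integral_gauss2:
  assumes F: "bounded_borel B F"
  shows "integral\<^sup>L gauss2 F = (\<integral>x. (\<integral>y. F (x, y) \<partial>std_normal_distribution) \<partial>std_normal_distribution)"
proof -
  interpret N: prob_space std_normal_distribution by (rule prob_std_normal)
  interpret pair_prob_space std_normal_distribution std_normal_distribution ..
  show ?thesis
    using integrable_bounded_borel[OF F borel_prob_gauss2] unfolding gauss2_def
    by (rule integral_fst'[symmetric])
qed

text \<open>Exchanging the two middle integrals brings the two noises of each coordinate together,
  and each pair merges by the one-dimensional identity, since the squares of sqrt s and sqrt t add
  up to s + t.\<close>

lemma gauss_semigroup:
  assumes F: "bounded_borel B F" and st: "0 \<le> s" "0 \<le> t"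
  shows "avg (gauss s) (avg (gauss t) F) = avg (gauss (s + t)) F"
proof
  fix z :: "real \<times> real"
  let ?N = "std_normal_distribution"
  interpret N: prob_space ?N by (rule prob_std_normal)
  interpret pair_prob_space ?N ?N ..
  have [measurable]: "F \<in> borel_measurable borel" using F by (simp add: bounded_borel_def)
  note Fb = bounded_borelD(1)[OF F]
  have [measurable]: "(\<lambda>x. F (f x, g x)) \<in> borel_measurable M"
    if [measurable]: "f \<in> borel_measurable M" "g \<in> borel_measurable M" for f g :: "'b \<Rightarrow> real" and M
    by (rule measurable_compose[of "\<lambda>x. (f x, g x)" M borel]) (auto intro: borel_measurable_Pair)
  \<comment> \<open>This holds for arbitrary f and g: a function that is not integrable has Bochner
    integral 0, which obeys the bound as well.\<close>
  have bb: "\<bar>\<integral>y. F (f y, g y) \<partial>?N\<bar> \<le> B" for f g :: "real \<Rightarrow> real"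
  proof (cases "integrable ?N (\<lambda>y. F (f y, g y))")
    case True
    have "\<bar>\<integral>y. F (f y, g y) \<partial>?N\<bar> \<le> (\<integral>y. \<bar>F (f y, g y)\<bar> \<partial>?N)" by (rule integral_abs_bound)
    also have "\<dots> \<le> (\<integral>y. B \<partial>?N)" using True Fb by (intro integral_mono) auto
    finally show ?thesis using N.prob_space by simp
  next
    case False
    then show ?thesis using bounded_borel_nonneg[OF F] by (simp add: not_integrable_integral_eq)
  qed
  define a b where "a = fst z" and "b = snd z"
  have z: "z = (a, b)" by (simp add: a_def b_def)
  have one: "avg (gauss u) G w = (\<integral>x. (\<integral>y. G (fst w + sqrt u * x, snd w + sqrt u * y) \<partial>?N) \<partial>?N)"
    if "bounded_borel B G" for G u w
    unfolding avg_gauss[OF that] integral_gauss2[OF bounded_borel_shift[OF that]]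
    by (cases w) simp
  have "avg (gauss s) (avg (gauss t) F) z =
     (\<integral>x. (\<integral>y. (\<integral>x'. (\<integral>y'. F (a + sqrt s * x + sqrt t * x', b + sqrt s * y + sqrt t * y') \<partial>?N) \<partial>?N) \<partial>?N) \<partial>?N)"
    unfolding one[OF bounded_borel_avg[OF F borel_prob_gauss]] one[OF F] by (simp add: z add.assoc)
  also have "\<dots> = (\<integral>x. (\<integral>x'. (\<integral>y. (\<integral>y'. F (a + sqrt s * x + sqrt t * x', b + sqrt s * y + sqrt t * y') \<partial>?N) \<partial>?N) \<partial>?N) \<partial>?N)"
  proof (rule Bochner_Integration.integral_cong[OF refl])
    fix x
    have "integrable (?N \<Otimes>\<^sub>M ?N) (\<lambda>(x', y). \<integral>y'. F (a + sqrt s * x + sqrt t * x', b + sqrt s * y + sqrt t * y') \<partial>?N)"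
      by (intro P.integrable_const_bound[where B=B] AE_I2) (auto simp: bb)
    then show "(\<integral>y. (\<integral>x'. (\<integral>y'. F (a + sqrt s * x + sqrt t * x', b + sqrt s * y + sqrt t * y') \<partial>?N) \<partial>?N) \<partial>?N) =
       (\<integral>x'. (\<integral>y. (\<integral>y'. F (a + sqrt s * x + sqrt t * x', b + sqrt s * y + sqrt t * y') \<partial>?N) \<partial>?N) \<partial>?N)"
      by (rule Fubini_integral)
  qed
  also have "\<dots> = (\<integral>x. (\<integral>x'. (\<integral>y. F (a + (sqrt s * x + sqrt t * x'), b + sqrt (s + t) * y) \<partial>?N) \<partial>?N) \<partial>?N)"
  proof (rule Bochner_Integration.integral_cong[OF refl], rule Bochner_Integration.integral_cong[OF refl])
    fix x x'
    show "(\<integral>y. (\<integral>y'. F (a + sqrt s * x + sqrt t * x', b + sqrt s * y + sqrt t * y') \<partial>?N) \<partial>?N) =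
      (\<integral>y. F (a + (sqrt s * x + sqrt t * x'), b + sqrt (s + t) * y) \<partial>?N)"
      using integral_normal_combination[of "\<lambda>u. F (a + sqrt s * x + sqrt t * x', b + u)" B "sqrt s" "sqrt t"] Fb st
      by (simp add: add.assoc)
  qed
  also have "\<dots> = (\<integral>x. (\<integral>y. F (a + sqrt (s + t) * x, b + sqrt (s + t) * y) \<partial>?N) \<partial>?N)"
    using integral_normal_combination[of "\<lambda>u. (\<integral>y. F (a + u, b + sqrt (s + t) * y) \<partial>?N)" B "sqrt s" "sqrt t"] bb st
    by simp
  also have "\<dots> = avg (gauss (s + t)) F z"
    by (subst one[OF F]) (simp add: z)
  finally show "avg (gauss s) (avg (gauss t) F) z = avg (gauss (s + t)) F z" .
qed

section \<open>Translation of the Gaussian measure and exponential tilting\<close>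

lemma gauss2_eq_density:
  "gauss2 = density lborel (\<lambda>z. ennreal (exp (- (norm z)\<^sup>2 / 2) / (2 * pi)))"
proof -
  have *: "std_normal_density (fst z) * std_normal_density (snd z) = exp (- (norm z)\<^sup>2 / 2) / (2 * pi)" for z
    unfolding std_normal_density_def
    by (simp add: norm_prod_def exp_add[symmetric] field_simps real_sqrt_mult[symmetric])
  have "gauss2 = density (lborel \<Otimes>\<^sub>M lborel) (\<lambda>(x, y). ennreal (std_normal_density x) * ennreal (std_normal_density y))"
    unfolding gauss2_def
    by (rule pair_measure_density)
       (auto intro: prob_space_imp_sigma_finite prob_std_normal lborel.sigma_finite_measure_axioms)
  then show ?thesis
    by (simp only: lborel_prod case_prod_beta' ennreal_mult'[OF normal_density_nonneg, symmetric] *)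
qed

text \<open>The Cameron--Martin formula: a translation of the argument becomes a density. The
  dependence on x then sits in an exponential weight and is smooth whatever the regularity of
  F.\<close>

lemma integral_gauss2_shift:
  fixes F :: "real \<times> real \<Rightarrow> real"
  assumes [measurable]: "F \<in> borel_measurable borel"
  shows "(\<integral>z. F (x + z) \<partial>gauss2) = (\<integral>z. F z * exp (x \<bullet> z - (norm x)\<^sup>2 / 2) \<partial>gauss2)"
proof -
  let ?p = "\<lambda>z :: real \<times> real. exp (- (norm z)\<^sup>2 / 2) / (2 * pi)"
  have "(\<integral>z. F (x + z) \<partial>gauss2) = (\<integral>z. ?p z * F (x + z) \<partial>lborel)"
    unfolding gauss2_eq_density by (subst integral_density) auto
  also have "\<dots> = (\<integral>z. ?p (x + z - x) * F (x + z) \<partial>lborel)" by simp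
  also have "\<dots> = (\<integral>z. ?p (z - x) * F z \<partial>distr lborel borel ((+) x))"
    by (subst integral_distr) auto
  also have "\<dots> = (\<integral>z. ?p (z - x) * F z \<partial>lborel)" by (simp add: lborel_distr_plus)
  also have "\<dots> = (\<integral>z. ?p z * (F z * exp (x \<bullet> z - (norm x)\<^sup>2 / 2)) \<partial>lborel)"
  proof (intro Bochner_Integration.integral_cong refl)
    fix z
    have "- (norm (z - x))\<^sup>2 / 2 = - (norm z)\<^sup>2 / 2 + (x \<bullet> z - (norm x)\<^sup>2 / 2)"
      by (simp add: power2_norm_eq_inner inner_diff inner_commute field_simps)
    then have "exp (- (norm (z - x))\<^sup>2 / 2) = exp (- (norm z)\<^sup>2 / 2) * exp (x \<bullet> z - (norm x)\<^sup>2 / 2)"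
      by (metis exp_add)
    then show "?p (z - x) * F z = ?p z * (F z * exp (x \<bullet> z - (norm x)\<^sup>2 / 2))"
      by (simp only: mult_ac times_divide_eq_left times_divide_eq_right)
  qed
  also have "\<dots> = (\<integral>z. F z * exp (x \<bullet> z - (norm x)\<^sup>2 / 2) \<partial>gauss2)"
    unfolding gauss2_eq_density by (subst integral_density) auto
  finally show ?thesis .
qed

text \<open>With u = norm z + 1 this is the fourth power of exp u: a third-order Taylor remainder
  produces a factor exp u and a factor u^3, and u is at most exp u. One integrable majorant then
  serves all remainders and all moments.\<close>

definition gauss_weight :: "real \<times> real \<Rightarrow> real" where
  "gauss_weight z = exp (4 * (norm z + 1))"

definition gauss_const :: real where
  "gauss_const = integral\<^sup>L gauss2 gauss_weight"

text \<open>The translation formula with F = 1 gives the normalised exponential the integral 1,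
  whereas a function that is not integrable would have Bochner integral 0.\<close>

lemma integrable_exp_inner_gauss2: "integrable gauss2 (\<lambda>z. exp (x \<bullet> z))"
proof -
  interpret prob_space gauss2 using borel_prob_gauss2 by (simp add: borel_prob_def)
  have "(\<integral>z. exp (x \<bullet> z - (norm x)\<^sup>2 / 2) \<partial>gauss2) = 1"
    using integral_gauss2_shift[of "\<lambda>_. 1" x] by (simp add: prob_space)
  then have "integrable gauss2 (\<lambda>z. exp (x \<bullet> z - (norm x)\<^sup>2 / 2))"
    using not_integrable_integral_eq by fastforce
  from integrable_mult_right[OF this, of "exp ((norm x)\<^sup>2 / 2)"] show ?thesis
    by (simp add: exp_add[symmetric])
qed

lemma integrable_gauss_weight: "integrable gauss2 gauss_weight"
proof (rule Bochner_Integration.integrable_bound)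
  let ?g = "\<lambda>z. exp 4 * (exp ((4, 4) \<bullet> z) + exp ((4, -4) \<bullet> z) + exp ((-4, 4) \<bullet> z) + exp ((-4, -4) \<bullet> z))"
  show "integrable gauss2 ?g"
    by (intro Bochner_Integration.integrable_add integrable_mult_right integrable_exp_inner_gauss2)
  show "gauss_weight \<in> borel_measurable gauss2" unfolding gauss_weight_def by measurable
  have "gauss_weight z \<le> ?g z" for z :: "real \<times> real"
  proof -
    obtain a b where z: "z = (a, b)" by (cases z)
    have n: "norm z \<le> \<bar>a\<bar> + \<bar>b\<bar>" unfolding z norm_Pair by (simp add: sqrt_sum_squares_le_sum_abs)
    have e: "exp (4 * \<bar>c\<bar>) \<le> exp (4 * c) + exp (-4 * c)" for c :: real by (cases "c \<ge> 0") auto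
    have "gauss_weight z \<le> exp 4 * (exp (4 * \<bar>a\<bar>) * exp (4 * \<bar>b\<bar>))"
      unfolding gauss_weight_def exp_add[symmetric] using n by simp
    also have "\<dots> \<le> exp 4 * ((exp (4 * a) + exp (-4 * a)) * (exp (4 * b) + exp (-4 * b)))"
      by (intro mult_left_mono mult_mono e) auto
    also have "\<dots> = ?g z" by (simp add: z algebra_simps exp_add[symmetric])
    finally show ?thesis .
  qed
  then show "AE z in gauss2. norm (gauss_weight z) \<le> norm (?g z)"
    by (intro AE_I2) (smt (verit) gauss_weight_def exp_gt_zero real_norm_def)
qed

lemma gauss_weight_bound:
  assumes [measurable]: "f \<in> borel_measurable borel" and b: "\<And>z. \<bar>f z\<bar> \<le> K * gauss_weight z"
  shows "integrable gauss2 f" and "\<bar>integral\<^sup>L gauss2 f\<bar> \<le> K * gauss_const"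
proof -
  have i: "integrable gauss2 (\<lambda>z. K * gauss_weight z)"
    by (intro integrable_mult_right integrable_gauss_weight)
  show f: "integrable gauss2 f"
  proof (rule Bochner_Integration.integrable_bound[OF i])
    show "AE z in gauss2. norm (f z) \<le> norm (K * gauss_weight z)"
      by (intro AE_I2) (metis b abs_ge_self order_trans real_norm_def)
  qed measurable
  have "\<bar>integral\<^sup>L gauss2 f\<bar> \<le> (\<integral>z. \<bar>f z\<bar> \<partial>gauss2)" by (rule integral_abs_bound)
  also have "\<dots> \<le> (\<integral>z. K * gauss_weight z \<partial>gauss2)" using f i b by (intro integral_mono) auto
  finally show "\<bar>integral\<^sup>L gauss2 f\<bar> \<le> K * gauss_const" by (simp add: gauss_const_def)
qed

lemma gauss_const_ge: "gauss_const \<ge> 0"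
  unfolding gauss_const_def by (intro Bochner_Integration.integral_nonneg) (simp add: gauss_weight_def)

lemma norm_power_le_gauss_weight: "k \<le> 4 \<Longrightarrow> (norm z + 1) ^ k \<le> gauss_weight z"
proof -
  assume k: "k \<le> 4"
  have "(norm z + 1) ^ k \<le> (norm z + 1) ^ 4" using k by (intro power_increasing) auto
  also have "\<dots> \<le> exp (norm z + 1) ^ 4"
    using exp_ge_add_one_self[of "norm z + 1"] by (intro power_mono) auto
  also have "\<dots> = gauss_weight z" unfolding gauss_weight_def by (simp add: exp_of_nat_mult[symmetric])
  finally show ?thesis .
qed

text \<open>The second-order Taylor polynomial in x of the Cameron--Martin density, that is, its
  Hermite terms of degree at most two.\<close>

definition tilt2 :: "real \<times> real \<Rightarrow> real \<times> real \<Rightarrow> real" where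
  "tilt2 x z = 1 + x \<bullet> z + ((x \<bullet> z)\<^sup>2 - (norm x)\<^sup>2) / 2"

lemma abs_tilt2_le: "\<bar>tilt2 x z\<bar> \<le> 1 + norm x * norm z + ((norm x * norm z)\<^sup>2 + (norm x)\<^sup>2) / 2"
proof -
  have a: "\<bar>x \<bullet> z\<bar> \<le> norm x * norm z" by (rule Cauchy_Schwarz_ineq2)
  then have "(x \<bullet> z)\<^sup>2 \<le> (norm x * norm z)\<^sup>2" by (metis abs_ge_zero power2_abs power_mono)
  then show ?thesis using a zero_le_power2[of "x \<bullet> z"] zero_le_power2[of "norm x"]
    unfolding tilt2_def by (simp add: abs_le_iff field_simps; linarith)
qed

text \<open>Expanding the exponential at y = a - n^2/2 leaves, besides its cubic remainder, the
  terms -a n^2/2 and n^4/8 of y^2/2. For n at most 1 these are of third order too.\<close>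

lemma exp_inner_tilt2:
  fixes x z :: "real \<times> real"
  assumes x: "norm x \<le> 1"
  shows "\<bar>exp (x \<bullet> z - (norm x)\<^sup>2 / 2) - tilt2 x z\<bar> \<le> norm x ^ 3 * gauss_weight z"
proof -
  define n m u a y where "n = norm x" and "m = norm z" and "u = m + 1" and "a = x \<bullet> z" and "y = a - n\<^sup>2 / 2"
  have n: "0 \<le> n" "n \<le> 1" and m: "0 \<le> m" and u: "1 \<le> u" using x by (auto simp: n_def m_def u_def)
  have a: "\<bar>a\<bar> \<le> n * m" unfolding a_def n_def m_def by (rule Cauchy_Schwarz_ineq2)
  have n2: "n\<^sup>2 \<le> n" using n by (simp add: power2_eq_square mult_left_le)
  have "n * u = n * m + n" by (simp add: u_def algebra_simps)
  then have y: "\<bar>y\<bar> \<le> n * u" using a n2 n zero_le_power2[of n] unfolding y_def by linarith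
  obtain t where t: "\<bar>t\<bar> \<le> \<bar>y\<bar>" and e: "exp y = (\<Sum>m<3. (y ^ m) / fact m) + (exp t / fact 3) * y ^ 3"
    using Maclaurin_exp_le[of y 3] by blast
  have e': "exp y = 1 + y + y\<^sup>2 / 2 + exp t / 6 * y ^ 3"
    using e by (simp add: numeral_3_eq_3 lessThan_Suc power2_eq_square)
  have d: "exp y - (1 + a + (a\<^sup>2 - n\<^sup>2) / 2) = - (a * n\<^sup>2 / 2) + n ^ 4 / 8 + exp t / 6 * y ^ 3"
    unfolding e' by (simp add: y_def power2_eq_square power4_eq_xxxx field_simps)
  have E: "exp u ^ 4 = gauss_weight z" unfolding gauss_weight_def u_def m_def by (simp add: exp_of_nat_mult[symmetric])
  have eu: "u \<le> exp u" "2 \<le> exp u" using exp_ge_add_one_self[of u] u by linarith+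
  have nu: "n * u \<le> u" using n u by (simp add: mult_left_le_one_le)
  have t1: "exp t \<le> exp u" using t y nu by simp
  have y3: "\<bar>y ^ 3\<bar> \<le> n ^ 3 * exp u ^ 3"
  proof -
    have "\<bar>y ^ 3\<bar> = \<bar>y\<bar> ^ 3" by (simp add: power_abs)
    also have "\<dots> \<le> (n * exp u) ^ 3" using y eu n by (intro power_mono) (auto intro: order_trans mult_left_mono)
    finally show ?thesis by (simp add: power_mult_distrib)
  qed
  have A: "\<bar>exp t / 6 * y ^ 3\<bar> \<le> n ^ 3 * exp u ^ 4 / 6"
  proof -
    have "\<bar>exp t / 6 * y ^ 3\<bar> = exp t / 6 * \<bar>y ^ 3\<bar>" by (simp add: abs_mult)
    also have "\<dots> \<le> exp u / 6 * (n ^ 3 * exp u ^ 3)" using t1 y3 by (intro mult_mono) auto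
    also have "\<dots> = n ^ 3 * exp u ^ 4 / 6" by (simp add: power4_eq_xxxx power3_eq_cube)
    finally show ?thesis .
  qed
  have Bd: "\<bar>a * n\<^sup>2 / 2\<bar> \<le> n ^ 3 * (m / 2)"
  proof -
    have "\<bar>a * n\<^sup>2 / 2\<bar> = \<bar>a\<bar> * n\<^sup>2 / 2" by (simp add: abs_mult)
    also have "\<dots> \<le> (n * m) * n\<^sup>2 / 2" using a by (intro divide_right_mono mult_right_mono) auto
    finally show ?thesis by (simp add: power2_eq_square power3_eq_cube mult_ac)
  qed
  have Cd: "\<bar>n ^ 4 / 8\<bar> \<le> n ^ 3 * (1 / 8)" using n by (simp add: power_decreasing)
  have "exp u ^ 1 \<le> exp u ^ 3" using eu u by (intro power_increasing) auto
  then have "2 * exp u \<le> exp u * exp u ^ 3" using eu u by (intro mult_mono) auto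
  then have D: "m / 2 + 1 / 8 \<le> exp u ^ 4 / 2" proof -
    assume "2 * exp u \<le> exp u * exp u ^ 3"
    moreover have "exp u * exp u ^ 3 = exp u ^ 4" by (simp add: power4_eq_xxxx power3_eq_cube)
    moreover have "m / 2 + 1 / 8 \<le> u" using m by (simp add: u_def)
    ultimately show ?thesis using eu(1) by linarith
  qed
  have "\<bar>exp y - (1 + a + (a\<^sup>2 - n\<^sup>2) / 2)\<bar> \<le> n ^ 3 * (m / 2) + n ^ 3 * (1 / 8) + n ^ 3 * exp u ^ 4 / 6"
    unfolding d using A Bd Cd by linarith
  also have "\<dots> = n ^ 3 * ((m / 2 + 1 / 8) + exp u ^ 4 / 6)" by (simp add: field_simps)
  also have "\<dots> \<le> n ^ 3 * exp u ^ 4" proof (rule mult_left_mono)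
    have "0 \<le> exp u ^ 4" by simp
    then show "m / 2 + 1 / 8 + exp u ^ 4 / 6 \<le> exp u ^ 4" using D by linarith
  qed (use n in simp)
  finally show ?thesis unfolding E unfolding tilt2_def y_def a_def n_def by simp
qed

lemma measurable_tilt2[measurable]: "tilt2 x \<in> borel_measurable borel"
  unfolding tilt2_def by measurable

lemma abs_tilt2_le_weight: "\<bar>tilt2 x z\<bar> \<le> (1 + norm x)\<^sup>2 * gauss_weight z"
proof -
  let ?n = "norm x" and ?m = "norm z"
  have "\<bar>tilt2 x z\<bar> \<le> 1 + ?n * ?m + ((?n * ?m)\<^sup>2 + ?n\<^sup>2) / 2" by (rule abs_tilt2_le)
  also have "\<dots> \<le> (1 + ?n)\<^sup>2 * (?m + 1)\<^sup>2"
    by (simp add: power2_eq_square algebra_simps)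
  also have "\<dots> \<le> (1 + ?n)\<^sup>2 * gauss_weight z"
    by (intro mult_left_mono norm_power_le_gauss_weight) auto
  finally show ?thesis .
qed

lemma integrable_mult_tilt2:
  assumes F: "bounded_borel B F"
  shows "integrable gauss2 (\<lambda>z. F z * tilt2 x z)"
proof (rule gauss_weight_bound(1))
  note [measurable] = bounded_borelD(2)[OF F]
  show "(\<lambda>z. F z * tilt2 x z) \<in> borel_measurable borel" by measurable
  show "\<bar>F z * tilt2 x z\<bar> \<le> (B * (1 + norm x)\<^sup>2) * gauss_weight z" for z
    using mult_mono[OF bounded_borelD(1)[OF F, of z] abs_tilt2_le_weight[of x z]] bounded_borel_nonneg[OF F]
    by (simp add: abs_mult mult.assoc)
qed

text \<open>For short x the density is expanded. For norm x > 1 the two integrals are estimated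
  separately, as constants and squares are then below the cube. Covering all x allows laws of
  unbounded support to be inserted, the Gaussian one among them.\<close>

lemma gauss2_taylor:
  assumes F: "bounded_borel B F"
  shows "\<bar>(\<integral>z. F (x + z) \<partial>gauss2) - (\<integral>z. F z * tilt2 x z \<partial>gauss2)\<bar> \<le> B * gauss_const * norm x ^ 3"
proof -
  note [measurable] = bounded_borelD(2)[OF F]
  note B = bounded_borel_nonneg[OF F] and iq = integrable_mult_tilt2[OF F, of x]
  show ?thesis
  proof (cases "norm x \<le> 1")
    case True
    let ?e = "\<lambda>z. exp (x \<bullet> z - (norm x)\<^sup>2 / 2)"
    have bd: "\<bar>F z * (?e z - tilt2 x z)\<bar> \<le> (B * norm x ^ 3) * gauss_weight z" for z
      using mult_mono[OF bounded_borelD(1)[OF F, of z] exp_inner_tilt2[OF True, of z]] B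
      by (simp add: abs_mult mult.assoc)
    have m: "(\<lambda>z. F z * (?e z - tilt2 x z)) \<in> borel_measurable borel" by measurable
    have ie: "integrable gauss2 (\<lambda>z. F z * ?e z)"
      using Bochner_Integration.integrable_add[OF gauss_weight_bound(1)[OF m bd] iq]
      by (simp add: algebra_simps)
    have "(\<integral>z. F (x + z) \<partial>gauss2) - (\<integral>z. F z * tilt2 x z \<partial>gauss2) = (\<integral>z. F z * (?e z - tilt2 x z) \<partial>gauss2)"
      unfolding integral_gauss2_shift[OF bounded_borelD(2)[OF F]] right_diff_distrib
      by (rule Bochner_Integration.integral_diff[OF ie iq, symmetric])
    then show ?thesis using gauss_weight_bound(2)[OF m bd] by (simp add: mult_ac)
  next
    case False
    let ?n = "norm x"
    interpret prob_space gauss2 using borel_prob_gauss2 by (simp add: borel_prob_def)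
    have m: "(\<lambda>z. F z * tilt2 x z) \<in> borel_measurable borel" by measurable
    have n: "1 \<le> ?n" "?n \<le> ?n ^ 3" "?n\<^sup>2 \<le> ?n ^ 3" "1 \<le> ?n ^ 3"
      using False power_increasing[of 1 3 ?n] power_increasing[of 2 3 ?n] by auto
    \<comment> \<open>The subtracted 1 pays for the untilted integral, which is at most B, so that
      long x needs no larger constant than short x.\<close>
    have bd: "\<bar>tilt2 x z\<bar> \<le> ?n ^ 3 * gauss_weight z - 1" for z :: "real \<times> real"
    proof -
      let ?m = "norm z"
      have arith: "1 + (1 + p + (q + r) / 2) \<le> 2 * t + p' + (q' + t) / 2"
        if "1 \<le> t" "p \<le> p'" "q \<le> q'" "r \<le> t" for p q r t p' q' :: real
        using that by (simp add: field_simps)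
      have "1 + \<bar>tilt2 x z\<bar> \<le> 1 + (1 + ?n * ?m + (?n\<^sup>2 * ?m\<^sup>2 + ?n\<^sup>2) / 2)"
        using abs_tilt2_le[of x z] by (simp add: power_mult_distrib)
      also have "\<dots> \<le> 2 * ?n ^ 3 + ?n ^ 3 * ?m + (?n ^ 3 * ?m\<^sup>2 + ?n ^ 3) / 2"
        by (intro arith mult_right_mono n) auto
      also have "\<dots> = ?n ^ 3 * (5 / 2 + ?m + ?m\<^sup>2 / 2)" by (simp add: field_simps)
      also have "\<dots> \<le> ?n ^ 3 * gauss_weight z"
      proof (rule mult_left_mono)
        have "exp (norm z + 1) \<ge> 2 + norm z" using exp_ge_add_one_self[of "norm z + 1"] by simp
        then have "(2 + norm z)\<^sup>2 \<le> (exp (norm z + 1))\<^sup>2" by (intro power_mono) auto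
        also have "\<dots> = exp (2 * (norm z + 1))" by (simp add: exp_of_nat_mult[symmetric])
        also have "\<dots> \<le> gauss_weight z" unfolding gauss_weight_def by simp
        finally show "5 / 2 + ?m + ?m\<^sup>2 / 2 \<le> gauss_weight z"
          using norm_ge_zero[of z] zero_le_square[of "norm z"] unfolding power2_eq_square distrib_left distrib_right
          by linarith
      qed simp
      finally show ?thesis by simp
    qed
    have bd': "\<bar>F z * tilt2 x z\<bar> \<le> B * (?n ^ 3 * gauss_weight z - 1)" for z
      using mult_mono[OF bounded_borelD(1)[OF F, of z] bd[of z]] B by (simp add: abs_mult)
    have "\<bar>\<integral>z. F z * tilt2 x z \<partial>gauss2\<bar> \<le> (\<integral>z. \<bar>F z * tilt2 x z\<bar> \<partial>gauss2)" by (rule integral_abs_bound)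
    also have "\<dots> \<le> (\<integral>z. B * (?n ^ 3 * gauss_weight z - 1) \<partial>gauss2)"
      using iq bd' by (intro integral_mono) (auto intro!: integrable_gauss_weight)
    also have "\<dots> = B * (?n ^ 3 * gauss_const - 1)"
      using integrable_gauss_weight by (simp add: gauss_const_def prob_space)
    finally have "\<bar>\<integral>z. F z * tilt2 x z \<partial>gauss2\<bar> \<le> B * (?n ^ 3 * gauss_const - 1)" .
    moreover have "\<bar>\<integral>z. F (x + z) \<partial>gauss2\<bar> \<le> B"
      using integral_bounded_borel[OF bounded_borel_shift[OF F, of x 1] borel_prob_gauss2] by simp
    ultimately show ?thesis by (simp add: algebra_simps)
  qed
qed

section \<open>Third-order comparison with a Gaussian step\<close>

definition isotropic :: "(real \<times> real) measure \<Rightarrow> bool" where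
  "isotropic \<mu> \<longleftrightarrow> borel_prob \<mu> \<and> integrable \<mu> (\<lambda>x. norm x ^ 3) \<and>
     (\<integral>x. fst x \<partial>\<mu>) = 0 \<and> (\<integral>x. snd x \<partial>\<mu>) = 0 \<and>
     (\<integral>x. (fst x)\<^sup>2 \<partial>\<mu>) = 1 \<and> (\<integral>x. (snd x)\<^sup>2 \<partial>\<mu>) = 1 \<and> (\<integral>x. fst x * snd x \<partial>\<mu>) = 0"

lemma abs_fst_le_norm: "\<bar>fst x\<bar> \<le> norm x" and abs_snd_le_norm: "\<bar>snd x\<bar> \<le> norm x" for x :: "real \<times> real"
  using norm_fst_le[of "fst x" "snd x"] norm_snd_le[of "snd x" "fst x"] by auto

lemma borel_measurable_fst_snd[measurable]:
  "(fst :: real \<times> real \<Rightarrow> real) \<in> borel_measurable borel" "(snd :: real \<times> real \<Rightarrow> real) \<in> borel_measurable borel"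
  by (intro borel_measurable_continuous_onI continuous_on_fst continuous_on_snd continuous_on_id)+

lemma monomials_le_gauss_weight:
  fixes z :: "real \<times> real"
  shows "\<bar>fst z\<bar> \<le> gauss_weight z" "\<bar>snd z\<bar> \<le> gauss_weight z"
    "\<bar>(fst z)\<^sup>2\<bar> \<le> gauss_weight z" "\<bar>(snd z)\<^sup>2\<bar> \<le> gauss_weight z" "\<bar>fst z * snd z\<bar> \<le> gauss_weight z"
    "\<bar>norm z ^ 3\<bar> \<le> gauss_weight z"
proof -
  have 1: "norm z \<le> gauss_weight z" using norm_power_le_gauss_weight[of 1 z] by simp
  have k: "norm z ^ k \<le> gauss_weight z" if "k \<le> 4" for k
    using power_mono[of "norm z" "norm z + 1" k] norm_power_le_gauss_weight[OF that, of z] by (meson norm_ge_zero le_add_same_cancel1 zero_le_one order_trans)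
  note 2 = k[of 2, simplified]
  show "\<bar>norm z ^ 3\<bar> \<le> gauss_weight z" using k[of 3] by simp
  show "\<bar>fst z\<bar> \<le> gauss_weight z" "\<bar>snd z\<bar> \<le> gauss_weight z"
    using 1 abs_fst_le_norm[of z] abs_snd_le_norm[of z] by linarith+
  show "\<bar>(fst z)\<^sup>2\<bar> \<le> gauss_weight z" "\<bar>(snd z)\<^sup>2\<bar> \<le> gauss_weight z"
    using 2 power_mono[OF abs_fst_le_norm, of z 2] power_mono[OF abs_snd_le_norm, of z 2] by auto
  show "\<bar>fst z * snd z\<bar> \<le> gauss_weight z"
    using 2 mult_mono[OF abs_fst_le_norm abs_snd_le_norm, of z z] by (simp add: abs_mult power2_eq_square)
qed

lemma integral_gauss2_product:
  fixes f g :: "real \<Rightarrow> real"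
  assumes "integrable gauss2 (\<lambda>z. f (fst z) * g (snd z))"
  shows "(\<integral>z. f (fst z) * g (snd z) \<partial>gauss2) =
    integral\<^sup>L std_normal_distribution f * integral\<^sup>L std_normal_distribution g"
proof -
  interpret N: prob_space std_normal_distribution by (rule prob_std_normal)
  interpret pair_prob_space std_normal_distribution std_normal_distribution ..
  have "(\<integral>z. f (fst z) * g (snd z) \<partial>gauss2) = (\<integral>x. (\<integral>y. f x * g y \<partial>std_normal_distribution) \<partial>std_normal_distribution)"
    using assms unfolding gauss2_def by (subst integral_fst'[symmetric]) auto
  also have "\<dots> = (\<integral>x. f x * integral\<^sup>L std_normal_distribution g \<partial>std_normal_distribution)"
    by (simp only: integral_mult_right_zero)
  finally show ?thesis by (simp only: integral_mult_left_zero)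
qed

lemma isotropic_gauss2: "isotropic gauss2"
proof -
  let ?N = std_normal_distribution
  have N1: "(\<integral>x. x \<partial>?N) = 0" using integral_std_normal_distribution_moment_odd[of 1] by simp
  have N2: "(\<integral>x. x\<^sup>2 \<partial>?N) = 1" using std_normal_distribution_even_moments(1)[of 1] by (simp add: fact_numeral)
  have N0: "(\<integral>x. 1 \<partial>?N) = (1 :: real)"
    using prob_space.prob_space[OF prob_std_normal] by simp
  have b: "integrable gauss2 f" if "f \<in> borel_measurable borel" "\<And>z. \<bar>f z\<bar> \<le> gauss_weight z" for f
    using gauss_weight_bound(1)[of f 1] that by simp
  have i: "integrable gauss2 fst" "integrable gauss2 snd"
    "integrable gauss2 (\<lambda>z. (fst z)\<^sup>2)" "integrable gauss2 (\<lambda>z. (snd z)\<^sup>2)" "integrable gauss2 (\<lambda>z. fst z * snd z)"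
    "integrable gauss2 (\<lambda>z. norm z ^ 3)"
    by (rule b, measurable, rule monomials_le_gauss_weight)+
  have "(\<integral>x. fst x \<partial>gauss2) = 0"
    using integral_gauss2_product[of "\<lambda>x. x" "\<lambda>x. 1"] i(1) N1 by simp
  moreover have "(\<integral>x. snd x \<partial>gauss2) = 0"
    using integral_gauss2_product[of "\<lambda>x. 1" "\<lambda>x. x"] i(2) N1 by simp
  moreover have "(\<integral>x. (fst x)\<^sup>2 \<partial>gauss2) = 1"
    using integral_gauss2_product[of "\<lambda>x. x\<^sup>2" "\<lambda>x. 1"] i(3) unfolding N0 N2 by simp
  moreover have "(\<integral>x. (snd x)\<^sup>2 \<partial>gauss2) = 1"
    using integral_gauss2_product[of "\<lambda>x. 1" "\<lambda>x. x\<^sup>2"] i(4) unfolding N0 N2 by simp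
  moreover have "(\<integral>x. fst x * snd x \<partial>gauss2) = 0"
    using integral_gauss2_product[of "\<lambda>x. x" "\<lambda>x. x"] i(5) unfolding N1 by simp
  moreover note i(6)
  ultimately show ?thesis by (simp add: isotropic_def borel_prob_gauss2)
qed

lemma isotropic_integrable:
  assumes "isotropic \<mu>"
  shows "integrable \<mu> fst" "integrable \<mu> snd" "integrable \<mu> (\<lambda>x. (fst x)\<^sup>2)" "integrable \<mu> (\<lambda>x. (snd x)\<^sup>2)"
    "integrable \<mu> (\<lambda>x. fst x * snd x)"
proof -
  interpret prob_space \<mu> using assms by (simp add: isotropic_def borel_prob_def)
  have [measurable_cong]: "sets \<mu> = sets borel" using assms by (simp add: isotropic_def borel_prob_def)
  have i: "integrable \<mu> (\<lambda>x. 1 + norm x ^ 3)" using assms by (auto simp: isotropic_def)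
  have *: "integrable \<mu> f" if [measurable]: "f \<in> borel_measurable borel"
    and "\<And>x. \<bar>f x\<bar> \<le> norm x \<or> \<bar>f x\<bar> \<le> (norm x)\<^sup>2" for f :: "real \<times> real \<Rightarrow> real"
  proof (rule Bochner_Integration.integrable_bound[OF i])
    show "f \<in> borel_measurable \<mu>" by measurable
    have "norm (f x) \<le> norm (1 + norm x ^ 3)" for x
    proof (cases "norm x \<le> 1")
      case True
      then have "(norm x)\<^sup>2 \<le> 1" by (simp add: power_le_one)
      moreover have "0 \<le> norm x ^ 3" by simp
      ultimately show ?thesis using True that(2)[of x] unfolding real_norm_def by linarith
    next
      case False
      then have "norm x \<le> norm x ^ 3" "(norm x)\<^sup>2 \<le> norm x ^ 3"
        using power_increasing[of 1 3 "norm x"] power_increasing[of 2 3 "norm x"] by auto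
      then show ?thesis using that(2)[of x] by auto
    qed
    then show "AE x in \<mu>. norm (f x) \<le> norm (1 + norm x ^ 3)" by blast
  qed
  show "integrable \<mu> fst" by (rule *) (use abs_fst_le_norm in auto)
  show "integrable \<mu> snd" by (rule *) (use abs_snd_le_norm in auto)
  show "integrable \<mu> (\<lambda>x. (fst x)\<^sup>2)" using power_mono[OF abs_fst_le_norm, where n=2] by (intro *) auto
  show "integrable \<mu> (\<lambda>x. (snd x)\<^sup>2)" using power_mono[OF abs_snd_le_norm, where n=2] by (intro *) auto
  show "integrable \<mu> (\<lambda>x. fst x * snd x)"
    using mult_mono[OF abs_fst_le_norm abs_snd_le_norm] by (intro *) (auto simp: abs_mult power2_eq_square)
qed

text \<open>The tilted integral is a quadratic polynomial in x, so its mean under \<mu> involves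
  only first and second moments and is the same number for every isotropic law. Only the cubic
  remainder depends on \<mu>.\<close>

lemma isotropic_step:
  assumes \<mu>: "isotropic \<mu>" and F: "bounded_borel B F" and e: "0 \<le> e"
  shows "\<bar>(\<integral>x. (\<integral>z. F (e *\<^sub>R x + z) \<partial>gauss2) \<partial>\<mu>)
     - (integral\<^sup>L gauss2 F + e\<^sup>2 / 2 * (\<integral>z. F z * ((fst z)\<^sup>2 + (snd z)\<^sup>2 - 2) \<partial>gauss2))\<bar>
     \<le> B * gauss_const * (\<integral>x. norm x ^ 3 \<partial>\<mu>) * e ^ 3"
proof -
  note [measurable] = bounded_borelD(2)[OF F]
  have bp: "borel_prob \<mu>" using \<mu> by (simp add: isotropic_def)
  interpret prob_space \<mu> using bp by (simp add: borel_prob_def)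
  have [measurable_cong]: "sets \<mu> = sets borel" using bp by (simp add: borel_prob_def)
  note b = gauss_weight_bound(1)[where K=B]
  have Fb: "\<bar>F z * f z\<bar> \<le> B * gauss_weight z" if "\<bar>f z\<bar> \<le> gauss_weight z" for f z
    using mult_mono[OF bounded_borelD(1)[OF F] that] bounded_borel_nonneg[OF F] by (simp add: abs_mult)
  have i: "integrable gauss2 F" by (rule integrable_bounded_borel[OF F borel_prob_gauss2])
  have i1: "integrable gauss2 (\<lambda>z. F z * fst z)"
    by (rule b) (measurable, rule Fb, rule monomials_le_gauss_weight)
  have i2: "integrable gauss2 (\<lambda>z. F z * snd z)"
    by (rule b) (measurable, rule Fb, rule monomials_le_gauss_weight)
  have i11: "integrable gauss2 (\<lambda>z. F z * (fst z)\<^sup>2)"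
    by (rule b) (measurable, rule Fb, rule monomials_le_gauss_weight)
  have i22: "integrable gauss2 (\<lambda>z. F z * (snd z)\<^sup>2)"
    by (rule b) (measurable, rule Fb, rule monomials_le_gauss_weight)
  have i12: "integrable gauss2 (\<lambda>z. F z * (fst z * snd z))"
    by (rule b) (measurable, rule Fb, rule monomials_le_gauss_weight)
  define m m1 m2 m11 m12 m22 where "m = integral\<^sup>L gauss2 F"
    and "m1 = (\<integral>z. F z * fst z \<partial>gauss2)" and "m2 = (\<integral>z. F z * snd z \<partial>gauss2)"
    and "m11 = (\<integral>z. F z * (fst z)\<^sup>2 \<partial>gauss2)" and "m12 = (\<integral>z. F z * (fst z * snd z) \<partial>gauss2)"
    and "m22 = (\<integral>z. F z * (snd z)\<^sup>2 \<partial>gauss2)"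
  have tilt: "(\<integral>z. F z * tilt2 (e *\<^sub>R x) z \<partial>gauss2) =
     m + e * m1 * fst x + e * m2 * snd x + e\<^sup>2 / 2 * (m11 - m) * (fst x)\<^sup>2 + e\<^sup>2 / 2 * (m22 - m) * (snd x)\<^sup>2
       + e\<^sup>2 * m12 * (fst x * snd x)" for x
  proof -
    have eq: "F z * tilt2 (e *\<^sub>R x) z =
       (1 - e\<^sup>2 / 2 * ((fst x)\<^sup>2 + (snd x)\<^sup>2)) * F z + (e * fst x) * (F z * fst z) + (e * snd x) * (F z * snd z)
       + (e\<^sup>2 / 2 * (fst x)\<^sup>2) * (F z * (fst z)\<^sup>2) + (e\<^sup>2 / 2 * (snd x)\<^sup>2) * (F z * (snd z)\<^sup>2)
       + (e\<^sup>2 * fst x * snd x) * (F z * (fst z * snd z))" for z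
      unfolding tilt2_def power2_norm_eq_inner by (simp add: inner_prod_def power2_eq_square field_simps)
    have lin: "(\<integral>z. c0 * F z + c1 * (F z * fst z) + c2 * (F z * snd z) + c11 * (F z * (fst z)\<^sup>2) + c22 * (F z * (snd z)\<^sup>2)
        + c12 * (F z * (fst z * snd z)) \<partial>gauss2) = c0 * m + c1 * m1 + c2 * m2 + c11 * m11 + c22 * m22 + c12 * m12"
      for c0 c1 c2 c11 c22 c12
      using i i1 i2 i11 i22 i12 by (simp add: m_def m1_def m2_def m11_def m12_def m22_def)
    show ?thesis
      unfolding eq lin by (simp add: algebra_simps add_divide_distrib diff_divide_distrib)
  qed
  note I = isotropic_integrable[OF \<mu>]
  have it: "integrable \<mu> (\<lambda>x. \<integral>z. F z * tilt2 (e *\<^sub>R x) z \<partial>gauss2)"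
    unfolding tilt using I by (intro Bochner_Integration.integrable_add integrable_mult_right) auto
  have "(\<integral>x. (\<integral>z. F z * tilt2 (e *\<^sub>R x) z \<partial>gauss2) \<partial>\<mu>) = m + e\<^sup>2 / 2 * (m11 - m) + e\<^sup>2 / 2 * (m22 - m)"
    unfolding tilt using I \<mu> prob_space by (simp add: isotropic_def)
  also have "\<dots> = m + e\<^sup>2 / 2 * (\<integral>z. F z * ((fst z)\<^sup>2 + (snd z)\<^sup>2 - 2) \<partial>gauss2)"
  proof -
    have "F z * ((fst z)\<^sup>2 + (snd z)\<^sup>2 - 2) = F z * (fst z)\<^sup>2 + F z * (snd z)\<^sup>2 - 2 * F z" for z by (simp add: algebra_simps)
    then have J: "(\<integral>z. F z * ((fst z)\<^sup>2 + (snd z)\<^sup>2 - 2) \<partial>gauss2) = m11 + m22 - 2 * m"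
      using i i11 i22 by (simp add: m_def m11_def m22_def)
    show ?thesis unfolding J by (simp add: field_simps)
  qed
  finally have t: "(\<integral>x. (\<integral>z. F z * tilt2 (e *\<^sub>R x) z \<partial>gauss2) \<partial>\<mu>) =
     integral\<^sup>L gauss2 F + e\<^sup>2 / 2 * (\<integral>z. F z * ((fst z)\<^sup>2 + (snd z)\<^sup>2 - 2) \<partial>gauss2)" by (simp add: m_def)
  have "bounded_borel B (avg gauss2 F)" by (rule bounded_borel_avg[OF F borel_prob_gauss2])
  from integrable_bounded_borel[OF bounded_borel_shift[OF this, of 0 e] bp]
  have iF: "integrable \<mu> (\<lambda>x. \<integral>z. F (e *\<^sub>R x + z) \<partial>gauss2)" by (simp add: avg_def)
  have i3: "integrable \<mu> (\<lambda>x. B * gauss_const * norm (e *\<^sub>R x) ^ 3)"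
    using \<mu> by (simp add: isotropic_def power_mult_distrib)
  have "\<bar>(\<integral>x. (\<integral>z. F (e *\<^sub>R x + z) \<partial>gauss2) \<partial>\<mu>) - (\<integral>x. (\<integral>z. F z * tilt2 (e *\<^sub>R x) z \<partial>gauss2) \<partial>\<mu>)\<bar>
     = \<bar>\<integral>x. (\<integral>z. F (e *\<^sub>R x + z) \<partial>gauss2) - (\<integral>z. F z * tilt2 (e *\<^sub>R x) z \<partial>gauss2) \<partial>\<mu>\<bar>"
    using iF it by simp
  also have "\<dots> \<le> (\<integral>x. \<bar>(\<integral>z. F (e *\<^sub>R x + z) \<partial>gauss2) - (\<integral>z. F z * tilt2 (e *\<^sub>R x) z \<partial>gauss2)\<bar> \<partial>\<mu>)"
    by (rule integral_abs_bound)
  also have "\<dots> \<le> (\<integral>x. B * gauss_const * norm (e *\<^sub>R x) ^ 3 \<partial>\<mu>)"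
    by (rule integral_mono[OF _ i3 gauss2_taylor[OF F]]) (intro integrable_abs Bochner_Integration.integrable_diff iF it)
  also have "\<dots> = B * gauss_const * (\<integral>x. norm x ^ 3 \<partial>\<mu>) * e ^ 3"
    using e by (simp add: power_mult_distrib mult_ac)
  finally show ?thesis unfolding t .
qed

text \<open>Dividing by sqrt s makes the noise standard and shrinks the step to length 1 / sqrt s,
  whose cube is the stated decay. The Gaussian step is an isotropic one as well, with law
  \<open>gauss2\<close>, so the common second-order value cancels.\<close>

lemma isotropic_gauss_step:
  assumes \<mu>: "isotropic \<mu>"
  obtains C where "0 \<le> C" and
    "\<And>F B s z. bounded_borel B F \<Longrightarrow> 0 < s \<Longrightarrow>
       \<bar>avg \<mu> (avg (gauss s) F) z - avg (gauss (s + 1)) F z\<bar> \<le> C * B / (s * sqrt s)"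
proof
  let ?C = "gauss_const * (\<integral>x. norm x ^ 3 \<partial>\<mu>) + gauss_const * (\<integral>x. norm x ^ 3 \<partial>gauss2)"
  show "0 \<le> ?C" using gauss_const_ge by (intro add_nonneg_nonneg mult_nonneg_nonneg) auto
  fix F B z and s :: real
  assume F: "bounded_borel B F" and s: "0 < s"
  let ?F = "\<lambda>w. F (z + sqrt s *\<^sub>R w)" and ?e = "1 / sqrt s"
  have F': "bounded_borel B ?F" by (rule bounded_borel_shift[OF F])
  have e3: "?e ^ 3 = 1 / (s * sqrt s)" using s by (simp add: power3_eq_cube field_simps)
  have A: "avg \<nu> (avg (gauss s) F) z = (\<integral>x. (\<integral>w. ?F (?e *\<^sub>R x + w) \<partial>gauss2) \<partial>\<nu>)" for \<nu>
    unfolding avg_gauss[OF F] unfolding avg_def using s by (simp add: scaleR_add_right add.assoc)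
  have gauss1: "gauss 1 = gauss2"
    unfolding gauss_def real_sqrt_one scaleR_one by (rule distr_id2[OF sets_gauss2[symmetric]])
  have "avg (gauss (s + 1)) F = avg (gauss (1 + s)) F" by (simp add: add.commute)
  also have "\<dots> = avg (gauss 1) (avg (gauss s) F)" using s by (intro gauss_semigroup[OF F, symmetric]) auto
  finally have B: "avg (gauss (s + 1)) F z = (\<integral>x. (\<integral>w. ?F (?e *\<^sub>R x + w) \<partial>gauss2) \<partial>gauss2)"
    using A[of gauss2] by (simp add: gauss1)
  have tri: "\<bar>p - q\<bar> \<le> c + d" if "\<bar>p - m\<bar> \<le> c" "\<bar>q - m\<bar> \<le> d" for p q m c d :: real
    using that by linarith
  have "\<bar>avg \<mu> (avg (gauss s) F) z - avg (gauss (s + 1)) F z\<bar> \<le>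
     B * gauss_const * (\<integral>x. norm x ^ 3 \<partial>\<mu>) * ?e ^ 3 + B * gauss_const * (\<integral>x. norm x ^ 3 \<partial>gauss2) * ?e ^ 3"
    unfolding A[of \<mu>] B using s
    by (intro tri[OF isotropic_step[OF \<mu> F'] isotropic_step[OF isotropic_gauss2 F']]) auto
  also have "\<dots> = ?C * B / (s * sqrt s)"
    unfolding e3 by (simp add: algebra_simps add_divide_distrib)
  finally show "\<bar>avg \<mu> (avg (gauss s) F) z - avg (gauss (s + 1)) F z\<bar> \<le> ?C * B / (s * sqrt s)" .
qed

section \<open>A Berry--Esseen bound for wedges\<close>

text \<open>Stage k has k vectors with law \<mu>, n - k Gaussian ones and the noise t. From k to k +
  1 the averaged function H of the k vectors is split as (H - G) + G with its Gaussian counterpart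
  G. The difference is bounded by the earlier distance \<delta> k. The part G is itself smoothed,
  which raises the variance of the noise to at least n, and n errors of order n^(-3/2) add up to
  n^(-1/2).\<close>

lemma lindeberg_telescope:
  assumes \<mu>: "borel_prob \<mu>" and F: "bounded_borel 1 F" and C: "0 \<le> C"
    and step: "\<And>F B s z. bounded_borel B F \<Longrightarrow> 0 < s \<Longrightarrow>
       \<bar>avg \<mu> (avg (gauss s) F) z - avg (gauss (s + 1)) F z\<bar> \<le> C * B / (s * sqrt s)"
    and d: "\<And>k z. k < n \<Longrightarrow> \<bar>(avg \<mu> ^^ k) F z - avg (gauss k) F z\<bar> \<le> \<delta> k"
    and n: "1 \<le> n" and t: "1 \<le> t"
  shows "\<bar>(avg \<mu> ^^ n) (avg (gauss t) F) z - avg (gauss (n + t)) F z\<bar> \<le>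
    C / sqrt n + C * (\<Sum>k<n. \<delta> k / ((real (n - Suc k) + t) * sqrt (real (n - Suc k) + t)))"
proof -
  define a where "a k = (avg \<mu> ^^ k) (avg (gauss (real (n - k) + t)) F) z" for k
  have "\<bar>a (Suc k) - a k\<bar> \<le> C / (n * sqrt n) + C * (\<delta> k / ((real (n - Suc k) + t) * sqrt (real (n - Suc k) + t)))"
    if k: "k < n" for k
  proof -
    define s H G where "s = real (n - Suc k) + t" and "H = (avg \<mu> ^^ k) F" and "G = avg (gauss k) F"
    \<comment> \<open>Here s + k equals n - 1 + t, so t \<ge> 1 makes up for the one summand that is
      being replaced.\<close>
    have s: "0 < s" "real (n - k) + t = s + 1" and sk: "real n \<le> s + real k" using k t by (auto simp: s_def)
    have H: "bounded_borel 1 H" unfolding H_def by (rule bounded_borel_avg_power[OF F \<mu>])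
    have G: "bounded_borel 1 G" unfolding G_def by (rule bounded_borel_avg[OF F borel_prob_gauss])
    have D: "bounded_borel (\<delta> k) (\<lambda>x. H x - G x)"
      using d[OF k] by (intro bounded_borel_diff[OF H G]) (simp add: H_def G_def)
    have Hs: "(avg \<mu> ^^ k) (avg (gauss u) F) = avg (gauss u) H" for u
      unfolding H_def using avg_power_commute[OF F \<mu> borel_prob_gauss] by simp
    have a1: "a (Suc k) = avg \<mu> (avg (gauss s) H) z" and a2: "a k = avg (gauss (s + 1)) H z"
      unfolding a_def s(2) by (simp_all add: Hs s_def[symmetric])
    have E: "avg (gauss u) (\<lambda>x. H x - G x) = (\<lambda>x. avg (gauss u) H x - avg (gauss u) G x)" for u
      using avg_diff[OF H G borel_prob_gauss] by blast
    have E2: "avg \<mu> (avg (gauss s) (\<lambda>x. H x - G x)) z = avg \<mu> (avg (gauss s) H) z - avg \<mu> (avg (gauss s) G) z"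
      unfolding E by (rule avg_diff[OF bounded_borel_avg[OF H borel_prob_gauss] bounded_borel_avg[OF G borel_prob_gauss] \<mu>])
    have d1: "\<bar>avg \<mu> (avg (gauss s) (\<lambda>x. H x - G x)) z - avg (gauss (s + 1)) (\<lambda>x. H x - G x) z\<bar> \<le> C * \<delta> k / (s * sqrt s)"
      by (rule step[OF D s(1)])
    have G1: "avg (gauss s) G = avg (gauss (s + k)) F" "avg (gauss (s + 1)) G = avg (gauss (s + k + 1)) F"
      unfolding G_def using gauss_semigroup[OF F, of s "real k"] gauss_semigroup[OF F, of "s + 1" "real k"] s
      by (auto simp: add_ac)
    have "\<bar>avg \<mu> (avg (gauss s) G) z - avg (gauss (s + 1)) G z\<bar> \<le> C * 1 / ((s + k) * sqrt (s + k))"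
      unfolding G1 using s by (intro step[OF F]) auto
    also have "\<dots> \<le> C * 1 / (n * sqrt n)"
      using C sk n s by (intro divide_left_mono mult_mono) auto
    finally have d2: "\<bar>avg \<mu> (avg (gauss s) G) z - avg (gauss (s + 1)) G z\<bar> \<le> C / (n * sqrt n)" by simp
    have tri: "\<bar>p - q\<bar> \<le> c + d" if "\<bar>(p - p') - (q - q')\<bar> \<le> d" "\<bar>p' - q'\<bar> \<le> c" for p q p' q' c d :: real
      using that by linarith
    show ?thesis unfolding a1 a2 s_def[symmetric] times_divide_eq_right
      by (rule tri[OF d1[unfolded E2, unfolded E] d2])
  qed
  then have "\<bar>\<Sum>k<n. a (Suc k) - a k\<bar> \<le> (\<Sum>k<n. C / (n * sqrt n) + C * (\<delta> k / ((real (n - Suc k) + t) * sqrt (real (n - Suc k) + t))))"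
    by (intro order_trans[OF sum_abs] sum_mono) auto
  also have "\<dots> = C / sqrt n + C * (\<Sum>k<n. \<delta> k / ((real (n - Suc k) + t) * sqrt (real (n - Suc k) + t)))"
    using n by (simp add: sum.distrib sum_distrib_left)
  finally show ?thesis unfolding sum_lessThan_telescope by (simp add: a_def)
qed

section \<open>Gaussian mass near the boundary of a wedge, and smoothing\<close>

definition wedge :: "real \<Rightarrow> real \<Rightarrow> real \<Rightarrow> real \<Rightarrow> real \<times> real \<Rightarrow> real" where
  "wedge r q a b w = of_bool (fst w \<le> a \<and> r * fst w + q * snd w \<le> b)"

lemma bounded_borel_wedge: "bounded_borel 1 (wedge r q a b)"
proof (rule bounded_borelI)
  show "wedge r q a b \<in> borel_measurable borel" unfolding wedge_def by measurable
qed (simp add: wedge_def)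

lemma std_normal_interval:
  assumes l: "0 \<le> l"
  shows "measure std_normal_distribution {c<..c + l} \<le> l"
proof -
  have "std_normal_density x \<le> 1" for x :: real
  proof -
    have "exp (- x\<^sup>2 / 2) \<le> 1" by simp
    moreover have "1 \<le> sqrt (2 * pi)" using pi_gt3 by (simp add: real_le_rsqrt)
    ultimately have "(1 / sqrt (2 * pi)) * exp (- x\<^sup>2 / 2) \<le> 1 * 1" by (intro mult_mono) auto
    then show ?thesis by (simp add: std_normal_density_def)
  qed
  then have "emeasure std_normal_distribution {c<..c + l} \<le> (\<integral>\<^sup>+x. indicator {c<..c + l} x \<partial>lborel)"
    by (subst emeasure_density) (simp, simp, intro nn_integral_mono, simp split: split_indicator)
  also have "\<dots> = ennreal l" using l by simp
  finally show ?thesis using l by (simp add: measure_def enn2real_leI)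
qed

text \<open>Since (r, q) is a unit vector, the linear form of a standard Gaussian vector is standard
  normal, whose density is at most 1.\<close>

lemma gauss_strip:
  assumes rq: "r\<^sup>2 + q\<^sup>2 = 1" and u: "0 < u" and l: "0 \<le> l"
  shows "(\<integral>x. of_bool (c < r * fst (z + u *\<^sub>R x) + q * snd (z + u *\<^sub>R x) \<and>
      r * fst (z + u *\<^sub>R x) + q * snd (z + u *\<^sub>R x) \<le> c + l) \<partial>gauss2) \<le> l / u"
    (is "(\<integral>x. ?f x \<partial>gauss2) \<le> _")
proof -
  let ?N = std_normal_distribution
  interpret N: prob_space ?N by (rule prob_std_normal)
  define d where "d = (c - r * fst z - q * snd z) / u"
  define g :: "real \<Rightarrow> real" where "g = (\<lambda>y. indicator {d<..d + l / u} y)"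
  have f: "?f x = g (r * fst x + q * snd x)" for x
    using u by (auto simp: g_def d_def field_simps indicator_def)
  have b: "bounded_borel 1 (\<lambda>x. g (r * fst x + q * snd x))"
    by (rule bounded_borelI) (auto simp: g_def indicator_def)
  have "(\<integral>x. ?f x \<partial>gauss2) = (\<integral>x. (\<integral>y. g (r * x + q * y) \<partial>?N) \<partial>?N)"
    unfolding f integral_gauss2[OF b] by simp
  also have "\<dots> = (\<integral>y. g y \<partial>?N)"
    using integral_normal_combination[of g 1 r q] rq by (simp add: g_def)
  also have "\<dots> = measure ?N {d<..d + l / u}"
    by (simp add: g_def)
  also have "\<dots> \<le> l / u" using u l by (intro std_normal_interval) auto
  finally show ?thesis .
qed

text \<open>A point of the larger wedge outside the smaller one exceeds one of the two bounds by at
  most l and so lies in one of two strips of width l. The angle of the wedge does not enter, and the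
  estimate persists at q = 0.\<close>

lemma gauss_wedge_shell:
  assumes rq: "r\<^sup>2 + q\<^sup>2 = 1" and n: "0 < n" and l: "0 \<le> l"
  shows "avg (gauss n) (wedge r q (a + l) (b + l)) z - avg (gauss n) (wedge r q a b) z \<le> 2 * l / sqrt n"
proof -
  let ?x = "\<lambda>x. z + sqrt n *\<^sub>R x"
  let ?f = "\<lambda>r q c x. of_bool (c < r * fst (?x x) + q * snd (?x x) \<and> r * fst (?x x) + q * snd (?x x) \<le> c + l) :: real"
  have i: "integrable gauss2 (?f r q c)" for r q c
    by (rule integrable_bounded_borel[OF bounded_borelI[where B=1] borel_prob_gauss2]) auto
  note w = integrable_bounded_borel[OF bounded_borel_shift[OF bounded_borel_wedge] borel_prob_gauss2, of r q _ _ z "sqrt n"]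
  have "avg (gauss n) (wedge r q (a + l) (b + l)) z - avg (gauss n) (wedge r q a b) z =
    (\<integral>x. wedge r q (a + l) (b + l) (?x x) - wedge r q a b (?x x) \<partial>gauss2)"
    unfolding avg_gauss[OF bounded_borel_wedge] using w by simp
  also have "\<dots> \<le> (\<integral>x. ?f 1 0 a x + ?f r q b x \<partial>gauss2)"
    by (intro integral_mono Bochner_Integration.integrable_add Bochner_Integration.integrable_diff i w)
       (auto simp: wedge_def)
  also have "\<dots> = (\<integral>x. ?f 1 0 a x \<partial>gauss2) + (\<integral>x. ?f r q b x \<partial>gauss2)"
    by (rule Bochner_Integration.integral_add[OF i i])
  also have "\<dots> \<le> l / sqrt n + l / sqrt n"
    using n l rq by (intro add_mono gauss_strip) auto
  finally show ?thesis by simp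
qed

text \<open>Where the Gaussian noise exceeds \<open>h\<close>, the lower bound \<open>- \<Delta>\<close> is used; this happens with
  probability at most 1/4 by Chebyshev's inequality.\<close>

lemma smoothing_chebyshev:
  assumes G: "bounded_borel B G" and near: "\<And>x. t * (norm x)\<^sup>2 \<le> h\<^sup>2 \<Longrightarrow> D - e \<le> G x"
    and far: "\<And>x. - \<Delta> \<le> G x" and D: "D \<le> \<Delta>" "0 \<le> \<Delta>" and e: "0 \<le> e"
    and th: "0 < t" "h\<^sup>2 = 8 * t" and int: "integral\<^sup>L gauss2 G \<le> \<delta>"
  shows "D \<le> \<delta> + e + \<Delta> / 2"
proof -
  interpret prob_space gauss2 using borel_prob_gauss2 by (simp add: borel_prob_def)
  note [measurable] = bounded_borelD(2)[OF G]
  have i1: "integrable gauss2 (\<lambda>x. (fst x)\<^sup>2)" and i2: "integrable gauss2 (\<lambda>x. (snd x)\<^sup>2)"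
    using isotropic_integrable[OF isotropic_gauss2] by auto
  have nx: "(norm x)\<^sup>2 = (fst x)\<^sup>2 + (snd x)\<^sup>2" for x :: "real \<times> real"
    by (simp add: norm_prod_def)
  \<comment> \<open>A quadratic minorant replaces a splitting of the integral: beyond radius sqrt 8
    it is at most -\<Delta>, and since the mean of |x|^2 is 2 it costs exactly \<Delta> / 2.\<close>
  have "D - e - \<Delta> / 4 * (norm x)\<^sup>2 \<le> G x" for x
  proof (cases "t * (norm x)\<^sup>2 \<le> h\<^sup>2")
    case True
    have "0 \<le> \<Delta> / 4 * (norm x)\<^sup>2" using D by simp
    then show ?thesis using near[OF True] by linarith
  next
    case False
    then have "8 * t < t * (norm x)\<^sup>2" using th by simp
    then have "8 \<le> (norm x)\<^sup>2" using th by (simp add: mult.commute)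
    from mult_left_mono[OF this, of "\<Delta> / 4"] have "2 * \<Delta> \<le> \<Delta> / 4 * (norm x)\<^sup>2" using D by simp
    then show ?thesis using far[of x] D e by linarith
  qed
  then have "(\<integral>x. D - e - \<Delta> / 4 * (norm x)\<^sup>2 \<partial>gauss2) \<le> integral\<^sup>L gauss2 G"
    using i1 i2 integrable_bounded_borel[OF G borel_prob_gauss2]
    by (intro integral_mono) (auto simp: nx)
  also have "(\<integral>x. D - e - \<Delta> / 4 * (norm x)\<^sup>2 \<partial>gauss2) = D - e - \<Delta> / 4 * 2"
    using i1 i2 isotropic_gauss2 prob_space by (simp add: nx isotropic_def)
  finally show ?thesis using int by linarith
qed

text \<open>A displacement of length at most h changes each of the two linear forms by at most h, so
  a displaced wedge lies between the wedges with both bounds moved by h. With \<Delta> as the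
  supremum over all corners and shifts, the loss \<Delta> / 2 on large noise is a fraction of the
  quantity being estimated and can be absorbed, \<Delta> being finite.\<close>

lemma wedge_smoothing:
  assumes \<mu>: "borel_prob \<mu>" and rq: "r\<^sup>2 + q\<^sup>2 = 1" and t: "0 < t" and n: "1 \<le> n"
    and \<delta>: "\<And>a b z. \<bar>(avg \<mu> ^^ n) (avg (gauss t) (wedge r q a b)) z - avg (gauss (n + t)) (wedge r q a b) z\<bar> \<le> \<delta>"
  shows "\<bar>(avg \<mu> ^^ n) (wedge r q a b) z - avg (gauss n) (wedge r q a b) z\<bar> \<le> 2 * \<delta> + 24 * sqrt t / sqrt n"
proof -
  define h where "h = sqrt (8 * t)"
  have h: "0 \<le> h" "h\<^sup>2 = 8 * t" using t by (auto simp: h_def)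
  have h3: "h \<le> 3 * sqrt t"
  proof -
    have "sqrt (8 * t) \<le> sqrt (9 * t)" using t by simp
    also have "\<dots> = 3 * sqrt t" by (simp add: real_sqrt_mult)
    finally show ?thesis by (simp add: h_def)
  qed
  let ?T = "\<lambda>a b. (avg \<mu> ^^ n) (wedge r q a b)" and ?G = "\<lambda>a b. avg (gauss n) (wedge r q a b)"
  let ?D = "\<lambda>(a, b, z). \<bar>?T a b z - ?G a b z\<bar>"
  \<comment> \<open>Each bound is moved by h twice, once to reach the noisy point and once to
    return, so the Gaussian shell has width 2 h and mass at most twice 2 h / sqrt n.\<close>
  define e where "e = 4 * h / sqrt n"
  define \<Delta> where "\<Delta> = (SUP p. ?D p)"
  note Tb = bounded_borel_avg_power[OF bounded_borel_wedge \<mu>, of n r q]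
  note Gb = bounded_borel_avg[OF bounded_borel_wedge borel_prob_gauss, of "real n" r q]
  have D2: "?D p \<le> 2" for p
  proof -
    obtain a b z where p: "p = (a, b, z)" by (cases p) auto
    show ?thesis using bounded_borelD(1)[OF Tb[of a b], of z] bounded_borelD(1)[OF Gb[of a b], of z] by (simp add: p)
  qed
  then have bdd: "bdd_above (range ?D)" by (intro bdd_aboveI[of _ 2]) blast
  have D\<Delta>: "\<bar>?T a b z - ?G a b z\<bar> \<le> \<Delta>" for a b z
    using cSUP_upper[OF UNIV_I bdd, of "(a, b, z)"] by (simp add: \<Delta>_def)
  have \<Delta>0: "0 \<le> \<Delta>" using D\<Delta>[of 0 0 0] by linarith
  have e0: "0 \<le> e" using h by (simp add: e_def)
  have DB: "bounded_borel \<Delta> (\<lambda>x. ?T a b (z + sqrt t *\<^sub>R x) - ?G a b (z + sqrt t *\<^sub>R x))" for a b z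
    using bounded_borel_shift[OF bounded_borel_diff[OF Tb Gb D\<Delta>]] by simp
  have int: "(\<integral>x. ?T a b (z + sqrt t *\<^sub>R x) - ?G a b (z + sqrt t *\<^sub>R x) \<partial>gauss2) =
      (avg \<mu> ^^ n) (avg (gauss t) (wedge r q a b)) z - avg (gauss (n + t)) (wedge r q a b) z" for a b z
  proof -
    have "(\<integral>x. ?T a b (z + sqrt t *\<^sub>R x) - ?G a b (z + sqrt t *\<^sub>R x) \<partial>gauss2) =
       avg (gauss t) (\<lambda>x. ?T a b x - ?G a b x) z"
      by (subst avg_gauss[OF bounded_borel_diff[OF Tb Gb D\<Delta>]]) simp
    also have "\<dots> = avg (gauss t) (?T a b) z - avg (gauss t) (?G a b) z"
      by (rule avg_diff[OF Tb Gb borel_prob_gauss])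
    also have "avg (gauss t) (?G a b) = avg (gauss (n + t)) (wedge r q a b)"
      using gauss_semigroup[OF bounded_borel_wedge, of t "real n" r q a b] t by (simp add: add.commute)
    also have "avg (gauss t) (?T a b) = (avg \<mu> ^^ n) (avg (gauss t) (wedge r q a b))"
      using avg_power_commute[OF bounded_borel_wedge \<mu> borel_prob_gauss] by simp
    finally show ?thesis .
  qed
  have nv: "norm v \<le> h" if "t * (norm x)\<^sup>2 \<le> h\<^sup>2" "v = sqrt t *\<^sub>R x" for v x :: "real \<times> real"
  proof (rule power2_le_imp_le)
    show "(norm v)\<^sup>2 \<le> h\<^sup>2" unfolding that(2) norm_scaleR using that(1) t by (simp only: power_mult_distrib power2_abs real_sqrt_pow2 less_imp_le)
  qed (rule h)
  have L: "\<bar>fst v\<bar> \<le> h" "\<bar>r * fst v + q * snd v\<bar> \<le> h" if "norm v \<le> h" for v :: "real \<times> real"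
  proof -
    show "\<bar>fst v\<bar> \<le> h" using abs_fst_le_norm[of v] that by linarith
    have "norm (r, q) = 1" using rq by (simp add: norm_Pair)
    then have "\<bar>(r, q) \<bullet> v\<bar> \<le> norm v" using Cauchy_Schwarz_ineq2[of "(r, q)" v] by simp
    then show "\<bar>r * fst v + q * snd v\<bar> \<le> h" using that by (simp add: inner_prod_def)
  qed
  have mono: "wedge r q (a - h) (b - h) (y + v) \<le> wedge r q a b (y + 0)"
    "wedge r q a b (y + 0) \<le> wedge r q (a + h) (b + h) (y + v)"
    "wedge r q (a - h) (b - h) (y + 0) \<le> wedge r q a b (y + v)"
    "wedge r q a b (y + v) \<le> wedge r q (a + h) (b + h) (y + 0)"
    if v: "norm v \<le> h" for a b y v
  proof -
    have "(of_bool P :: real) \<le> of_bool Q" if "P \<Longrightarrow> Q" for P Q using that by auto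
    note le = this
    have e: "r * fst (y + v) + q * snd (y + v) = (r * fst y + q * snd y) + (r * fst v + q * snd v)"
      by (simp add: algebra_simps)
    show "wedge r q (a - h) (b - h) (y + v) \<le> wedge r q a b (y + 0)"
      "wedge r q a b (y + 0) \<le> wedge r q (a + h) (b + h) (y + v)"
      "wedge r q (a - h) (b - h) (y + 0) \<le> wedge r q a b (y + v)"
      "wedge r q a b (y + v) \<le> wedge r q (a + h) (b + h) (y + 0)"
      unfolding wedge_def e using L[OF v] by (rule_tac le; simp add: abs_le_iff; linarith)+
  qed
  have shell: "?G (a + 2 * h) (b + 2 * h) z \<le> ?G a b z + e" for a b z
    using gauss_wedge_shell[OF rq, of "real n" "2 * h" a b z] n h by (simp add: e_def)
  have up: "?T a b z - ?G a b z \<le> \<delta> + e + \<Delta> / 2" for a b z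
  proof (rule smoothing_chebyshev[OF DB[of "a + h" "b + h" z] _ _ _ \<Delta>0 e0 t h(2)])
    fix x :: "real \<times> real" assume "t * (norm x)\<^sup>2 \<le> h\<^sup>2"
    then have v: "norm (sqrt t *\<^sub>R x) \<le> h" by (intro nv[of x]) auto
    have "?T a b (z + 0) \<le> ?T (a + h) (b + h) (z + sqrt t *\<^sub>R x)"
      by (rule avg_power_mono[OF bounded_borel_wedge bounded_borel_wedge \<mu> mono(2)[OF v]])
    moreover have "?G (a + h) (b + h) (z + sqrt t *\<^sub>R x) \<le> ?G (a + h + h) (b + h + h) (z + 0)"
      using avg_power_mono[OF bounded_borel_wedge bounded_borel_wedge borel_prob_gauss[of "real n"] mono(4)[OF v, where a="a + h" and b="b + h"], where n=1 and z=z] by simp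
    ultimately show "?T a b z - ?G a b z - e \<le> ?T (a + h) (b + h) (z + sqrt t *\<^sub>R x) - ?G (a + h) (b + h) (z + sqrt t *\<^sub>R x)"
      using shell[of a b z] by (simp add: add.assoc)
  next
    fix x show "- \<Delta> \<le> ?T (a + h) (b + h) (z + sqrt t *\<^sub>R x) - ?G (a + h) (b + h) (z + sqrt t *\<^sub>R x)"
      using D\<Delta>[of "a + h" "b + h" "z + sqrt t *\<^sub>R x"] by linarith
  next
    show "?T a b z - ?G a b z \<le> \<Delta>" using D\<Delta>[of a b z] by linarith
    show "(\<integral>x. ?T (a + h) (b + h) (z + sqrt t *\<^sub>R x) - ?G (a + h) (b + h) (z + sqrt t *\<^sub>R x) \<partial>gauss2) \<le> \<delta>"
      unfolding int using \<delta>[of "a + h" "b + h" z] by linarith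
  qed
  have DB': "bounded_borel \<Delta> (\<lambda>x. ?G a b (z + sqrt t *\<^sub>R x) - ?T a b (z + sqrt t *\<^sub>R x))" for a b z
    using DB[of a b z] by (auto simp: bounded_borel_def abs_minus_commute
      dest: borel_measurable_uminus)
  have down: "?G a b z - ?T a b z \<le> \<delta> + e + \<Delta> / 2" for a b z
  proof (rule smoothing_chebyshev[OF DB'[of "a - h" "b - h" z] _ _ _ \<Delta>0 e0 t h(2)])
    fix x :: "real \<times> real" assume "t * (norm x)\<^sup>2 \<le> h\<^sup>2"
    then have v: "norm (sqrt t *\<^sub>R x) \<le> h" by (intro nv[of x]) auto
    have "?T (a - h) (b - h) (z + sqrt t *\<^sub>R x) \<le> ?T a b (z + 0)"
      by (rule avg_power_mono[OF bounded_borel_wedge bounded_borel_wedge \<mu> mono(1)[OF v]])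
    moreover have "?G (a - h - h) (b - h - h) (z + 0) \<le> ?G (a - h) (b - h) (z + sqrt t *\<^sub>R x)"
      using avg_power_mono[OF bounded_borel_wedge bounded_borel_wedge borel_prob_gauss[of "real n"] mono(3)[OF v, where a="a - h" and b="b - h"], where n=1 and z=z] by simp
    moreover have "?G a b z \<le> ?G (a - h - h) (b - h - h) z + e"
      using shell[of "a - 2 * h" "b - 2 * h" z] by simp
    ultimately show "?G a b z - ?T a b z - e \<le> ?G (a - h) (b - h) (z + sqrt t *\<^sub>R x) - ?T (a - h) (b - h) (z + sqrt t *\<^sub>R x)"
      by simp
  next
    fix x show "- \<Delta> \<le> ?G (a - h) (b - h) (z + sqrt t *\<^sub>R x) - ?T (a - h) (b - h) (z + sqrt t *\<^sub>R x)"
      using D\<Delta>[of "a - h" "b - h" "z + sqrt t *\<^sub>R x"] by linarith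
  next
    show "?G a b z - ?T a b z \<le> \<Delta>" using D\<Delta>[of a b z] by linarith
    have "(\<integral>x. ?G (a - h) (b - h) (z + sqrt t *\<^sub>R x) - ?T (a - h) (b - h) (z + sqrt t *\<^sub>R x) \<partial>gauss2) =
       - (\<integral>x. ?T (a - h) (b - h) (z + sqrt t *\<^sub>R x) - ?G (a - h) (b - h) (z + sqrt t *\<^sub>R x) \<partial>gauss2)"
      by (subst Bochner_Integration.integral_minus[symmetric]) simp
    then show "(\<integral>x. ?G (a - h) (b - h) (z + sqrt t *\<^sub>R x) - ?T (a - h) (b - h) (z + sqrt t *\<^sub>R x) \<partial>gauss2) \<le> \<delta>"
      unfolding int using \<delta>[of "a - h" "b - h" z] by linarith
  qed
  have "\<Delta> \<le> \<delta> + e + \<Delta> / 2"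
    unfolding \<Delta>_def
  proof (rule cSUP_least)
    fix p :: "real \<times> real \<times> real \<times> real"
    obtain a b z where p: "p = (a, b, z)" by (cases p) auto
    show "?D p \<le> \<delta> + e + (SUP p. ?D p) / 2"
      using up[of a b z] down[of a b z] unfolding p \<Delta>_def[symmetric] by simp
  qed simp
  then have "\<Delta> \<le> 2 * \<delta> + 2 * e" by simp
  \<comment> \<open>Here 2 e is 8 h / sqrt n, and h is at most 3 sqrt t.\<close>
  moreover have "2 * e \<le> 24 * sqrt t / sqrt n" unfolding e_def using h3 by (simp add: divide_right_mono)
  ultimately show ?thesis using D\<Delta>[of a b z] by linarith
qed

section \<open>Sums that govern the recurrence, and the induction\<close>

lemma sum_inverse_sqrt_le: "(\<Sum>k<n. 1 / sqrt (real (Suc k))) \<le> 2 * sqrt n"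
proof (induction n)
  case (Suc n)
  let ?a = "sqrt (real n)" and ?b = "sqrt (real (Suc n))"
  have ab: "0 \<le> ?a" "?a \<le> ?b" "0 < ?b" "?b * ?b = ?a * ?a + 1" by auto
  have "2 * ?a * ?b + 1 \<le> 2 * ?b * ?b"
    using zero_le_square[of "?b - ?a"] ab(4) by (simp add: algebra_simps)
  then have "2 * ?a + 1 / ?b \<le> 2 * ?b" using ab(3) by (simp add: field_simps)
  then show ?case using Suc by simp
qed simp

text \<open>Each summand is below the decrement of 6 / sqrt u: with a = sqrt u and b = sqrt (u + 1)
  the decrement is 6 / (a b (a + b)), and b \<le> 3 a / 2 gives b (a + b) \<le> 15 a^2 / 4. The
  bound is uniform in the length of the sum and vanishes for large t, which is what makes the
  recurrence contract.\<close>

lemma sum_inverse_three_halves_le: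
  assumes t: "1 \<le> t"
  shows "(\<Sum>j<n. 1 / ((real j + t) * sqrt (real j + t))) \<le> 6 / sqrt t"
proof -
  have *: "1 / (u * sqrt u) \<le> 6 / sqrt u - 6 / sqrt (u + 1)" if u: "1 \<le> u" for u
  proof -
    define a b where "a = sqrt u" and "b = sqrt (u + 1)"
    have a: "1 \<le> a" "u = a * a" and b: "0 < b" "b * b = a * a + 1" using u by (auto simp: a_def b_def)
    have aa: "1 \<le> a * a" using a mult_mono[of 1 a 1 a] by simp
    have ba: "b \<le> 3 / 2 * a" by (rule power2_le_imp_le) (use a b aa in \<open>auto simp: power2_eq_square\<close>)
    have "(b - a) * (a + b) = 1" using b by (simp add: algebra_simps)
    then have e: "b - a = 1 / (a + b)" using a b by (simp add: field_simps)
    have "b * (a + b) \<le> (3 / 2 * a) * (a + 3 / 2 * a)" using ba a b by (intro mult_mono) auto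
    also have "\<dots> \<le> 6 * (a * a)" using aa by simp
    finally have "b * (a + b) \<le> 6 * (a * a)" .
    then have "1 / (a * a * a) \<le> 6 / (a * (b * (a + b)))"
      using a b by (simp add: divide_simps mult_ac)
    also have "\<dots> = 6 * (b - a) / (a * b)" unfolding e by (simp add: field_simps)
    also have "\<dots> = 6 / a - 6 / b" using a b by (simp add: field_simps)
    finally show ?thesis unfolding a_def[symmetric] b_def[symmetric] by (simp only: a(2))
  qed
  have "(\<Sum>j<n. 1 / ((real j + t) * sqrt (real j + t))) \<le> 6 / sqrt t - 6 / sqrt (real n + t)"
  proof (induction n)
    case (Suc n)
    have "1 / ((real n + t) * sqrt (real n + t)) \<le> 6 / sqrt (real n + t) - 6 / sqrt (real n + t + 1)"
      using t by (intro *) auto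
    then show ?case using Suc by (simp add: add_ac)
  qed simp
  also have "\<dots> \<le> 6 / sqrt t" using t by simp
  finally show ?thesis .
qed

text \<open>Since k + 1 and n - k - 1 + t add up to n + t, sqrt n is at most the sum of their roots,
  and multiplying a summand by sqrt n cancels one root at a time. The first cancellation leaves the
  three-halves sum, at most 6 / sqrt t. The second leaves, after 1 / sqrt t is extracted, a discrete
  beta integral, at most 4.\<close>

lemma convolution_sum_le:
  assumes t: "1 \<le> t" and n: "1 \<le> n"
  shows "(\<Sum>k<n. (1 / sqrt (real (Suc k))) / ((real (n - Suc k) + t) * sqrt (real (n - Suc k) + t)))
     \<le> 10 / (sqrt t * sqrt n)"
proof -
  let ?m = "\<lambda>k. real (n - Suc k) + t"
  have sq: "sqrt n \<le> sqrt x + sqrt y" if "real n \<le> x + y" "0 \<le> x" "0 \<le> y" for x y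
  proof -
    have "sqrt n \<le> sqrt (x + y)" using that by simp
    also have "\<dots> \<le> sqrt x + sqrt y" by (rule sqrt_add_le_add_sqrt) (use that in auto)
    finally show ?thesis .
  qed
  have A: "sqrt n * (1 / (sqrt (Suc k) * sqrt (real (n - k)))) \<le> 1 / sqrt (Suc k) + 1 / sqrt (real (n - k))"
    if k: "k < n" for k
  proof -
    have "sqrt n \<le> sqrt (Suc k) + sqrt (n - k)" using k by (intro sq) auto
    from divide_right_mono[OF this, of "sqrt (Suc k) * sqrt (real (n - k))"]
    show ?thesis using k by (simp add: add_divide_distrib add.commute)
  qed
  have refl: "(\<Sum>k<n. 1 / sqrt (real (n - k))) = (\<Sum>k<n. 1 / sqrt (real (Suc k)))"
    using sum.nat_diff_reindex[of "\<lambda>k. 1 / sqrt (real (Suc k))" n, symmetric]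
    by (simp add: Suc_diff_Suc)
  have "sqrt n * (\<Sum>k<n. 1 / (sqrt (Suc k) * sqrt (real (n - k)))) \<le> (\<Sum>k<n. 1 / sqrt (real (Suc k)) + 1 / sqrt (real (n - k)))"
    unfolding sum_distrib_left using A by (intro sum_mono) auto
  also have "\<dots> \<le> 4 * sqrt n"
    unfolding sum.distrib refl using sum_inverse_sqrt_le[of n] by simp
  finally have S: "(\<Sum>k<n. 1 / (sqrt (Suc k) * sqrt (real (n - k)))) \<le> 4"
    using n by simp
  have B: "sqrt n * ((1 / sqrt (real (Suc k))) / (?m k * sqrt (?m k))) \<le>
     1 / (?m k * sqrt (?m k)) + (1 / sqrt t) * (1 / (sqrt (Suc k) * sqrt (real (n - k))))" if k: "k < n" for k
  proof -
    have m: "0 < ?m k" "t \<le> ?m k" "real (n - k) \<le> ?m k" using k t by auto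
    have "sqrt n \<le> sqrt (Suc k) + sqrt (?m k)" using k t by (intro sq) auto
    from divide_right_mono[OF this, of "sqrt (Suc k) * (?m k * sqrt (?m k))"]
    have "sqrt n * ((1 / sqrt (real (Suc k))) / (?m k * sqrt (?m k))) \<le>
       (sqrt (Suc k) + sqrt (?m k)) / (sqrt (Suc k) * (?m k * sqrt (?m k)))" using m by (simp add: mult.assoc)
    also have "\<dots> = 1 / (?m k * sqrt (?m k)) + 1 / (sqrt (Suc k) * ?m k)"
      using m by (simp add: add_divide_distrib)
    also have "1 / (sqrt (Suc k) * ?m k) = 1 / (sqrt (?m k) * (sqrt (Suc k) * sqrt (?m k)))"
      using m by (simp add: mult_ac)
    also have "\<dots> \<le> 1 / (sqrt t * (sqrt (Suc k) * sqrt (real (n - k))))"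
      using m t k by (intro divide_left_mono mult_mono mult_pos_pos) auto
    finally show ?thesis by simp
  qed
  have "sqrt n * (\<Sum>k<n. (1 / sqrt (real (Suc k))) / (?m k * sqrt (?m k))) \<le>
     (\<Sum>k<n. 1 / (?m k * sqrt (?m k))) + (1 / sqrt t) * (\<Sum>k<n. 1 / (sqrt (Suc k) * sqrt (real (n - k))))"
    unfolding sum_distrib_left sum.distrib[symmetric] using B by (intro sum_mono) auto
  also have "(\<Sum>k<n. 1 / (?m k * sqrt (?m k))) \<le> 6 / sqrt t"
    using sum_inverse_three_halves_le[OF t, of n] sum.nat_diff_reindex[of "\<lambda>j. 1 / ((real j + t) * sqrt (real j + t))" n] by simp
  also have "(1 / sqrt t) * (\<Sum>k<n. 1 / (sqrt (Suc k) * sqrt (real (n - k)))) \<le> (1 / sqrt t) * 4"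
    using S t by (intro mult_left_mono) auto
  finally have "sqrt n * (\<Sum>k<n. (1 / sqrt (real (Suc k))) / (?m k * sqrt (?m k))) \<le> 10 / sqrt t"
    by (simp add: add_divide_distrib[symmetric])
  then show ?thesis using n t by (simp add: field_simps)
qed

lemma berry_esseen_wedge:
  assumes \<mu>: "isotropic \<mu>" and rq: "r\<^sup>2 + q\<^sup>2 = 1"
  obtains K where "\<And>n a b z. 1 \<le> n \<Longrightarrow>
    \<bar>(avg \<mu> ^^ n) (wedge r q a b) z - avg (gauss n) (wedge r q a b) z\<bar> \<le> K / sqrt n"
proof -
  obtain C where C: "0 \<le> C" and step: "\<And>F B s z. bounded_borel B F \<Longrightarrow> 0 < s \<Longrightarrow>
       \<bar>avg \<mu> (avg (gauss s) F) z - avg (gauss (s + 1)) F z\<bar> \<le> C * B / (s * sqrt s)"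
    using isotropic_gauss_step[OF \<mu>] by blast
  have bp: "borel_prob \<mu>" using \<mu> by (simp add: isotropic_def)
  \<comment> \<open>The induction step needs 2 C + 20 C K / u + 24 u \<le> K / 2. This u makes 20 C
    / u at most 1/4, and K is four times 2 C + 24 u.\<close>
  define u where "u = 80 * C + 1"
  define t where "t = u\<^sup>2"
  define K where "K = 8 * C + 96 * u"
  have u: "1 \<le> u" using C by (simp add: u_def)
  then have t: "1 \<le> t" "sqrt t = u" by (auto simp: t_def)
  have K: "0 \<le> K" using C u by (simp add: K_def)
  \<comment> \<open>Writing \<open>Suc n\<close> under the root includes n = 0, where both functions
    are the wedge itself and which enters the sum as its term k = 0. The step proves the bound with
    K / 2, and the spare factor pays for sqrt (n + 1) \<le> 2 sqrt n.\<close>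
  have "\<bar>(avg \<mu> ^^ n) (wedge r q a b) z - avg (gauss n) (wedge r q a b) z\<bar> \<le> K / sqrt (Suc n)" for n a b z
  proof (induction n arbitrary: a b z rule: less_induct)
    case (less n)
    show ?case
    proof (cases "n = 0")
      case True
      then show ?thesis using K by (simp add: avg_gauss_0[OF bounded_borel_wedge])
    next
      case False
      then have n: "1 \<le> n" by simp
      let ?S = "\<Sum>k<n. K / sqrt (Suc k) / ((real (n - Suc k) + t) * sqrt (real (n - Suc k) + t))"
      have "?S = K * (\<Sum>k<n. (1 / sqrt (real (Suc k))) / ((real (n - Suc k) + t) * sqrt (real (n - Suc k) + t)))"
        by (simp add: sum_distrib_left)
      also have "\<dots> \<le> K * (10 / (sqrt t * sqrt n))"
        by (intro mult_left_mono convolution_sum_le t n K)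
      finally have S: "?S \<le> K * (10 / (u * sqrt n))" by (simp add: t)
      have "\<bar>(avg \<mu> ^^ n) (avg (gauss t) (wedge r q a b)) z - avg (gauss (n + t)) (wedge r q a b) z\<bar>
          \<le> C / sqrt n + C * (K * (10 / (u * sqrt n)))" for a b z
        using lindeberg_telescope[where F="wedge r q a b" and \<delta>="\<lambda>k. K / sqrt (Suc k)" and z=z,
            OF bp bounded_borel_wedge C step less n t(1)] mult_left_mono[OF S C] by linarith
      then have "\<bar>(avg \<mu> ^^ n) (wedge r q a b) z - avg (gauss n) (wedge r q a b) z\<bar> \<le>
         2 * (C / sqrt n + C * (K * (10 / (u * sqrt n)))) + 24 * sqrt t / sqrt n"
        using t by (intro wedge_smoothing[OF bp rq _ n]) auto
      also have "\<dots> = (2 * C + 20 * C / u * K + 24 * u) / sqrt n"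
        unfolding t using n u by (simp add: field_simps)
      also have "\<dots> \<le> (K / 2) / sqrt n"
      proof (rule divide_right_mono)
        have "20 * C / u \<le> 1 / 4" using C by (simp add: u_def field_simps)
        from mult_right_mono[OF this K] show "2 * C + 20 * C / u * K + 24 * u \<le> K / 2" by (simp add: K_def)
      qed simp
      also have "\<dots> \<le> K / sqrt (Suc n)"
      proof -
        have "sqrt (Suc n) \<le> sqrt (4 * n)" using n by simp
        also have "\<dots> = 2 * sqrt n" by (simp add: real_sqrt_mult)
        finally have "sqrt (Suc n) \<le> 2 * sqrt n" .
        then have "K / (2 * sqrt n) \<le> K / sqrt (Suc n)" using K n by (intro divide_left_mono) auto
        then show ?thesis by simp
      qed
      finally show ?thesis .
    qed
  qed
  moreover have "K / sqrt (Suc n) \<le> K / sqrt n" if "1 \<le> n" for n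
    using K that by (intro divide_left_mono) auto
  ultimately show ?thesis using that[of K] by (meson order_trans)
qed

section \<open>From wedges to quadrants\<close>

lemma avg_distr:
  assumes \<mu>: "borel_prob \<mu>" and [measurable]: "L \<in> borel_measurable borel" and h: "bounded_borel B h"
    and add: "\<And>x y. L (x + y) = L x + L y"
  shows "avg \<mu> (\<lambda>w. h (L w)) z = avg (distr \<mu> borel L) h (L z)"
proof -
  have [measurable_cong]: "sets \<mu> = sets borel" using \<mu> by (simp add: borel_prob_def)
  note [measurable] = bounded_borelD(2)[OF h]
  show ?thesis unfolding avg_def by (subst integral_distr) (auto simp: add)
qed

text \<open>An additive map intertwines the convolutions with a law and with its image. Injectivity
  plays no part, so the estimate also passes to laws concentrated on a line.\<close>

lemma avg_power_distr:
  assumes \<mu>: "borel_prob \<mu>" and L: "L \<in> borel_measurable borel" and h: "bounded_borel B h"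
    and add: "\<And>x y. L (x + y) = L x + L y"
  shows "(avg \<mu> ^^ n) (\<lambda>w. h (L w)) z = (avg (distr \<mu> borel L) ^^ n) h (L z)"
proof (induction n arbitrary: z)
  case (Suc n)
  have [measurable_cong]: "sets \<mu> = sets borel" using \<mu> by (simp add: borel_prob_def)
  have "L \<in> \<mu> \<rightarrow>\<^sub>M borel" using L by measurable
  then have "borel_prob (distr \<mu> borel L)" using \<mu> by (intro borel_prob_distr) (simp_all add: borel_prob_def)
  then have b: "bounded_borel B ((avg (distr \<mu> borel L) ^^ n) h)" by (rule bounded_borel_avg_power[OF h])
  have "(avg \<mu> ^^ n) (\<lambda>w. h (L w)) = (\<lambda>w. (avg (distr \<mu> borel L) ^^ n) h (L w))" using Suc by blast
  then show ?case using avg_distr[OF \<mu> L b add] by simp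
qed simp

definition quadrant :: "real \<Rightarrow> real \<Rightarrow> real \<times> real \<Rightarrow> real" where
  "quadrant a b w = of_bool (fst w \<le> a \<and> snd w \<le> b)"

lemma bounded_borel_quadrant: "bounded_borel 1 (quadrant a b)"
proof (rule bounded_borelI)
  show "quadrant a b \<in> borel_measurable borel" unfolding quadrant_def by measurable
qed (simp add: quadrant_def)

text \<open>The wedge is the preimage of a quadrant under the map that builds
  \<open>bivariate_normal\<close> from two independent coordinates, and scaling by sqrt n acts on
  the noise and on both bounds alike.\<close>

lemma avg_gauss_wedge_eq_cdf:
  assumes n: "0 < n"
  shows "avg (gauss n) (wedge r (sqrt (1 - r\<^sup>2)) (sqrt n * a) (sqrt n * b)) 0 = bivariate_normal_cdf a b r"
proof -
  let ?L = "\<lambda>(x, y). (x, r * x + sqrt (1 - r\<^sup>2) * y)"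
  let ?A = "{(x, y). x \<le> a \<and> y \<le> b} :: (real \<times> real) set"
  have L[measurable]: "?L \<in> gauss2 \<rightarrow>\<^sub>M borel"
  proof -
    have "(\<lambda>z :: real \<times> real. (fst z, r * fst z + sqrt (1 - r\<^sup>2) * snd z)) \<in> borel_measurable borel"
      by (intro borel_measurable_Pair) measurable
    then show ?thesis by (simp add: case_prod_beta' cong: measurable_cong_sets)
  qed
  have A: "?A \<in> sets borel"
  proof -
    have "?A = {..(a, b)}" by auto
    then show ?thesis by simp
  qed
  have "bivariate_normal_cdf a b r = measure gauss2 (?L -` ?A \<inter> space gauss2)"
    unfolding bivariate_normal_cdf_def bivariate_normal_def gauss2_def[symmetric]
    by (rule measure_distr[OF L A])
  also have "\<dots> = (\<integral>x. indicator (?L -` ?A \<inter> space gauss2) x \<partial>gauss2)"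
    using measurable_sets[OF L A] by simp
  also have "\<dots> = (\<integral>x. wedge r (sqrt (1 - r\<^sup>2)) (sqrt n * a) (sqrt n * b) (0 + sqrt n *\<^sub>R x) \<partial>gauss2)"
  proof (intro Bochner_Integration.integral_cong refl)
    fix x :: "real \<times> real" assume x: "x \<in> space gauss2"
    have n: "0 < sqrt n" using n by simp
    have e: "r * (sqrt n * fst x) + sqrt (1 - r\<^sup>2) * (sqrt n * snd x) = sqrt n * (r * fst x + sqrt (1 - r\<^sup>2) * snd x)"
      by (simp add: algebra_simps)
    show "indicator (?L -` ?A \<inter> space gauss2) x = wedge r (sqrt (1 - r\<^sup>2)) (sqrt n * a) (sqrt n * b) (0 + sqrt n *\<^sub>R x)"
      using x unfolding wedge_def by (simp add: indicator_def case_prod_beta e mult_le_cancel_left_pos[OF n])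
  qed
  also have "\<dots> = avg (gauss n) (wedge r (sqrt (1 - r\<^sup>2)) (sqrt n * a) (sqrt n * b)) 0"
    by (rule avg_gauss[OF bounded_borel_wedge, symmetric])
  finally show ?thesis by simp
qed

lemma integrable_AE_bounded:
  fixes f :: "'b \<Rightarrow> real"
  assumes "prob_space M" "f \<in> borel_measurable M" "AE x in M. \<bar>f x\<bar> \<le> B"
  shows "integrable M f"
  using assms by (intro finite_measure.integrable_const_bound[where B=B]) (auto simp: prob_space_def)

text \<open>For \<open>\<bar>r\<bar> = 1\<close> the second coordinate of the isotropic vector is an independent normal variable, which
  the linear map ignores.\<close>

lemma isotropic_lift:
  assumes Q: "prob_space Q" and [measurable]: "X1 \<in> borel_measurable Q" "X2 \<in> borel_measurable Q"
    and bd: "AE w in Q. \<bar>X1 w\<bar> \<le> B" "AE w in Q. \<bar>X2 w\<bar> \<le> B"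
    and mean: "(\<integral>w. X1 w \<partial>Q) = 0" "(\<integral>w. X2 w \<partial>Q) = 0"
    and var: "(\<integral>w. (X1 w)\<^sup>2 \<partial>Q) = 1" "(\<integral>w. (X2 w)\<^sup>2 \<partial>Q) = 1"
    and cov: "(\<integral>w. X1 w * X2 w \<partial>Q) = r"
  obtains \<mu> where "isotropic \<mu>" "r\<^sup>2 + (sqrt (1 - r\<^sup>2))\<^sup>2 = 1"
    "distr \<mu> borel (\<lambda>w. (fst w, r * fst w + sqrt (1 - r\<^sup>2) * snd w)) = distr Q borel (\<lambda>w. (X1 w, X2 w))"
proof -
  interpret Q: prob_space Q by fact
  let ?q = "sqrt (1 - r\<^sup>2)" and ?L = "\<lambda>w. (fst w, r * fst w + sqrt (1 - r\<^sup>2) * snd w) :: real \<times> real"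
  have L[measurable]: "?L \<in> borel_measurable borel" by (intro borel_measurable_Pair) measurable
  have bd2: "AE w in Q. \<bar>X1 w\<bar> \<le> B \<and> \<bar>X2 w\<bar> \<le> B \<and> \<bar>(X1 w)\<^sup>2\<bar> \<le> B * B \<and> \<bar>(X2 w)\<^sup>2\<bar> \<le> B * B \<and> \<bar>X1 w * X2 w\<bar> \<le> B * B"
  proof -
    have m: "\<bar>x * y\<bar> \<le> B * B" if "\<bar>x\<bar> \<le> B" "\<bar>y\<bar> \<le> B" for x y :: real
      unfolding abs_mult using that by (intro mult_mono) auto
    show ?thesis using bd unfolding power2_eq_square by eventually_elim (intro conjI m)
  qed
  have i1: "integrable Q X1" by (rule integrable_AE_bounded[OF Q, of _ B]) (use bd in auto)
  have i2: "integrable Q X2" by (rule integrable_AE_bounded[OF Q, of _ B]) (use bd in auto)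
  have i11: "integrable Q (\<lambda>w. (X1 w)\<^sup>2)"
    by (rule integrable_AE_bounded[OF Q, of _ "B * B"]) (measurable, use bd2 in \<open>eventually_elim, simp\<close>)
  have i22: "integrable Q (\<lambda>w. (X2 w)\<^sup>2)"
    by (rule integrable_AE_bounded[OF Q, of _ "B * B"]) (measurable, use bd2 in \<open>eventually_elim, simp\<close>)
  have i12: "integrable Q (\<lambda>w. X1 w * X2 w)"
    by (rule integrable_AE_bounded[OF Q, of _ "B * B"]) (measurable, use bd2 in \<open>eventually_elim, simp\<close>)
  have sq: "(X2 w - r * X1 w)\<^sup>2 = (X2 w)\<^sup>2 - 2 * r * (X1 w * X2 w) + r\<^sup>2 * (X1 w)\<^sup>2" for w
    by (simp add: power2_eq_square algebra_simps)
  \<comment> \<open>The residual of X2 after projection on X1 has variance 1 - r^2. That it is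
    nonnegative gives |r| \<le> 1, and that it vanishes for |r| = 1 makes X2 a multiple of X1
    there.\<close>
  have res: "(\<integral>w. (X2 w - r * X1 w)\<^sup>2 \<partial>Q) = 1 - r\<^sup>2"
    unfolding sq using i11 i22 i12 var cov by (simp add: power2_eq_square)
  have "0 \<le> (\<integral>w. (X2 w - r * X1 w)\<^sup>2 \<partial>Q)" by (intro Bochner_Integration.integral_nonneg) simp
  then have r: "r\<^sup>2 \<le> 1" unfolding res by simp
  then have q2: "?q\<^sup>2 = 1 - r\<^sup>2" by simp
  show ?thesis
  proof (cases "r\<^sup>2 = 1")
    case False
    then have q: "0 < ?q" using r by simp
    \<comment> \<open>Gram--Schmidt: the normalised residual is uncorrelated with X1.\<close>
    define W2 where "W2 w = (X2 w - r * X1 w) / ?q" for w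
    have [measurable]: "W2 \<in> borel_measurable Q" unfolding W2_def by measurable
    define \<mu> where "\<mu> = distr Q borel (\<lambda>w. (X1 w, W2 w))"
    have W[measurable]: "(\<lambda>w. (X1 w, W2 w)) \<in> Q \<rightarrow>\<^sub>M borel" by (intro borel_measurable_Pair) measurable
    have sq': "(W2 w)\<^sup>2 = (X2 w - r * X1 w)\<^sup>2 / ?q\<^sup>2" for w unfolding W2_def by (simp only: power_divide)
    have "isotropic \<mu>"
      unfolding isotropic_def
    proof (intro conjI)
      show "borel_prob \<mu>" unfolding \<mu>_def by (intro borel_prob_distr Q) measurable
      show "integrable \<mu> (\<lambda>x. norm x ^ 3)"
      proof (rule integrable_AE_bounded)
        show "prob_space \<mu>" unfolding \<mu>_def by (intro Q.prob_space_distr) measurable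
        show "(\<lambda>x. norm x ^ 3) \<in> borel_measurable \<mu>" unfolding \<mu>_def by measurable
        have "AE w in Q. norm (X1 w, W2 w) ^ 3 \<le> (B + (B + \<bar>r\<bar> * B) / ?q) ^ 3"
          using bd
        proof eventually_elim
          case (elim w)
          have "\<bar>r * X1 w\<bar> \<le> \<bar>r\<bar> * B" using elim by (simp add: abs_mult mult_left_mono)
          then have "\<bar>X2 w - r * X1 w\<bar> \<le> B + \<bar>r\<bar> * B" using elim by linarith
          then have "\<bar>W2 w\<bar> \<le> (B + \<bar>r\<bar> * B) / ?q" unfolding W2_def using q by (simp add: abs_divide divide_right_mono)
          moreover have "norm (X1 w, W2 w) \<le> \<bar>X1 w\<bar> + \<bar>W2 w\<bar>"
            by (simp add: norm_Pair sqrt_sum_squares_le_sum_abs)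
          ultimately show ?case using elim by (intro power_mono) auto
        qed
        then show "AE x in \<mu>. \<bar>norm x ^ 3\<bar> \<le> (B + (B + \<bar>r\<bar> * B) / ?q) ^ 3"
          unfolding \<mu>_def by (subst AE_distr_iff) auto
      qed
      show "(\<integral>x. fst x \<partial>\<mu>) = 0" unfolding \<mu>_def by (subst integral_distr) (auto simp: mean)
      show "(\<integral>x. snd x \<partial>\<mu>) = 0" unfolding \<mu>_def using i1 i2
        by (subst integral_distr) (auto simp: mean W2_def)
      show "(\<integral>x. (fst x)\<^sup>2 \<partial>\<mu>) = 1" unfolding \<mu>_def by (subst integral_distr) (auto simp: var)
      show "(\<integral>x. (snd x)\<^sup>2 \<partial>\<mu>) = 1" unfolding \<mu>_def
        by (subst integral_distr) (use False in \<open>auto simp: sq' q2 res\<close>)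
      have c: "X1 w * W2 w = (X1 w * X2 w - r * (X1 w)\<^sup>2) / ?q" for w
        unfolding W2_def by (simp add: power2_eq_square algebra_simps)
      have "(\<integral>w. X1 w * W2 w \<partial>Q) = 0" unfolding c using i12 i11 by (simp add: cov var)
      then show "(\<integral>x. fst x * snd x \<partial>\<mu>) = 0" unfolding \<mu>_def by (subst integral_distr) auto
    qed
    moreover have "distr \<mu> borel ?L = distr Q borel (\<lambda>w. (X1 w, X2 w))"
    proof -
      have "distr \<mu> borel ?L = distr Q borel (\<lambda>w. ?L (X1 w, W2 w))"
        unfolding \<mu>_def by (subst distr_distr) (auto simp: comp_def)
      also have "(\<lambda>w. ?L (X1 w, W2 w)) = (\<lambda>w. (X1 w, X2 w))"
        using q by (auto simp: W2_def)
      finally show ?thesis .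
    qed
    ultimately show ?thesis using q2 by (intro that[of \<mu>]) auto
  next
    case True
    let ?N = std_normal_distribution
    have "(\<integral>w. (X2 w - r * X1 w)\<^sup>2 \<partial>Q) = 0" unfolding res using True by simp
    moreover have "integrable Q (\<lambda>w. (X2 w - r * X1 w)\<^sup>2)"
      unfolding sq using i11 i22 i12 by simp
    ultimately have "AE w in Q. (X2 w - r * X1 w)\<^sup>2 = 0"
      by (subst (asm) integral_nonneg_eq_0_iff_AE) auto
    then have ae: "AE w in Q. X2 w = r * X1 w" by eventually_elim simp
    define X where "X = distr Q borel X1"
    interpret X: prob_space X unfolding X_def by (intro Q.prob_space_distr) measurable
    interpret N: prob_space ?N by (rule prob_std_normal)
    interpret pair_prob_space X ?N ..
    have [measurable_cong]: "sets X = sets borel" by (simp add: X_def)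
    define \<mu> where "\<mu> = X \<Otimes>\<^sub>M ?N"
    have sets\<mu>[measurable_cong]: "sets \<mu> = sets borel"
    proof -
      have "sets \<mu> = sets (borel \<Otimes>\<^sub>M borel :: (real \<times> real) measure)" unfolding \<mu>_def by (intro sets_pair_measure_cong) (auto simp: X_def)
      then show ?thesis unfolding borel_prod .
    qed
    have Ni: "integrable ?N (\<lambda>x. x)" "integrable ?N (\<lambda>x. x\<^sup>2)" "integrable ?N (\<lambda>x. \<bar>x\<bar> ^ 3)"
      using integrable_std_normal_distribution_moment[of 1] integrable_std_normal_distribution_moment[of 2]
        integrable_abs[OF integrable_std_normal_distribution_moment[of 3]] by (auto simp: power_abs)
    have Nm: "(\<integral>x. x \<partial>?N) = 0" "(\<integral>x. x\<^sup>2 \<partial>?N) = 1"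
      using integral_std_normal_distribution_moment_odd[of 1] std_normal_distribution_even_moments(1)[of 1]
      by (simp_all add: fact_numeral)
    have Xi: "integrable X f \<longleftrightarrow> integrable Q (\<lambda>w. f (X1 w))" "(\<integral>x. f x \<partial>X) = (\<integral>w. f (X1 w) \<partial>Q)"
      if "f \<in> borel_measurable borel" for f :: "real \<Rightarrow> real"
      using that unfolding X_def by (simp_all add: integrable_distr_eq integral_distr)
    have fac: "(\<integral>z. f (fst z) * g (snd z) \<partial>\<mu>) = integral\<^sup>L X f * integral\<^sup>L ?N g \<and> integrable \<mu> (\<lambda>z. f (fst z) * g (snd z))"
      if f: "integrable X f" and g: "integrable ?N g" for f g :: "real \<Rightarrow> real"
    proof -
      have [measurable]: "f \<in> borel_measurable borel" "g \<in> borel_measurable borel"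
        using borel_measurable_integrable[OF f] borel_measurable_integrable[OF g] by (simp_all add: X_def)
      have i: "integrable \<mu> (\<lambda>z. f (fst z) * g (snd z))"
        unfolding \<mu>_def
      proof (rule Fubini_integrable)
        show "integrable X (\<lambda>x. \<integral>y. norm (f (fst (x, y)) * g (snd (x, y))) \<partial>?N)"
          using integrable_mult_left[OF integrable_abs[OF f]] by (simp add: abs_mult)
      qed (use g in auto)
      have "(\<integral>z. f (fst z) * g (snd z) \<partial>\<mu>) = (\<integral>x. (\<integral>y. f x * g y \<partial>?N) \<partial>X)"
        using i unfolding \<mu>_def by (subst integral_fst'[symmetric]) auto
      also have "\<dots> = (\<integral>x. f x * integral\<^sup>L ?N g \<partial>X)" by (simp only: integral_mult_right_zero)
      finally show ?thesis using i by (simp only: integral_mult_left_zero)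
    qed
    have X1: "integrable X (\<lambda>x. x)" "integrable X (\<lambda>x. x\<^sup>2)" "(\<integral>x. x \<partial>X) = 0" "(\<integral>x. x\<^sup>2 \<partial>X) = 1"
      using i1 i11 mean var by (simp_all add: Xi)
    have c1: "integrable X (\<lambda>x. 1)" "integrable ?N (\<lambda>x. 1 :: real)" "(\<integral>x. 1 \<partial>X) = (1 :: real)" "(\<integral>x. 1 \<partial>?N) = (1 :: real)"
      using X.prob_space N.prob_space by simp_all
    have "isotropic \<mu>"
      unfolding isotropic_def
    proof (intro conjI)
      show "borel_prob \<mu>" using sets\<mu> P.prob_space_axioms unfolding borel_prob_def \<mu>_def by simp
      have "AE w in Q. \<bar>\<bar>X1 w\<bar> ^ 3\<bar> \<le> B ^ 3" using bd(1) by eventually_elim (use power_mono[where n=3] in force)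
      then have "integrable Q (\<lambda>w. \<bar>X1 w\<bar> ^ 3)" by (intro integrable_AE_bounded[OF Q]) auto
      then have X3: "integrable X (\<lambda>x. \<bar>x\<bar> ^ 3)" by (subst Xi) auto
      show "integrable \<mu> (\<lambda>x. norm x ^ 3)"
      proof (rule Bochner_Integration.integrable_bound)
        show "integrable \<mu> (\<lambda>z. 8 * (\<bar>fst z\<bar> ^ 3 * 1 + 1 * \<bar>snd z\<bar> ^ 3))"
          by (intro integrable_mult_right Bochner_Integration.integrable_add fac[THEN conjunct2] X3 Ni c1)
        show "(\<lambda>x. norm x ^ 3) \<in> borel_measurable \<mu>" by measurable
        have "norm z ^ 3 \<le> 8 * (\<bar>fst z\<bar> ^ 3 * 1 + 1 * \<bar>snd z\<bar> ^ 3)" for z :: "real \<times> real"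
        proof -
          let ?m = "max \<bar>fst z\<bar> \<bar>snd z\<bar>"
          have "norm z \<le> \<bar>fst z\<bar> + \<bar>snd z\<bar>" by (simp add: norm_prod_def sqrt_sum_squares_le_sum_abs)
          then have "norm z ^ 3 \<le> (2 * ?m) ^ 3" by (intro power_mono) auto
          also have "\<dots> \<le> 8 * (\<bar>fst z\<bar> ^ 3 + \<bar>snd z\<bar> ^ 3)" by (auto simp: power_mult_distrib max_def)
          finally show ?thesis by simp
        qed
        then show "AE z in \<mu>. norm (norm z ^ 3) \<le> norm (8 * (\<bar>fst z\<bar> ^ 3 * 1 + 1 * \<bar>snd z\<bar> ^ 3))"
          by (intro AE_I2) simp
      qed
      show "(\<integral>x. fst x \<partial>\<mu>) = 0" using fac[OF X1(1) c1(2)] X1 by simp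
      show "(\<integral>x. snd x \<partial>\<mu>) = 0" using fac[OF c1(1) Ni(1)] Nm by simp
      show "(\<integral>x. (fst x)\<^sup>2 \<partial>\<mu>) = 1" using fac[OF X1(2) c1(2)] X1(4) c1(4) by simp
      show "(\<integral>x. (snd x)\<^sup>2 \<partial>\<mu>) = 1" using fac[OF c1(1) Ni(2)] Nm(2) c1(3) by simp
      show "(\<integral>x. fst x * snd x \<partial>\<mu>) = 0" using fac[OF X1(1) Ni(1)] Nm by simp
    qed
    moreover have "distr \<mu> borel ?L = distr Q borel (\<lambda>w. (X1 w, X2 w))"
    proof -
      have q0: "?q = 0" using True by simp
      have m: "(\<lambda>x :: real. (x, r * x)) \<in> borel_measurable borel" by (intro borel_measurable_Pair) measurable
      have "distr \<mu> borel ?L = distr (distr \<mu> X fst) borel (\<lambda>x. (x, r * x))"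
        unfolding \<mu>_def using m by (subst distr_distr) (auto simp: comp_def q0)
      also have "distr \<mu> X fst = X"
        unfolding \<mu>_def by (rule N.distr_pair_fst)
      also have "distr X borel (\<lambda>x. (x, r * x)) = distr Q borel (\<lambda>w. (X1 w, r * X1 w))"
        unfolding X_def using m by (subst distr_distr) (auto simp: comp_def)
      also have "\<dots> = distr Q borel (\<lambda>w. (X1 w, X2 w))"
        using ae by (intro distr_cong_AE) (auto intro!: borel_measurable_Pair)
      finally show ?thesis .
    qed
    ultimately show ?thesis using q2 by (intro that[of \<mu>]) auto
  qed
qed

section \<open>Product measures and layer-cake integrals\<close>

lemma measurable_sum_coordinates:
  fixes W :: "nat \<Rightarrow> 'b \<Rightarrow> real \<times> real" and h :: "real \<times> real \<Rightarrow> real"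
  assumes W: "\<And>i. W i \<in> P \<rightarrow>\<^sub>M borel" and h: "h \<in> borel_measurable borel" and n: "{..<n} \<subseteq> I"
  shows "(\<lambda>x. h (z + (\<Sum>i<n. W i (x i)))) \<in> borel_measurable (\<Pi>\<^sub>M i\<in>I. P)"
proof (rule measurable_compose[OF _ h], intro borel_measurable_add borel_measurable_sum measurable_const)
  fix i assume "i \<in> {..<n}"
  then have "(\<lambda>x. x i) \<in> (\<Pi>\<^sub>M i\<in>I. P) \<rightarrow>\<^sub>M P" using n by (intro measurable_component_singleton) auto
  then show "(\<lambda>x. W i (x i)) \<in> borel_measurable (\<Pi>\<^sub>M i\<in>I. P)" by (rule measurable_compose[OF _ W])
qed simp

text \<open>Integrating out the last coordinate replaces h by \<open>avg \<gamma> h\<close>, so the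
  induction runs over all h at once. The maps \<open>W i\<close> may differ, since only the laws of
  the envelopes of the Y i agree.\<close>

lemma integral_PiM_sum:
  fixes W :: "nat \<Rightarrow> 'b \<Rightarrow> real \<times> real"
  assumes P: "prob_space P" and W[measurable]: "\<And>i. W i \<in> P \<rightarrow>\<^sub>M borel"
    and law: "\<And>i. distr P borel (W i) = \<gamma>" and h: "bounded_borel B h"
  shows "(\<integral>x. h (z + (\<Sum>i<n. W i (x i))) \<partial>(\<Pi>\<^sub>M i\<in>{..<n}. P)) = (avg \<gamma> ^^ n) h z"
  using h
proof (induction n arbitrary: h)
  case 0
  show ?case by (simp add: PiM_empty lebesgue_integral_count_space_finite)
next
  case (Suc n)
  interpret P: prob_space P by fact
  interpret S: product_prob_space "\<lambda>_. P" "{..<Suc n}" ..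
  note [measurable] = bounded_borelD(2)[OF Suc.prems]
  have \<gamma>: "borel_prob \<gamma>" unfolding law[of 0, symmetric] by (intro borel_prob_distr P) measurable
  have int: "integrable (\<Pi>\<^sub>M i\<in>insert n {..<n}. P) (\<lambda>x. h (z + (\<Sum>i<Suc n. W i (x i))))"
  proof (rule integrable_AE_bounded)
    show "prob_space (\<Pi>\<^sub>M i\<in>insert n {..<n}. P)" by (intro prob_space_PiM P)
    show "(\<lambda>x. h (z + (\<Sum>i<Suc n. W i (x i)))) \<in> borel_measurable (\<Pi>\<^sub>M i\<in>insert n {..<n}. P)"
      by (rule measurable_sum_coordinates[OF W bounded_borelD(2)[OF Suc.prems]]) auto
    show "AE x in \<Pi>\<^sub>M i\<in>insert n {..<n}. P. \<bar>h (z + (\<Sum>i<Suc n. W i (x i)))\<bar> \<le> B"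
      by (intro AE_I2 bounded_borelD(1)[OF Suc.prems])
  qed
  have "(\<integral>x. h (z + (\<Sum>i<Suc n. W i (x i))) \<partial>(\<Pi>\<^sub>M i\<in>{..<Suc n}. P)) =
     (\<integral>x. (\<integral>y. h (z + (\<Sum>i<Suc n. W i ((x(n := y)) i))) \<partial>P) \<partial>(\<Pi>\<^sub>M i\<in>{..<n}. P))"
    unfolding lessThan_Suc[of n] by (rule S.product_integral_insert) (use int in \<open>auto simp: lessThan_Suc\<close>)
  also have "\<dots> = (\<integral>x. avg \<gamma> h (z + (\<Sum>i<n. W i (x i))) \<partial>(\<Pi>\<^sub>M i\<in>{..<n}. P))"
  proof (rule Bochner_Integration.integral_cong[OF refl])
    fix x
    have "(\<Sum>i<n. W i ((x(n := y)) i)) = (\<Sum>i<n. W i (x i))" for y by (intro sum.cong) auto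
    then show "(\<integral>y. h (z + (\<Sum>i<Suc n. W i ((x(n := y)) i))) \<partial>P) = avg \<gamma> h (z + (\<Sum>i<n. W i (x i)))"
      unfolding avg_def law[of n, symmetric] by (subst integral_distr) (auto simp: add.assoc)
  qed
  also have "\<dots> = (avg \<gamma> ^^ n) (avg \<gamma> h) z" by (rule Suc.IH[OF bounded_borel_avg[OF Suc.prems \<gamma>]])
  finally show ?case by (simp only: funpow_Suc_right comp_apply)
qed

lemma integral_PiM_UNIV_sum:
  fixes W :: "nat \<Rightarrow> 'b \<Rightarrow> real \<times> real"
  assumes P: "prob_space P" and W[measurable]: "\<And>i. W i \<in> P \<rightarrow>\<^sub>M borel"
    and law: "\<And>i. distr P borel (W i) = \<gamma>" and h: "bounded_borel B h"
  shows "(\<integral>x. h (\<Sum>i<n. W i (x i)) \<partial>(\<Pi>\<^sub>M i\<in>UNIV. P)) = (avg \<gamma> ^^ n) h 0"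
proof -
  interpret P: prob_space P by fact
  interpret S: product_prob_space "\<lambda>_. P" "UNIV :: nat set" ..
  note [measurable] = bounded_borelD(2)[OF h]
  have m: "(\<lambda>x. h (0 + (\<Sum>i<n. W i (x i)))) \<in> borel_measurable (\<Pi>\<^sub>M i\<in>{..<n}. P)"
    by (rule measurable_sum_coordinates[OF W bounded_borelD(2)[OF h]]) auto
  have "(avg \<gamma> ^^ n) h 0 = (\<integral>x. h (0 + (\<Sum>i<n. W i (x i))) \<partial>(\<Pi>\<^sub>M i\<in>{..<n}. P))"
    by (rule integral_PiM_sum[OF assms, symmetric])
  also have "\<dots> = (\<integral>x. h (0 + (\<Sum>i<n. W i (x i))) \<partial>distr (\<Pi>\<^sub>M i\<in>UNIV. P) (\<Pi>\<^sub>M i\<in>{..<n}. P) (\<lambda>x. restrict x {..<n}))"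
    by (subst S.distr_PiM_restrict_finite) auto
  also have "\<dots> = (\<integral>x. h (0 + (\<Sum>i<n. W i (restrict x {..<n} i))) \<partial>(\<Pi>\<^sub>M i\<in>UNIV. P))"
    by (rule integral_distr[OF _ m]) (rule measurable_restrict_subset, simp)
  also have "\<dots> = (\<integral>x. h (\<Sum>i<n. W i (x i)) \<partial>(\<Pi>\<^sub>M i\<in>UNIV. P))"
    by simp
  finally show ?thesis ..
qed

section \<open>Layer-cake formulas\<close>

lemma set_integral_expectation:
  fixes k :: "real \<Rightarrow> 'b \<Rightarrow> real"
  assumes Q: "prob_space Q" and [measurable]: "(\<lambda>(t, w). k t w) \<in> borel_measurable (lborel \<Otimes>\<^sub>M Q)"
    and B: "\<And>t w. t \<in> {a..b} \<Longrightarrow> w \<in> space Q \<Longrightarrow> \<bar>k t w\<bar> \<le> B"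
  shows "(LBINT t:{a..b}. (\<integral>w. k t w \<partial>Q)) = (\<integral>w. (LBINT t:{a..b}. k t w) \<partial>Q)"
    and "integrable Q (\<lambda>w. LBINT t:{a..b}. k t w)"
proof -
  interpret Q: prob_space Q by fact
  interpret pair_sigma_finite lborel Q ..
  have "emeasure (lborel \<Otimes>\<^sub>M Q) ({a..b} \<times> space Q) = emeasure lborel {a..b} * emeasure Q (space Q)"
    by (rule Q.emeasure_pair_measure_Times) auto
  also have "\<dots> < \<infinity>" by (simp add: Q.emeasure_space_1 emeasure_lborel_Icc_eq)
  finally have fin: "emeasure (lborel \<Otimes>\<^sub>M Q) ({a..b} \<times> space Q) < \<infinity>" .
  have "integrable (lborel \<Otimes>\<^sub>M Q) (\<lambda>x. indicator ({a..b} \<times> space Q) x *\<^sub>R (case x of (t, w) \<Rightarrow> k t w))"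
    by (rule integrableI_bounded_set_indicator[OF _ _ fin, where B=B]) (auto intro!: AE_I2 simp: B)
  also have "?this \<longleftrightarrow> integrable (lborel \<Otimes>\<^sub>M Q) (\<lambda>(t, w). indicator {a..b} t *\<^sub>R k t w)"
    by (intro Bochner_Integration.integrable_cong refl) (auto simp: space_pair_measure indicator_def)
  finally have i: "integrable (lborel \<Otimes>\<^sub>M Q) (\<lambda>(t, w). indicator {a..b} t *\<^sub>R k t w)" .
  show "(LBINT t:{a..b}. (\<integral>w. k t w \<partial>Q)) = (\<integral>w. (LBINT t:{a..b}. k t w) \<partial>Q)"
    unfolding set_lebesgue_integral_def using Fubini_integral[OF i] by (simp only: integral_scaleR_right)
  show "integrable Q (\<lambda>w. LBINT t:{a..b}. k t w)"
    unfolding set_lebesgue_integral_def using integrable_snd[OF i] by simp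
qed

lemma LBINT_Icc_FTC:
  fixes F f :: "real \<Rightarrow> real"
  assumes "a \<le> b" "\<And>x. (F has_real_derivative f x) (at x)" "\<And>x. isCont f x"
  shows "(LBINT t:{a..b}. f t) = F b - F a"
  using integral_FTC_Icc_real[of a b F f] assms
  by (simp add: set_lebesgue_integral_def mult.commute)

lemma LBINT_threshold:
  fixes F f :: "real \<Rightarrow> real"
  assumes F: "\<And>x. (F has_real_derivative f x) (at x)" "\<And>x. isCont f x" and u: "a \<le> u" "u \<le> b"
  shows "(LBINT t:{a..b}. f t * of_bool (t \<le> u)) = F u - F a"
    "(LBINT t:{a..b}. f t * of_bool (u \<le> t)) = F b - F u"
proof -
  have "(LBINT t:{a..b}. f t * of_bool (t \<le> u)) = (LBINT t:{a..u}. f t)"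
    unfolding set_lebesgue_integral_def using u by (intro Bochner_Integration.integral_cong) (auto simp: indicator_def)
  then show "(LBINT t:{a..b}. f t * of_bool (t \<le> u)) = F u - F a" using LBINT_Icc_FTC[OF u(1) F] by simp
  have "(LBINT t:{a..b}. f t * of_bool (u \<le> t)) = (LBINT t:{u..b}. f t)"
    unfolding set_lebesgue_integral_def using u by (intro Bochner_Integration.integral_cong) (auto simp: indicator_def)
  then show "(LBINT t:{a..b}. f t * of_bool (u \<le> t)) = F b - F u" using LBINT_Icc_FTC[OF u(2) F] by simp
qed

text \<open>With the indicator lowered by 1 on the negative half, exactly the part of f between 0
  and u survives, with the correct sign for either sign of u. The choices x and x^2 for F produce
  the two Choquet moments.\<close>

lemma LBINT_layer_cake:
  fixes F f :: "real \<Rightarrow> real"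
  assumes F: "\<And>x. (F has_real_derivative f x) (at x)" "\<And>x. isCont f x" and u: "- M \<le> u" "u \<le> M"
  shows "(LBINT t:{0..M}. f t * of_bool (t \<le> u)) + (LBINT t:{-M..0}. f t * (of_bool (t \<le> u) - 1)) = F u - F 0"
proof (cases "0 \<le> u")
  case True
  have "(LBINT t:{-M..0}. f t * (of_bool (t \<le> u) - 1)) = (LBINT t:{-M..0}. 0)"
    unfolding set_lebesgue_integral_def using True by (intro Bochner_Integration.integral_cong) (auto simp: indicator_def)
  then show ?thesis using LBINT_threshold(1)[OF F True u(2)] by (simp add: set_lebesgue_integral_def)
next
  case False
  have "(LBINT t:{0..M}. f t * of_bool (t \<le> u)) = (LBINT t:{0..M}. 0)"
    unfolding set_lebesgue_integral_def using False by (intro Bochner_Integration.integral_cong) (auto simp: indicator_def)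
  \<comment> \<open>The lowered indicator is minus that of u < t, which differs from that of u \<le>
    t only at the single point u.\<close>
  moreover have "(LBINT t:{-M..0}. f t * (of_bool (t \<le> u) - 1)) = (LBINT t:{-M..0}. - (f t * of_bool (u \<le> t)))"
    unfolding set_lebesgue_integral_def
    by (rule integral_discrete_difference[of "{u}"]) (auto simp: indicator_def)
  moreover have "\<dots> = - (F 0 - F u)"
    using LBINT_threshold(2)[OF F u(1), of 0] False by (simp add: set_lebesgue_integral_def)
  ultimately show ?thesis by (simp add: set_lebesgue_integral_def)
qed

lemma expectation_layer_cake:
  fixes F f :: "real \<Rightarrow> real"
  assumes Q: "prob_space Q" and U[measurable]: "U \<in> borel_measurable Q" and M: "AE w in Q. \<bar>U w\<bar> \<le> M"
    and F: "\<And>x. (F has_real_derivative f x) (at x)" "\<And>x. isCont f x"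
  shows "(LBINT t:{0..M}. f t * measure Q {w\<in>space Q. t \<le> U w})
     + (LBINT t:{-M..0}. f t * (measure Q {w\<in>space Q. t \<le> U w} - 1)) = (\<integral>w. F (U w) - F 0 \<partial>Q)"
proof -
  interpret Q: prob_space Q by fact
  have "continuous_on {-M..M} f" using F(2) by (simp add: continuous_at_imp_continuous_on)
  then have "bounded (f ` {-M..M})" by (intro compact_imp_bounded compact_continuous_image) auto
  then obtain B where "\<forall>t\<in>{-M..M}. \<bar>f t\<bar> \<le> B" unfolding bounded_iff by auto
  then have B: "\<bar>f t\<bar> \<le> B" if "t \<in> {-M..M}" for t using that by blast
  have [measurable]: "f \<in> borel_measurable borel" using F(2)
    by (intro borel_measurable_continuous_onI continuous_at_imp_continuous_on) auto
  have p: "(\<integral>w. of_bool (t \<le> U w) \<partial>Q) = measure Q {w\<in>space Q. t \<le> U w}" for t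
  proof -
    have "(\<integral>w. of_bool (t \<le> U w) \<partial>Q) = (\<integral>w. indicator {w\<in>space Q. t \<le> U w} w \<partial>Q)"
      by (intro Bochner_Integration.integral_cong) (auto simp: indicator_def)
    also have "\<dots> = measure Q ({w\<in>space Q. t \<le> U w} \<inter> space Q)"
      by (rule Bochner_Integration.integral_indicator)
    also have "{w\<in>space Q. t \<le> U w} \<inter> space Q = {w\<in>space Q. t \<le> U w}" by auto
    finally show ?thesis .
  qed
  have ib: "integrable Q (\<lambda>w. of_bool (t \<le> U w) :: real)" for t
    by (rule integrable_AE_bounded[OF Q, of _ 1]) auto
  have M0: "0 \<le> M"
  proof -
    have "AE w in Q. 0 \<le> M" using M by eventually_elim auto
    then show ?thesis by simp
  qed
  have fB: "\<bar>f t * c\<bar> \<le> B" if "t \<in> {-M..M}" "\<bar>c\<bar> \<le> 1" for t c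
    using mult_mono[OF B[OF that(1)] that(2)] B[OF that(1)] by (simp add: abs_mult)
  have m: "(\<lambda>(t, w). f t * of_bool (t \<le> U w)) \<in> borel_measurable (lborel \<Otimes>\<^sub>M Q)"
    "(\<lambda>(t, w). f t * (of_bool (t \<le> U w) - 1)) \<in> borel_measurable (lborel \<Otimes>\<^sub>M Q)"
    by measurable
  have b: "\<bar>f t * of_bool (t \<le> U w)\<bar> \<le> B" if "t \<in> {0..M}" for t w
    using that M0 by (intro fB) auto
  have b': "\<bar>f t * (of_bool (t \<le> U w) - 1)\<bar> \<le> B" if "t \<in> {-M..0}" for t w
    using that M0 by (intro fB) auto
  note F1 = set_integral_expectation[OF Q m(1) b] and F2 = set_integral_expectation[OF Q m(2) b']
  have 1: "(LBINT t:{0..M}. f t * measure Q {w\<in>space Q. t \<le> U w}) = (\<integral>w. (LBINT t:{0..M}. f t * of_bool (t \<le> U w)) \<partial>Q)"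
    unfolding p[symmetric] integral_mult_right_zero[symmetric] by (rule F1)
  have e: "f t * (measure Q {w\<in>space Q. t \<le> U w} - 1) = (\<integral>w. f t * (of_bool (t \<le> U w) - 1) \<partial>Q)" for t
    using ib Q.prob_space by (simp add: p)
  have 2: "(LBINT t:{-M..0}. f t * (measure Q {w\<in>space Q. t \<le> U w} - 1)) =
     (\<integral>w. (LBINT t:{-M..0}. f t * (of_bool (t \<le> U w) - 1)) \<partial>Q)"
    unfolding e by (rule F2)
  note i = F1(2) F2(2)
  have "(\<integral>w. (LBINT t:{0..M}. f t * of_bool (t \<le> U w)) \<partial>Q) + (\<integral>w. (LBINT t:{-M..0}. f t * (of_bool (t \<le> U w) - 1)) \<partial>Q)
    = (\<integral>w. (LBINT t:{0..M}. f t * of_bool (t \<le> U w)) + (LBINT t:{-M..0}. f t * (of_bool (t \<le> U w) - 1)) \<partial>Q)"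
    by (rule Bochner_Integration.integral_add[OF i, symmetric])
  also have "\<dots> = (\<integral>w. F (U w) - F 0 \<partial>Q)"
  proof (rule integral_cong_AE)
    have "continuous_on UNIV F" using F(1) by (intro DERIV_continuous_on) auto
    then have [measurable]: "F \<in> borel_measurable borel" by (rule borel_measurable_continuous_onI)
    show "(\<lambda>w. F (U w) - F 0) \<in> borel_measurable Q" by measurable
    show "AE w in Q. (LBINT t:{0..M}. f t * of_bool (t \<le> U w)) + (LBINT t:{-M..0}. f t * (of_bool (t \<le> U w) - 1)) = F (U w) - F 0"
      using M by eventually_elim (rule LBINT_layer_cake[OF F], auto)
    show "(\<lambda>w. (LBINT t:{0..M}. f t * of_bool (t \<le> U w)) + (LBINT t:{-M..0}. f t * (of_bool (t \<le> U w) - 1))) \<in> borel_measurable Q"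
      by (rule borel_measurable_add[OF borel_measurable_integrable[OF i(1)] borel_measurable_integrable[OF i(2)]])
  qed
  finally show ?thesis unfolding 1 2 .
qed

section \<open>Choquet integrals as expectations of envelopes\<close>

text \<open>For fixed w the levels with t1 \<le> U w and V w \<le> t2 form a rectangle with sides U
  w + M and M - V w. As U \<le> V, this rectangle lies in the triangle t1 \<le> t2, so the
  triangular domain of integration loses nothing.\<close>

lemma expectation_cross_layer_cake:
  assumes Q: "prob_space Q" and U[measurable]: "U \<in> borel_measurable Q" and V[measurable]: "V \<in> borel_measurable Q"
    and UV: "\<And>w. w \<in> space Q \<Longrightarrow> U w \<le> V w" and B: "\<And>w. w \<in> space Q \<Longrightarrow> \<bar>U w\<bar> \<le> B"
    and M: "AE w in Q. - M \<le> U w \<and> V w \<le> M"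
  shows "(LBINT t2:{-M..M}. (LBINT t1:{-M..t2}. measure Q {w\<in>space Q. t1 \<le> U w \<and> V w \<le> t2}))
     = (\<integral>w. (U w + M) * (M - V w) \<partial>Q)"
proof -
  interpret Q: prob_space Q by fact
  have M0: "0 \<le> M"
  proof -
    have "AE w in Q. 0 \<le> M" using M AE_space by eventually_elim (use UV in fastforce)
    then show ?thesis by simp
  qed
  have p: "measure Q {w\<in>space Q. t1 \<le> U w \<and> V w \<le> t2} = (\<integral>w. of_bool (t1 \<le> U w) * of_bool (V w \<le> t2) \<partial>Q)" for t1 t2
  proof -
    have "(\<integral>w. of_bool (t1 \<le> U w) * of_bool (V w \<le> t2) \<partial>Q) = (\<integral>w. (indicator {w\<in>space Q. t1 \<le> U w \<and> V w \<le> t2} w :: real) \<partial>Q)"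
      by (intro Bochner_Integration.integral_cong) (auto simp: indicator_def)
    also have "\<dots> = measure Q ({w\<in>space Q. t1 \<le> U w \<and> V w \<le> t2} \<inter> space Q)"
      by (rule Bochner_Integration.integral_indicator)
    also have "{w\<in>space Q. t1 \<le> U w \<and> V w \<le> t2} \<inter> space Q = {w\<in>space Q. t1 \<le> U w \<and> V w \<le> t2}" by auto
    finally show ?thesis ..
  qed
  have inner: "(LBINT t1:{-M..t2}. measure Q {w\<in>space Q. t1 \<le> U w \<and> V w \<le> t2}) =
      (\<integral>w. (U w + M) * of_bool (V w \<le> t2) \<partial>Q)" if t2: "t2 \<in> {-M..M}" for t2
  proof -
    have z: "measure Q {w\<in>space Q. t1 \<le> U w \<and> V w \<le> t2} = 0" if "t2 < t1" for t1
    proof -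
      have "{w\<in>space Q. t1 \<le> U w \<and> V w \<le> t2} = {}" using UV that by fastforce
      then show ?thesis by (simp only: measure_empty)
    qed
    have m: "(\<lambda>(t1, w). of_bool (t1 \<le> U w) * of_bool (V w \<le> t2) :: real) \<in> borel_measurable (lborel \<Otimes>\<^sub>M Q)"
      by measurable
    have b: "\<bar>of_bool (t1 \<le> U w) * of_bool (V w \<le> t2) :: real\<bar> \<le> 1" for t1 w by simp
    note F = set_integral_expectation[OF Q m b]
    have "(LBINT t1:{-M..t2}. measure Q {w\<in>space Q. t1 \<le> U w \<and> V w \<le> t2}) =
       (LBINT t1:{-M..M}. measure Q {w\<in>space Q. t1 \<le> U w \<and> V w \<le> t2})"
      unfolding set_lebesgue_integral_def
    proof (rule Bochner_Integration.integral_cong[OF refl])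
      fix t1
      show "indicator {-M..t2} t1 *\<^sub>R measure Q {w\<in>space Q. t1 \<le> U w \<and> V w \<le> t2} =
        indicator {-M..M} t1 *\<^sub>R measure Q {w\<in>space Q. t1 \<le> U w \<and> V w \<le> t2}"
        using t2 z[of t1] by (cases "t2 < t1") (simp_all only: indicator_def, auto)
    qed
    also have "\<dots> = (\<integral>w. (LBINT t1:{-M..M}. of_bool (t1 \<le> U w) * of_bool (V w \<le> t2)) \<partial>Q)"
      unfolding p by (rule F(1))
    also have "\<dots> = (\<integral>w. (U w + M) * of_bool (V w \<le> t2) \<partial>Q)"
    proof (rule integral_cong_AE)
      show "AE w in Q. (LBINT t1:{-M..M}. of_bool (t1 \<le> U w) * of_bool (V w \<le> t2)) = (U w + M) * of_bool (V w \<le> t2)"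
        using M AE_space
      proof eventually_elim
        case (elim w)
        have "(LBINT t:{-M..M}. 1 * of_bool (t \<le> U w)) = U w - - M"
          using elim UV[of w] by (intro LBINT_threshold(1)[where F="\<lambda>x. x"]) (auto intro!: derivative_eq_intros)
        then show ?case by (simp add: mult.assoc[symmetric])
      qed
    qed (rule borel_measurable_integrable[OF F(2)], measurable)
    finally show ?thesis .
  qed
  have "(LBINT t2:{-M..M}. (LBINT t1:{-M..t2}. measure Q {w\<in>space Q. t1 \<le> U w \<and> V w \<le> t2})) =
     (LBINT t2:{-M..M}. (\<integral>w. (U w + M) * of_bool (V w \<le> t2) \<partial>Q))"
    unfolding set_lebesgue_integral_def[of lborel "{-M..M}"]
    using inner by (intro Bochner_Integration.integral_cong refl) (auto simp: indicator_def)
  \<comment> \<open>Fubini is justified by the everywhere bound B; M bounds the envelopes only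
    almost everywhere.\<close>
  also have "\<dots> = (\<integral>w. (LBINT t2:{-M..M}. (U w + M) * of_bool (V w \<le> t2)) \<partial>Q)"
  proof (rule set_integral_expectation[OF Q])
    fix t w assume "w \<in> space Q"
    then show "\<bar>(U w + M) * of_bool (V w \<le> t)\<bar> \<le> B + M" using B[of w] M0 by auto
  qed measurable
  also have "\<dots> = (\<integral>w. (U w + M) * (M - V w) \<partial>Q)"
  proof (rule integral_cong_AE)
    show "AE w in Q. (LBINT t2:{-M..M}. (U w + M) * of_bool (V w \<le> t2)) = (U w + M) * (M - V w)"
      using M AE_space
    proof eventually_elim
      case (elim w)
      have "(LBINT t:{-M..M}. 1 * of_bool (V w \<le> t)) = M - V w"
        using elim UV[of w] by (intro LBINT_threshold(2)[where F="\<lambda>x. x"]) (auto intro!: derivative_eq_intros)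
      then show ?case by simp
    qed
    show "(\<lambda>w. (U w + M) * (M - V w)) \<in> borel_measurable Q" by measurable
    have "(\<lambda>(t, w). (U w + M) * of_bool (V w \<le> t)) \<in> borel_measurable (lborel \<Otimes>\<^sub>M Q)" by measurable
    from set_integral_expectation(2)[OF Q this, where B="B + M"]
    show "(\<lambda>w. LBINT t2:{-M..M}. (U w + M) * of_bool (V w \<le> t2)) \<in> borel_measurable Q"
      using B M0 by (intro borel_measurable_integrable) force
  qed
  finally show ?thesis .
qed

lemma LBINT_countable_difference:
  fixes g h :: "real \<Rightarrow> real"
  assumes "countable A" "\<And>t. t \<notin> A \<Longrightarrow> g t = h t"
  shows "(LBINT t:S. g t) = (LBINT t:S. h t)"
  unfolding set_lebesgue_integral_def using assms
  by (intro integral_discrete_difference[of A]) auto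

section \<open>Envelopes over compact sets\<close>

definition lower_env :: "('a \<Rightarrow> real) \<Rightarrow> 'a set \<Rightarrow> real" where
  "lower_env f K = (INF x\<in>K. f x)"

definition upper_env :: "('a \<Rightarrow> real) \<Rightarrow> 'a set \<Rightarrow> real" where
  "upper_env f K = (SUP x\<in>K. f x)"

text \<open>These nonstrict bounds are containments in level sets, and containments are the events
  that \<nu> measures. Their strict counterparts fail in general, because a bounded f need not
  attain its extrema on K.\<close>

lemma env_iff:
  assumes "bounded (range f)" "K \<in> compacts"
  shows "t \<le> lower_env f K \<longleftrightarrow> K \<subseteq> {x. t \<le> f x}" "upper_env f K \<le> t \<longleftrightarrow> K \<subseteq> {x. f x \<le> t}"
proof -
  have "bounded (f ` K)" by (rule bounded_subset[OF assms(1)]) auto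
  then have "bdd_below (f ` K)" "bdd_above (f ` K)"
    by (simp_all add: bounded_imp_bdd_below bounded_imp_bdd_above)
  moreover have "K \<noteq> {}" using assms(2) by (simp add: compacts_def)
  ultimately show "t \<le> lower_env f K \<longleftrightarrow> K \<subseteq> {x. t \<le> f x}" "upper_env f K \<le> t \<longleftrightarrow> K \<subseteq> {x. f x \<le> t}"
    unfolding lower_env_def upper_env_def by (auto simp: le_cINF_iff cSUP_le_iff)
qed

lemma env_bounds:
  assumes "bounded (range f)" "K \<in> compacts" "x \<in> K"
  shows "lower_env f K \<le> f x" "f x \<le> upper_env f K"
  using env_iff[OF assms(1,2)] assms(3) by blast+

lemma lower_le_upper_env: "bounded (range f) \<Longrightarrow> K \<in> compacts \<Longrightarrow> lower_env f K \<le> upper_env f K"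
  using env_bounds[of f K] by (auto simp: compacts_def) (meson order_trans ex_in_conv)

lemma abs_env_le:
  assumes "bounded (range f)" "K \<in> compacts" "\<And>x. \<bar>f x\<bar> \<le> B"
  shows "\<bar>lower_env f K\<bar> \<le> B" "\<bar>upper_env f K\<bar> \<le> B"
proof -
  have "- B \<le> lower_env f K" "upper_env f K \<le> B"
    using assms(3) by (auto simp: env_iff[OF assms(1,2)] abs_le_iff minus_le_iff)
  then show "\<bar>lower_env f K\<bar> \<le> B" "\<bar>upper_env f K\<bar> \<le> B"
    using lower_le_upper_env[OF assms(1,2)] by auto
qed

locale choquet_space =
  fixes \<nu> :: "'a::polish_space set \<Rightarrow> real" and P :: "'a set measure"
  assumes choquet: "choquet_measure \<nu> P"
begin

lemma prob_P: "prob_space P" and sets_P: "sets P = sets hyperspace_borel"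
  and nu_sets: "A \<in> sets borel \<Longrightarrow> {K\<in>compacts. K \<subseteq> A} \<in> sets (completion P)"
  and nu_measure: "A \<in> sets borel \<Longrightarrow> measure (completion P) {K\<in>compacts. K \<subseteq> A} = \<nu> A"
  using choquet by (auto simp: choquet_measure_def)

lemma space_P[simp]: "space P = compacts"
  using sets_eq_imp_space_eq[OF sets_P] by (simp add: hyperspace_borel_def space_measure_of_conv)

sublocale Q: prob_space "completion P"
  using prob_P by (rule prob_space.prob_space_completion)

end

locale choquet_variable = choquet_space \<nu> P
  for \<nu> :: "'a::polish_space set \<Rightarrow> real" and P :: "'a set measure" +
  fixes f :: "'a \<Rightarrow> real"
  assumes f_meas[measurable]: "f \<in> borel_measurable borel" and f_bounded: "bounded (range f)"
begin

abbreviation "U \<equiv> lower_env f"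
abbreviation "V \<equiv> upper_env f"
abbreviation "M \<equiv> belief_bound \<nu> f"

lemma U_event: "{K\<in>compacts. t \<le> U K} = {K\<in>compacts. K \<subseteq> {x. t \<le> f x}}"
  and V_event: "{K\<in>compacts. V K \<le> t} = {K\<in>compacts. K \<subseteq> {x. f x \<le> t}}"
  and UV_event: "{K\<in>compacts. t \<le> U K \<and> V K \<le> s} = {K\<in>compacts. K \<subseteq> {x. t \<le> f x \<and> f x \<le> s}}"
  using env_iff[OF f_bounded] by blast+

text \<open>The preimages of generating half-lines are families of compact sets inside a Borel set,
  which are known to lie in the completion only.\<close>

lemma measurable_U[measurable]: "U \<in> borel_measurable (completion P)"
  unfolding borel_measurable_iff_ge by (auto simp: U_event intro!: nu_sets)

lemma measurable_V[measurable]: "V \<in> borel_measurable (completion P)"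
  unfolding borel_measurable_iff_le by (auto simp: V_event intro!: nu_sets)

lemma measure_U: "measure (completion P) {K\<in>space (completion P). t \<le> U K} = \<nu> {x. t \<le> f x}"
  and measure_UV: "measure (completion P) {K\<in>space (completion P). t \<le> U K \<and> V K \<le> s} = \<nu> {x. t \<le> f x \<and> f x \<le> s}"
  by (simp_all add: U_event UV_event nu_measure)

lemma f_bound: "\<exists>B\<ge>0. \<forall>x. \<bar>f x\<bar> \<le> B"
proof -
  obtain B where B: "\<forall>x. \<bar>f x\<bar> \<le> B" using f_bounded unfolding bounded_iff by auto
  moreover have "0 \<le> B" using B[rule_format, of undefined] by linarith
  ultimately show ?thesis by blast
qed

lemma AE_bound_iff: "\<nu> {x. \<bar>f x\<bar> \<le> C} = 1 \<longleftrightarrow> (AE K in completion P. - C \<le> U K \<and> V K \<le> C)"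
proof -
  have "\<nu> {x. \<bar>f x\<bar> \<le> C} = measure (completion P) {K\<in>space (completion P). - C \<le> U K \<and> V K \<le> C}"
    unfolding measure_UV by (simp add: abs_le_iff conj_commute minus_le_iff)
  also have "\<dots> = 1 \<longleftrightarrow> (AE K in completion P. - C \<le> U K \<and> V K \<le> C)"
    by (rule Q.prob_Collect_eq_1) measurable
  finally show ?thesis .
qed

text \<open>The infimum in \<open>belief_bound\<close> is attained: the bounds M + 1/(n + 1) hold
  outside a single null set for all n together, and their limit gives M.\<close>

lemma AE_belief_bound: "AE K in completion P. - M \<le> U K \<and> V K \<le> M"
proof -
  let ?S = "{C. C \<ge> 0 \<and> \<nu> {x. \<bar>f x\<bar> \<le> C} = 1}"
  obtain B where B: "\<And>x. \<bar>f x\<bar> \<le> B" "0 \<le> B" using f_bound by blast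
  have "AE K in completion P. - B \<le> U K \<and> V K \<le> B"
    using AE_space by eventually_elim (use abs_env_le[OF f_bounded _ B(1)] in \<open>auto simp: abs_le_iff minus_le_iff\<close>)
  then have S: "B \<in> ?S" using B(2) AE_bound_iff by simp
  have "AE K in completion P. - (M + 1 / real (Suc n)) \<le> U K \<and> V K \<le> M + 1 / real (Suc n)" for n
  proof -
    have "Inf ?S < M + 1 / real (Suc n)" by (simp add: belief_bound_def)
    then obtain C where C: "C \<in> ?S" "C < M + 1 / real (Suc n)" using S cInf_lessD[of ?S] by blast
    then have "AE K in completion P. - C \<le> U K \<and> V K \<le> C" using AE_bound_iff by simp
    then show ?thesis by eventually_elim (use C(2) in linarith)
  qed
  then have "AE K in completion P. \<forall>n. - (M + 1 / real (Suc n)) \<le> U K \<and> V K \<le> M + 1 / real (Suc n)"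
    by (simp add: AE_all_countable)
  then show ?thesis
  proof eventually_elim
    case (elim K)
    have lim: "(\<lambda>n. M + 1 / real (Suc n)) \<longlonglongrightarrow> M + 0"
      by (intro tendsto_add tendsto_const LIMSEQ_Suc lim_1_over_n)
    have "- U K \<le> M + 1 / real (Suc n)" "V K \<le> M + 1 / real (Suc n)" for n using elim[rule_format, of n] by auto
    then have "- U K \<le> M + 0" "V K \<le> M + 0" by (auto intro!: LIMSEQ_le_const[OF lim] simp del: of_nat_Suc add_0_right)
    then show ?case by auto
  qed
qed

lemma AE_abs_bound: "AE K in completion P. \<bar>U K\<bar> \<le> M" "AE K in completion P. \<bar>V K\<bar> \<le> M"
proof -
  have "AE K in completion P. \<bar>U K\<bar> \<le> M \<and> \<bar>V K\<bar> \<le> M"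
    using AE_belief_bound AE_space by eventually_elim (use lower_le_upper_env[OF f_bounded] in fastforce)
  then show "AE K in completion P. \<bar>U K\<bar> \<le> M" "AE K in completion P. \<bar>V K\<bar> \<le> M"
    by (auto elim: eventually_mono)
qed

text \<open>The conjugate of \<open>\<nu>\<close> and the law of the upper envelope may disagree at the atoms of the latter,
  because the supremum over a compact set need not be attained; there are only countably many.\<close>

lemma conjugate_eq_measure_V:
  "\<exists>A. countable A \<and>
    (\<forall>t. t \<notin> A \<longrightarrow> conjugate \<nu> {x. t \<le> f x} = measure (completion P) {K\<in>space (completion P). t \<le> V K})"
proof (intro exI conjI allI impI)
  let ?A = "{t. measure (distr (completion P) borel V) {t} \<noteq> 0}"
  interpret D: prob_space "distr (completion P) borel V" by (rule Q.prob_space_distr) measurable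
  show "countable ?A" by (rule D.countable_support)
  fix t assume "t \<notin> ?A"
  then have 0: "measure (completion P) {K\<in>space (completion P). V K = t} = 0"
    by (simp add: measure_distr vimage_def Int_def conj_commute)
  have s: "{x. f x < t} \<in> sets borel" by measurable
  \<comment> \<open>The belief event lies between V < t and V \<le> t, which differ by a null event
    when t is not an atom.\<close>
  have lt: "{K\<in>space (completion P). V K < t} \<subseteq> {K\<in>compacts. K \<subseteq> {x. f x < t}}"
    using env_bounds(2)[OF f_bounded] by fastforce
  have le: "{K\<in>compacts. K \<subseteq> {x. f x < t}} \<subseteq> {K\<in>space (completion P). V K < t} \<union> {K\<in>space (completion P). V K = t}"
    using env_iff(2)[OF f_bounded, of _ t] by fastforce
  have "measure (completion P) {K\<in>compacts. K \<subseteq> {x. f x < t}} \<le>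
    measure (completion P) ({K\<in>space (completion P). V K < t} \<union> {K\<in>space (completion P). V K = t})"
    by (rule Q.finite_measure_mono[OF le]) measurable
  also have "\<dots> \<le> measure (completion P) {K\<in>space (completion P). V K < t} + 0"
    unfolding 0[symmetric] by (rule measure_Un_le) measurable
  finally have "\<nu> {x. f x < t} = measure (completion P) {K\<in>space (completion P). V K < t}"
    using Q.finite_measure_mono[OF lt nu_sets[OF s]] by (simp add: nu_measure[OF s])
  moreover have "measure (completion P) {K\<in>space (completion P). \<not> V K < t} = 1 - measure (completion P) {K\<in>space (completion P). V K < t}"
    by (rule Q.prob_neg) measurable
  moreover have "- {x. t \<le> f x} = {x. f x < t}" by auto
  ultimately show "conjugate \<nu> {x. t \<le> f x} = measure (completion P) {K\<in>space (completion P). t \<le> V K}"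
    by (simp add: conjugate_def not_less)
qed

lemma lower_mean_eq: "lower_mean \<nu> f = (\<integral>K. U K \<partial>completion P)"
  using expectation_layer_cake[OF Q.prob_space_axioms measurable_U AE_abs_bound(1), of "\<lambda>x. x" "\<lambda>_. 1"]
  unfolding measure_U lower_mean_def choquet_mean_def by (simp add: DERIV_ident)

lemma lower_variance_eq:
  "choquet_variance M \<nu> f = (\<integral>K. (U K)\<^sup>2 \<partial>completion P) - (lower_mean \<nu> f)\<^sup>2"
proof -
  have "((\<lambda>x :: real. x\<^sup>2) has_real_derivative 2 * x) (at x)" for x by (auto intro!: derivative_eq_intros)
  from expectation_layer_cake[OF Q.prob_space_axioms measurable_U AE_abs_bound(1) this]
  show ?thesis unfolding measure_U choquet_variance_def lower_mean_def by simp
qed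

lemma upper_mean_eq: "upper_mean \<nu> f = (\<integral>K. V K \<partial>completion P)"
proof -
  obtain A where A: "countable A"
    "\<And>t. t \<notin> A \<Longrightarrow> conjugate \<nu> {x. t \<le> f x} = measure (completion P) {K\<in>space (completion P). t \<le> V K}"
    using conjugate_eq_measure_V by blast
  have "(LBINT t:{0..M}. conjugate \<nu> {x. t \<le> f x}) = (LBINT t:{0..M}. measure (completion P) {K\<in>space (completion P). t \<le> V K})"
    by (rule LBINT_countable_difference[OF A(1)]) (rule A(2))
  moreover have "(LBINT t:{-M..0}. conjugate \<nu> {x. t \<le> f x} - 1) = (LBINT t:{-M..0}. measure (completion P) {K\<in>space (completion P). t \<le> V K} - 1)"
    by (rule LBINT_countable_difference[OF A(1)]) (subst A(2), assumption, rule refl)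
  ultimately show ?thesis
    using expectation_layer_cake[OF Q.prob_space_axioms measurable_V AE_abs_bound(2), of "\<lambda>x. x" "\<lambda>_. 1"]
    unfolding upper_mean_def choquet_mean_def by (simp add: DERIV_ident)
qed

lemma upper_variance_eq:
  "choquet_variance M (conjugate \<nu>) f = (\<integral>K. (V K)\<^sup>2 \<partial>completion P) - (upper_mean \<nu> f)\<^sup>2"
proof -
  obtain A where A: "countable A"
    "\<And>t. t \<notin> A \<Longrightarrow> conjugate \<nu> {x. t \<le> f x} = measure (completion P) {K\<in>space (completion P). t \<le> V K}"
    using conjugate_eq_measure_V by blast
  have 1: "(LBINT t:{0..M}. 2 * t * conjugate \<nu> {x. t \<le> f x}) = (LBINT t:{0..M}. 2 * t * measure (completion P) {K\<in>space (completion P). t \<le> V K})"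
    by (rule LBINT_countable_difference[OF A(1)]) (subst A(2), assumption, rule refl)
  have 2: "(LBINT t:{-M..0}. 2 * t * (conjugate \<nu> {x. t \<le> f x} - 1)) = (LBINT t:{-M..0}. 2 * t * (measure (completion P) {K\<in>space (completion P). t \<le> V K} - 1))"
    by (rule LBINT_countable_difference[OF A(1)]) (subst A(2), assumption, rule refl)
  have "((\<lambda>x :: real. x\<^sup>2) has_real_derivative 2 * x) (at x)" for x by (auto intro!: derivative_eq_intros)
  from expectation_layer_cake[OF Q.prob_space_axioms measurable_V AE_abs_bound(2) this]
  show ?thesis unfolding choquet_variance_def upper_mean_def 1 2 by simp
qed

lemma integrable_env:
  "integrable (completion P) U" "integrable (completion P) V" "integrable (completion P) (\<lambda>K. U K * V K)"
  "integrable (completion P) (\<lambda>K. (U K)\<^sup>2)" "integrable (completion P) (\<lambda>K. (V K)\<^sup>2)"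
proof -
  obtain B where B: "\<And>x. \<bar>f x\<bar> \<le> B" "0 \<le> B" using f_bound by blast
  have b: "\<bar>U K\<bar> \<le> B" "\<bar>V K\<bar> \<le> B" if "K \<in> space (completion P)" for K
    using abs_env_le[OF f_bounded _ B(1)] that by auto
  have bb: "\<bar>x * y\<bar> \<le> B * B" if "\<bar>x\<bar> \<le> B" "\<bar>y\<bar> \<le> B" for x y
    unfolding abs_mult using that B by (intro mult_mono) auto
  note I = integrable_AE_bounded[OF Q.prob_space_axioms _ AE_I2]
  show "integrable (completion P) U" "integrable (completion P) V" by (rule I[of _ B]; use b in simp)+
  show "integrable (completion P) (\<lambda>K. U K * V K)" by (rule I[of _ "B * B"]) (measurable, intro bb b)
  show "integrable (completion P) (\<lambda>K. (U K)\<^sup>2)" unfolding power2_eq_square by (rule I[of _ "B * B"]) (measurable, intro bb b)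
  show "integrable (completion P) (\<lambda>K. (V K)\<^sup>2)" unfolding power2_eq_square by (rule I[of _ "B * B"]) (measurable, intro bb b)
qed

text \<open>The double integral is the expectation of (U + M)(M - V). Its expansion cancels all
  terms with M in the numerator and leaves the covariance of the envelopes. When a standard
  deviation vanishes, the left side is 0, hence the case distinction.\<close>

lemma belief_correlation_eq:
  "belief_correlation \<nu> f * (lower_sd \<nu> f * upper_sd \<nu> f) =
     (if lower_sd \<nu> f * upper_sd \<nu> f = 0 then 0
      else (\<integral>K. U K * V K \<partial>completion P) - lower_mean \<nu> f * upper_mean \<nu> f)"
proof -
  obtain B where B: "\<And>x. \<bar>f x\<bar> \<le> B" "0 \<le> B" using f_bound by blast
  have "(LBINT t2:{-M..M}. (LBINT t1:{-M..t2}. \<nu> {x. t1 \<le> f x \<and> f x \<le> t2})) = (\<integral>K. (U K + M) * (M - V K) \<partial>completion P)"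
    unfolding measure_UV[symmetric]
  proof (rule expectation_cross_layer_cake[OF Q.prob_space_axioms measurable_U measurable_V _ _ AE_belief_bound])
    show "U K \<le> V K" if "K \<in> space (completion P)" for K using lower_le_upper_env[OF f_bounded] that by simp
    show "\<bar>U K\<bar> \<le> B" if "K \<in> space (completion P)" for K using abs_env_le[OF f_bounded _ B(1)] that by simp
  qed
  also have "(\<lambda>K. (U K + M) * (M - V K)) = (\<lambda>K. M\<^sup>2 + M * U K - M * V K - U K * V K)"
    by (simp add: fun_eq_iff power2_eq_square algebra_simps)
  also have "(\<integral>K. M\<^sup>2 + M * U K - M * V K - U K * V K \<partial>completion P) =
     M\<^sup>2 + M * lower_mean \<nu> f - M * upper_mean \<nu> f - (\<integral>K. U K * V K \<partial>completion P)"
    using integrable_env Q.prob_space by (simp add: lower_mean_eq upper_mean_eq)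
  finally show ?thesis unfolding belief_correlation_def Let_def by simp
qed

end

section \<open>The i.i.d. product belief measure\<close>

lemma env_approx:
  assumes f: "bounded (range f)" and K: "K \<in> compacts" and d: "0 < d"
  shows "\<exists>x\<in>K. f x \<le> lower_env f K + d" "\<exists>x\<in>K. upper_env f K - d \<le> f x"
proof -
  have "\<not> lower_env f K + d \<le> lower_env f K" using d by simp
  then show "\<exists>x\<in>K. f x \<le> lower_env f K + d"
    unfolding env_iff(1)[OF f K] by force
  have "\<not> upper_env f K \<le> upper_env f K - d" using d by simp
  then show "\<exists>x\<in>K. upper_env f K - d \<le> f x"
    unfolding env_iff(2)[OF f K] by force
qed

text \<open>In a product set the coordinates vary independently, so the extreme values of the sum
  are the sums of the extreme values. As these may not be attained, a point within d of the extremum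
  is chosen in every factor.\<close>

lemma Pi_subset_sum_iff:
  fixes Y :: "nat \<Rightarrow> 'a::metric_space \<Rightarrow> real"
  assumes Y: "\<And>i. bounded (range (Y i))" and Ks: "\<And>i. Ks i \<in> compacts"
  shows "Pi UNIV Ks \<subseteq> {\<omega>. c1 \<le> (\<Sum>i<n. Y i (\<omega> i)) \<and> (\<Sum>i<n. Y i (\<omega> i)) \<le> c2} \<longleftrightarrow>
     c1 \<le> (\<Sum>i<n. lower_env (Y i) (Ks i)) \<and> (\<Sum>i<n. upper_env (Y i) (Ks i)) \<le> c2"
    (is "?L \<longleftrightarrow> ?R")
proof
  assume ?R
  show ?L
  proof
    fix \<omega> assume "\<omega> \<in> Pi UNIV Ks"
    then have w: "\<omega> i \<in> Ks i" for i by auto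
    have "(\<Sum>i<n. lower_env (Y i) (Ks i)) \<le> (\<Sum>i<n. Y i (\<omega> i))" "(\<Sum>i<n. Y i (\<omega> i)) \<le> (\<Sum>i<n. upper_env (Y i) (Ks i))"
      by (intro sum_mono env_bounds[OF Y Ks w])+
    then show "\<omega> \<in> {\<omega>. c1 \<le> (\<Sum>i<n. Y i (\<omega> i)) \<and> (\<Sum>i<n. Y i (\<omega> i)) \<le> c2}" using \<open>?R\<close> by auto
  qed
next
  assume L: ?L
  show ?R
  proof
    show "c1 \<le> (\<Sum>i<n. lower_env (Y i) (Ks i))"
    proof (rule field_le_epsilon)
      fix e :: real assume e: "0 < e"
      \<comment> \<open>Dividing by n + 1 instead of n keeps d positive for n = 0.\<close>
      define d where "d = e / (real n + 1)"
      have d: "0 < d" "real n * d \<le> e" using e by (auto simp: d_def field_simps)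
      have "\<forall>i. \<exists>x\<in>Ks i. Y i x \<le> lower_env (Y i) (Ks i) + d" using env_approx(1)[OF Y Ks d(1)] by blast
      then obtain \<omega> where w: "\<And>i. \<omega> i \<in> Ks i \<and> Y i (\<omega> i) \<le> lower_env (Y i) (Ks i) + d" by metis
      then have "\<omega> \<in> Pi UNIV Ks" by auto
      then have "c1 \<le> (\<Sum>i<n. Y i (\<omega> i))" using L by auto
      also have "\<dots> \<le> (\<Sum>i<n. lower_env (Y i) (Ks i) + d)" using w by (intro sum_mono) auto
      also have "\<dots> \<le> (\<Sum>i<n. lower_env (Y i) (Ks i)) + e" using d by (simp add: sum.distrib)
      finally show "c1 \<le> (\<Sum>i<n. lower_env (Y i) (Ks i)) + e" .
    qed
    show "(\<Sum>i<n. upper_env (Y i) (Ks i)) \<le> c2"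
    proof (rule field_le_epsilon)
      fix e :: real assume e: "0 < e"
      define d where "d = e / (real n + 1)"
      have d: "0 < d" "real n * d \<le> e" using e by (auto simp: d_def field_simps)
      have "\<forall>i. \<exists>x\<in>Ks i. upper_env (Y i) (Ks i) - d \<le> Y i x" using env_approx(2)[OF Y Ks d(1)] by blast
      then obtain \<omega> where w: "\<And>i. \<omega> i \<in> Ks i \<and> upper_env (Y i) (Ks i) - d \<le> Y i (\<omega> i)" by metis
      then have "\<omega> \<in> Pi UNIV Ks" by auto
      then have c2: "(\<Sum>i<n. Y i (\<omega> i)) \<le> c2" using L by auto
      have "(\<Sum>i<n. upper_env (Y i) (Ks i)) \<le> (\<Sum>i<n. Y i (\<omega> i) + d)"
        using w by (intro sum_mono) (simp add: diff_le_eq)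
      also have "\<dots> \<le> c2 + e" using d c2 by (simp add: sum.distrib)
      finally show "(\<Sum>i<n. upper_env (Y i) (Ks i)) \<le> c2 + e" .
    qed
  qed
qed

section \<open>The joint law of the two envelopes\<close>

text \<open>In the product order of the plane a set \<open>{..x}\<close> is a quadrant; quadrants
  are closed under intersection and generate the Borel sets.\<close>

lemma borel_prob_eqI_atMost:
  assumes "borel_prob M" "borel_prob N" and eq: "\<And>x. measure M {..x} = measure N {..x}"
  shows "M = N"
proof (rule measure_eqI_generator_eq)
  interpret M: prob_space M using assms(1) by (simp add: borel_prob_def)
  interpret N: prob_space N using assms(2) by (simp add: borel_prob_def)
  let ?E = "range (\<lambda>a :: real \<times> real. {..a})"
  have "{..a} \<inter> {..b} \<in> ?E" for a b :: "real \<times> real"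
  proof -
    have "{..a} \<inter> {..b} = {..inf a b}" by auto
    then show ?thesis by blast
  qed
  then show "Int_stable ?E" unfolding Int_stable_def by auto
  have "sets borel = sigma_sets UNIV ?E" unfolding borel_eq_atMost by (rule sets_measure_of) auto
  then show "sets M = sigma_sets UNIV ?E" "sets N = sigma_sets UNIV ?E"
    using assms(1,2) by (simp_all add: borel_prob_def)
  show "emeasure M X = emeasure N X" if "X \<in> ?E" for X
    using that eq by (auto simp: M.emeasure_eq_measure N.emeasure_eq_measure)
  show "range (\<lambda>n. {..(real n, real n)}) \<subseteq> ?E" by auto
  show "(\<Union>n. {..(real n, real n)}) = UNIV"
  proof -
    have "\<exists>n. a \<le> real n \<and> b \<le> real n" for a b :: real
      using real_arch_simple[of "max a b"] by auto
    then show ?thesis by auto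
  qed
  show "emeasure M {..(real i, real i)} \<noteq> \<infinity>" for i by simp
qed simp

context choquet_variable
begin

text \<open>The sign at the infimum turns both constraints into upper bounds, so that the event of
  the theorem becomes a quadrant.\<close>

definition law :: "(real \<times> real) measure" where
  "law = distr (completion P) borel (\<lambda>K. (- U K, V K))"

lemma measurable_env_pair[measurable]: "(\<lambda>K. (- U K, V K)) \<in> completion P \<rightarrow>\<^sub>M borel"
  by (intro borel_measurable_Pair) measurable

lemma borel_prob_law: "borel_prob law"
  unfolding law_def by (intro borel_prob_distr Q.prob_space_axioms) measurable

text \<open>Quadrants correspond to closed intervals of values of f. Identical distribution, a
  condition on intervals only, therefore already determines the joint law of infimum and
  supremum.\<close>

lemma measure_law: "measure law {..x} = \<nu> {y. - fst x \<le> f y \<and> f y \<le> snd x}"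
proof -
  have "measure law {..x} = measure (completion P) ((\<lambda>K. (- U K, V K)) -` {..x} \<inter> space (completion P))"
    unfolding law_def by (rule measure_distr) auto
  also have "(\<lambda>K. (- U K, V K)) -` {..x} \<inter> space (completion P) =
      {K\<in>space (completion P). - fst x \<le> U K \<and> V K \<le> snd x}"
    by (auto simp: less_eq_prod_def)
  finally show ?thesis unfolding measure_UV .
qed

text \<open>\<open>iid_product_belief\<close> completes the product of copies of \<open>P\<close>
  and does not multiply completions, so the coordinate functions must be measurable for
  \<open>P\<close> itself before the product is formed.\<close>

lemma env_borel_versions:
  "\<exists>u v. u \<in> borel_measurable P \<and> v \<in> borel_measurable P \<and> (AE K in P. U K = u K \<and> V K = v K)"
proof -
  obtain u where u: "u \<in> borel_measurable P" "AE K in P. U K = u K"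
    using completion_ex_borel_measurable_real[OF measurable_U] by blast
  obtain v where v: "v \<in> borel_measurable P" "AE K in P. V K = v K"
    using completion_ex_borel_measurable_real[OF measurable_V] by blast
  from u(2) v(2) have "AE K in P. U K = u K \<and> V K = v K" by eventually_elim simp
  then show ?thesis using u(1) v(1) by blast
qed

end

text \<open>Outside a countable union of null events, one for each coordinate, all envelopes equal
  their Borel versions, and containment of the product set becomes a quadrant event for a sum of
  independent vectors with law \<gamma>.\<close>

lemma (in choquet_space) iid_product_belief_eq_avg:
  fixes Y :: "nat \<Rightarrow> 'a \<Rightarrow> real" and A :: "real \<times> real \<Rightarrow> real \<times> real"
  assumes Y: "\<And>i. choquet_variable \<nu> P (Y i)"
    and law: "\<And>i. distr (choquet_variable.law P (Y i)) borel A = \<gamma>"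
    and A: "A = (\<lambda>x. ((fst x + m1) / s1, (snd x - m2) / s2))" and s: "0 < s1" "0 < s2"
  shows "iid_product_belief P {\<omega>. \<alpha>1 * sqrt n * s1 + n * m1 \<le> (\<Sum>i<n. Y i (\<omega> i)) \<and>
        (\<Sum>i<n. Y i (\<omega> i)) \<le> \<alpha>2 * sqrt n * s2 + n * m2}
     = (avg \<gamma> ^^ n) (quadrant (sqrt n * - \<alpha>1) (sqrt n * \<alpha>2)) 0"
proof -
  let ?a = "sqrt n * - \<alpha>1" and ?b = "sqrt n * \<alpha>2"
  let ?c1 = "\<alpha>1 * sqrt n * s1 + n * m1" and ?c2 = "\<alpha>2 * sqrt n * s2 + n * m2"
  let ?N = "\<Pi>\<^sub>M i\<in>(UNIV :: nat set). P"
  have Yb: "bounded (range (Y i))" for i using Y by (rule choquet_variable.f_bounded)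
  have "\<forall>i. \<exists>u v. u \<in> borel_measurable P \<and> v \<in> borel_measurable P \<and>
      (AE K in P. lower_env (Y i) K = u K \<and> upper_env (Y i) K = v K)"
    by (intro allI choquet_variable.env_borel_versions[OF Y])
  from choice[OF this] obtain u where "\<forall>i. \<exists>v. u i \<in> borel_measurable P \<and> v \<in> borel_measurable P \<and>
      (AE K in P. lower_env (Y i) K = u i K \<and> upper_env (Y i) K = v K)" by blast
  from choice[OF this] obtain v where "\<forall>i. u i \<in> borel_measurable P \<and> v i \<in> borel_measurable P \<and>
      (AE K in P. lower_env (Y i) K = u i K \<and> upper_env (Y i) K = v i K)" by blast
  then have [measurable]: "\<And>i. u i \<in> borel_measurable P" "\<And>i. v i \<in> borel_measurable P"
    and uv: "\<And>i. AE K in P. lower_env (Y i) K = u i K \<and> upper_env (Y i) K = v i K"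
    by blast+
  have Am[measurable]: "A \<in> borel_measurable borel" unfolding A by (intro borel_measurable_Pair) measurable
  define W where "W i K = A (- u i K, v i K)" for i K
  have pm: "(\<lambda>K. (- u i K, v i K)) \<in> P \<rightarrow>\<^sub>M borel" for i by (intro borel_measurable_Pair) measurable
  have Wm: "W i \<in> P \<rightarrow>\<^sub>M borel" for i unfolding W_def by (rule measurable_compose[OF pm Am])
  have Wlaw: "distr P borel (W i) = \<gamma>" for i
  proof -
    interpret choquet_variable \<nu> P "Y i" by (rule Y)
    have pm': "(\<lambda>K. (- u i K, v i K)) \<in> completion P \<rightarrow>\<^sub>M borel" by (rule measurable_completion[OF pm])
    have "AE K in completion P. (- u i K, v i K) = (- U K, V K)"
      using uv[of i] unfolding AE_completion_iff by eventually_elim simp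
    then have "law = distr (completion P) borel (\<lambda>K. (- u i K, v i K))"
      unfolding law_def by (intro distr_cong_AE[symmetric] refl pm' measurable_env_pair)
    also have "\<dots> = distr P borel (\<lambda>K. (- u i K, v i K))" by (rule distr_completion[OF pm])
    finally have "\<gamma> = distr (distr P borel (\<lambda>K. (- u i K, v i K))) borel A" using law[of i] by simp
    also have "\<dots> = distr P borel (W i)" unfolding W_def by (subst distr_distr[OF Am pm]) (simp add: comp_def)
    finally show ?thesis ..
  qed
  let ?E = "{Ks :: nat \<Rightarrow> 'a set. (\<forall>i. Ks i \<in> compacts) \<and>
     Pi UNIV Ks \<subseteq> {\<omega>. ?c1 \<le> (\<Sum>i<n. Y i (\<omega> i)) \<and> (\<Sum>i<n. Y i (\<omega> i)) \<le> ?c2}}"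
  let ?S = "{Ks\<in>space ?N. quadrant ?a ?b (0 + (\<Sum>i<n. W i (Ks i))) = 1}"
  have Qm: "(\<lambda>Ks. quadrant ?a ?b (0 + (\<Sum>i<n. W i (Ks i)))) \<in> borel_measurable ?N"
    by (rule measurable_sum_coordinates[OF Wm bounded_borelD(2)[OF bounded_borel_quadrant]]) simp
  then have S: "?S \<in> sets ?N" by measurable
  interpret N: prob_space ?N by (intro prob_space_PiM prob_P)
  have spN: "space ?N = {Ks. \<forall>i. Ks i \<in> compacts}" by (auto simp: space_PiM)
  have "AE Ks in ?N. \<forall>i. lower_env (Y i) (Ks i) = u i (Ks i) \<and> upper_env (Y i) (Ks i) = v i (Ks i)"
    unfolding AE_all_countable by (intro allI AE_PiM_component[OF prob_P _ uv]) auto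
  then have ae: "AE Ks in ?N. Ks \<in> ?S \<longleftrightarrow> Ks \<in> ?E"
    using AE_space
  proof eventually_elim
    case (elim Ks)
    then have Ks: "\<And>i. Ks i \<in> compacts" by (simp add: spN)
    have fs: "fst (\<Sum>i<n. W i (Ks i)) = (n * m1 - (\<Sum>i<n. lower_env (Y i) (Ks i))) / s1"
      using elim(1) by (simp add: fst_sum W_def A sum_divide_distrib[symmetric] sum_subtractf)
    have sn: "snd (\<Sum>i<n. W i (Ks i)) = ((\<Sum>i<n. upper_env (Y i) (Ks i)) - n * m2) / s2"
      using elim(1) by (simp add: snd_sum W_def A sum_divide_distrib[symmetric] sum_subtractf)
    have "fst (\<Sum>i<n. W i (Ks i)) \<le> ?a \<longleftrightarrow> ?c1 \<le> (\<Sum>i<n. lower_env (Y i) (Ks i))"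
      unfolding fs using s(1) by (auto simp: divide_le_eq algebra_simps)
    moreover have "snd (\<Sum>i<n. W i (Ks i)) \<le> ?b \<longleftrightarrow> (\<Sum>i<n. upper_env (Y i) (Ks i)) \<le> ?c2"
      unfolding sn using s(2) by (auto simp: divide_le_eq algebra_simps)
    ultimately show ?case
      using elim(2) Pi_subset_sum_iff[of Y Ks ?c1 n ?c2, OF Yb Ks] Ks by (simp add: quadrant_def)
  qed
  have ae': "AE Ks in completion ?N. Ks \<in> ?S \<longleftrightarrow> Ks \<in> ?E"
    using ae unfolding AE_completion_iff .
  have S': "?S \<in> sets (completion ?N)" by (rule sets_completionI_sets[OF S])
  have "?E \<subseteq> space (completion ?N)" unfolding space_completion spN by auto
  \<comment> \<open>The measurability of \<open>?E\<close> comes from completeness: it agrees almost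
    everywhere with the measurable event \<open>?S\<close>.\<close>
  from completion.in_sets_AE[OF ae' S' this]
  have E': "?E \<in> sets (completion ?N)" .
  have "iid_product_belief P {\<omega>. ?c1 \<le> (\<Sum>i<n. Y i (\<omega> i)) \<and> (\<Sum>i<n. Y i (\<omega> i)) \<le> ?c2} = measure (completion ?N) ?E"
    by (simp add: iid_product_belief_def)
  also have "\<dots> = measure (completion ?N) ?S"
    using ae' by (intro measure_eq_AE E' S') auto
  also have "\<dots> = measure ?N ?S" using S by (rule measure_completion)
  also have "\<dots> = (\<integral>Ks. indicator ?S Ks \<partial>?N)"
    by (simp only: Bochner_Integration.integral_indicator) (simp only: sets.Int_space_eq2[OF S])
  also have "\<dots> = (\<integral>Ks. quadrant ?a ?b (\<Sum>i<n. W i (Ks i)) \<partial>?N)"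
    by (intro Bochner_Integration.integral_cong refl) (auto simp: indicator_def quadrant_def)
  also have "\<dots> = (avg \<gamma> ^^ n) (quadrant ?a ?b) 0"
    by (rule integral_PiM_UNIV_sum[OF prob_P Wm Wlaw bounded_borel_quadrant])
  finally show ?thesis .
qed

section \<open>Standardised envelopes and the final estimate\<close>

theorem theorem4p2:
  fixes \<nu> :: "'a::polish_space set \<Rightarrow> real"
    and P :: "'a set measure"
    and Y :: "nat \<Rightarrow> 'a \<Rightarrow> real"
    and X :: "nat \<Rightarrow> (nat \<Rightarrow> 'a) \<Rightarrow> real"
    and k :: nat
    and \<mu>l \<mu>u \<sigma>l \<sigma>u \<rho> :: real
  assumes "belief_measure \<nu>"
    and "choquet_measure \<nu> P"
    and "\<And>i. Y i \<in> borel_measurable borel"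
    and "\<And>i. bounded (range (Y i))"
    and "identically_distributed_wrt \<nu> Y"
  defines "X \<equiv> \<lambda>i \<omega>. Y i (\<omega> i)"
    and "\<mu>l \<equiv> lower_mean \<nu> (Y k)"
    and "\<mu>u \<equiv> upper_mean \<nu> (Y k)"
    and "\<sigma>l \<equiv> lower_sd \<nu> (Y k)"
    and "\<sigma>u \<equiv> upper_sd \<nu> (Y k)"
    and "\<rho> \<equiv> belief_correlation \<nu> (Y k)"
  assumes "\<sigma>l > 0" and "\<sigma>u > 0"
  shows "\<exists>C :: real.
    (\<forall>\<alpha>1 \<alpha>2 :: real. \<forall>n :: nat. n \<ge> 1 \<longrightarrow>
       \<bar>iid_product_belief P
          {\<omega>. \<alpha>1 * sqrt n * \<sigma>l + n * \<mu>l \<le> (\<Sum>i<n. X i \<omega>) \<and>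
              (\<Sum>i<n. X i \<omega>) \<le> \<alpha>2 * sqrt n * \<sigma>u + n * \<mu>u}
        - bivariate_normal_cdf (- \<alpha>1) \<alpha>2 (- \<rho>)\<bar> \<le> C / sqrt n) \<and>
    (\<forall>\<alpha>1 \<alpha>2 :: nat \<Rightarrow> real. \<forall>n :: nat. n \<ge> 1 \<longrightarrow>
       \<bar>iid_product_belief P
          {\<omega>. \<alpha>1 n * sqrt n * \<sigma>l + n * \<mu>l \<le> (\<Sum>i<n. X i \<omega>) \<and>
              (\<Sum>i<n. X i \<omega>) \<le> \<alpha>2 n * sqrt n * \<sigma>u + n * \<mu>u}
        - bivariate_normal_cdf (- \<alpha>1 n) (\<alpha>2 n) (- \<rho>)\<bar> \<le> C / sqrt n)"
proof -
  have cs: "choquet_space \<nu> P" by unfold_locales (rule assms(2))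
  have cv: "choquet_variable \<nu> P (Y i)" for i
    by (intro choquet_variable.intro cs choquet_variable_axioms.intro assms(3,4))
  interpret choquet_variable \<nu> P "Y k" by (rule cv)
  note pos = \<open>\<sigma>l > 0\<close> \<open>\<sigma>u > 0\<close>
  let ?A = "\<lambda>x :: real \<times> real. ((fst x + \<mu>l) / \<sigma>l, (snd x - \<mu>u) / \<sigma>u)"
  have Am: "?A \<in> borel_measurable borel" by (intro borel_measurable_Pair) measurable
  \<comment> \<open>The pair (-U, V) is normalised to means 0 and variances 1. The sign turns the
    lower bound with \<alpha>1 into an upper bound with -\<alpha>1 and the correlation \<rho> into
    -\<rho>.\<close>
  define X1 where "X1 K = (- U K + \<mu>l) / \<sigma>l" for K
  define X2 where "X2 K = (V K - \<mu>u) / \<sigma>u" for K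
  define \<gamma> where "\<gamma> = distr (completion P) borel (\<lambda>K. (X1 K, X2 K))"
  have law_eq: "choquet_variable.law P (Y i) = law" for i
  proof (rule borel_prob_eqI_atMost[OF choquet_variable.borel_prob_law[OF cv] borel_prob_law])
    fix x :: "real \<times> real"
    have "\<nu> {y. Y i y \<in> {- fst x..snd x}} = \<nu> {y. Y k y \<in> {- fst x..snd x}}"
      using assms(5) is_interval_cc unfolding identically_distributed_wrt_def by blast
    then show "measure (choquet_variable.law P (Y i)) {..x} = measure law {..x}"
      unfolding choquet_variable.measure_law[OF cv] by simp
  qed
  have \<gamma>_law: "distr (choquet_variable.law P (Y i)) borel ?A = \<gamma>" for i
    unfolding law_eq[of i] unfolding law_def \<gamma>_def
    by (subst distr_distr[OF Am measurable_env_pair]) (simp add: comp_def X1_def X2_def)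
  have [measurable]: "X1 \<in> borel_measurable (completion P)" "X2 \<in> borel_measurable (completion P)"
    unfolding X1_def X2_def by measurable
  have sl: "\<sigma>l\<^sup>2 = (\<integral>K. (U K)\<^sup>2 \<partial>completion P) - \<mu>l\<^sup>2" and su: "\<sigma>u\<^sup>2 = (\<integral>K. (V K)\<^sup>2 \<partial>completion P) - \<mu>u\<^sup>2"
    using pos unfolding \<sigma>l_def \<sigma>u_def lower_sd_def upper_sd_def lower_variance_eq upper_variance_eq \<mu>l_def \<mu>u_def
    by simp_all
  have ml: "\<mu>l = (\<integral>K. U K \<partial>completion P)" and mu: "\<mu>u = (\<integral>K. V K \<partial>completion P)"
    unfolding \<mu>l_def \<mu>u_def by (rule lower_mean_eq upper_mean_eq)+
  have rho: "\<rho> * (\<sigma>l * \<sigma>u) = (\<integral>K. U K * V K \<partial>completion P) - \<mu>l * \<mu>u"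
    using belief_correlation_eq pos unfolding \<rho>_def \<sigma>l_def \<sigma>u_def \<mu>l_def \<mu>u_def by simp
  have mean: "(\<integral>K. X1 K \<partial>completion P) = 0" "(\<integral>K. X2 K \<partial>completion P) = 0"
    using integrable_env Q.prob_space unfolding X1_def X2_def by (simp_all add: ml mu)
  have sq1: "(X1 K)\<^sup>2 = ((U K)\<^sup>2 - 2 * \<mu>l * U K + \<mu>l\<^sup>2) / \<sigma>l\<^sup>2" for K
    unfolding X1_def power_divide by (simp add: power2_eq_square algebra_simps)
  have var1: "(\<integral>K. (X1 K)\<^sup>2 \<partial>completion P) = 1"
  proof -
    have "(\<integral>K. (U K)\<^sup>2 - 2 * \<mu>l * U K + \<mu>l\<^sup>2 \<partial>completion P) = (\<integral>K. (U K)\<^sup>2 \<partial>completion P) - 2 * \<mu>l * \<mu>l + \<mu>l\<^sup>2"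
      using integrable_env Q.prob_space by (simp add: ml[symmetric])
    also have "\<dots> = \<sigma>l\<^sup>2" unfolding sl by (simp add: power2_eq_square)
    finally show ?thesis using pos by (simp add: sq1)
  qed
  have sq2: "(X2 K)\<^sup>2 = ((V K)\<^sup>2 - 2 * \<mu>u * V K + \<mu>u\<^sup>2) / \<sigma>u\<^sup>2" for K
    unfolding X2_def power_divide by (simp add: power2_eq_square algebra_simps)
  have var2: "(\<integral>K. (X2 K)\<^sup>2 \<partial>completion P) = 1"
  proof -
    have "(\<integral>K. (V K)\<^sup>2 - 2 * \<mu>u * V K + \<mu>u\<^sup>2 \<partial>completion P) = (\<integral>K. (V K)\<^sup>2 \<partial>completion P) - 2 * \<mu>u * \<mu>u + \<mu>u\<^sup>2"
      using integrable_env Q.prob_space by (simp add: mu[symmetric])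
    also have "\<dots> = \<sigma>u\<^sup>2" unfolding su by (simp add: power2_eq_square)
    finally show ?thesis using pos by (simp add: sq2)
  qed
  have "X1 K * X2 K = (\<mu>l * V K + \<mu>u * U K - U K * V K - \<mu>l * \<mu>u) / (\<sigma>l * \<sigma>u)" for K
    unfolding X1_def X2_def by (simp add: algebra_simps add_divide_distrib diff_divide_distrib)
  then have "(\<integral>K. X1 K * X2 K \<partial>completion P) = - (\<rho> * (\<sigma>l * \<sigma>u)) / (\<sigma>l * \<sigma>u)"
    unfolding rho using integrable_env Q.prob_space by (simp add: ml[symmetric] mu[symmetric])
  then have cov: "(\<integral>K. X1 K * X2 K \<partial>completion P) = - \<rho>" using pos by simp
  let ?B = "max ((M + \<bar>\<mu>l\<bar>) / \<sigma>l) ((M + \<bar>\<mu>u\<bar>) / \<sigma>u)"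
  have bd1: "AE K in completion P. \<bar>X1 K\<bar> \<le> ?B"
    using AE_abs_bound(1)
  proof eventually_elim
    case (elim K)
    then have "\<bar>X1 K\<bar> \<le> (M + \<bar>\<mu>l\<bar>) / \<sigma>l" unfolding X1_def using pos by (simp add: abs_divide divide_right_mono)
    then show ?case by simp
  qed
  have bd2: "AE K in completion P. \<bar>X2 K\<bar> \<le> ?B"
    using AE_abs_bound(2)
  proof eventually_elim
    case (elim K)
    then have "\<bar>X2 K\<bar> \<le> (M + \<bar>\<mu>u\<bar>) / \<sigma>u" unfolding X2_def using pos by (simp add: abs_divide divide_right_mono)
    then show ?case by simp
  qed
  let ?r = "- \<rho>" and ?q = "sqrt (1 - (- \<rho>)\<^sup>2)"
  let ?L = "\<lambda>w :: real \<times> real. (fst w, ?r * fst w + ?q * snd w)"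
  obtain \<mu> where \<mu>: "isotropic \<mu>" and rq: "?r\<^sup>2 + ?q\<^sup>2 = 1" and lift: "distr \<mu> borel ?L = \<gamma>"
    unfolding \<gamma>_def
    using isotropic_lift[OF Q.prob_space_axioms _ _ bd1 bd2 mean var1 var2 cov] by auto
  obtain C where C: "\<And>n a b z. 1 \<le> n \<Longrightarrow>
      \<bar>(avg \<mu> ^^ n) (wedge ?r ?q a b) z - avg (gauss n) (wedge ?r ?q a b) z\<bar> \<le> C / sqrt n"
    using berry_esseen_wedge[OF \<mu> rq] by blast
  have "\<bar>iid_product_belief P {\<omega>. \<alpha>1 * sqrt n * \<sigma>l + n * \<mu>l \<le> (\<Sum>i<n. X i \<omega>) \<and> (\<Sum>i<n. X i \<omega>) \<le> \<alpha>2 * sqrt n * \<sigma>u + n * \<mu>u}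
      - bivariate_normal_cdf (- \<alpha>1) \<alpha>2 (- \<rho>)\<bar> \<le> C / sqrt n" if n: "1 \<le> n" for \<alpha>1 \<alpha>2 :: real and n :: nat
  proof -
    let ?a = "sqrt n * - \<alpha>1" and ?b = "sqrt n * \<alpha>2"
    have L: "?L \<in> borel_measurable borel" by (intro borel_measurable_Pair) measurable
    have \<mu>': "borel_prob \<mu>" using \<mu> by (simp add: isotropic_def)
    have w: "wedge ?r ?q ?a ?b = (\<lambda>w. quadrant ?a ?b (?L w))" by (simp add: fun_eq_iff wedge_def quadrant_def)
    have "(avg \<mu> ^^ n) (wedge ?r ?q ?a ?b) 0 = (avg \<gamma> ^^ n) (quadrant ?a ?b) (?L 0)"
      unfolding w lift[symmetric]
      by (rule avg_power_distr[OF \<mu>' L bounded_borel_quadrant]) (simp add: algebra_simps)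
    also have "?L 0 = 0" by (simp add: zero_prod_def)
    also have "(avg \<gamma> ^^ n) (quadrant ?a ?b) 0 = iid_product_belief P {\<omega>. \<alpha>1 * sqrt n * \<sigma>l + n * \<mu>l \<le> (\<Sum>i<n. X i \<omega>) \<and> (\<Sum>i<n. X i \<omega>) \<le> \<alpha>2 * sqrt n * \<sigma>u + n * \<mu>u}"
      unfolding X_def by (rule choquet_space.iid_product_belief_eq_avg[OF cs cv \<gamma>_law refl pos, symmetric])
    finally have eq: "(avg \<mu> ^^ n) (wedge ?r ?q ?a ?b) 0 = \<dots>" .
    have "avg (gauss n) (wedge ?r ?q ?a ?b) 0 = bivariate_normal_cdf (- \<alpha>1) \<alpha>2 ?r"
      using n by (intro avg_gauss_wedge_eq_cdf) simp
    then show ?thesis using C[OF n, of ?a ?b 0] unfolding eq by simp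
  qed
  \<comment> \<open>C was fixed before \<alpha>1, \<alpha>2 and n, so the version with sequences is
    the same estimate read at each n.\<close>
  then show ?thesis by blast
qed

end
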